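(* Let $d,r\ge1$ be integers with $d>2r$, let $\sigma\ge0$, and let $U_{s,1},U_{s,2}\in\mathbb{R}^{d\times r}$ have orthonormal columns with $U_{s,1}^\top U_{s,2}=0$. For $\epsilon>0$ and prompt length $n$, let $g^\star_{\mathcal W}$ be the optimal linear attention model (see context) for training prompts of length $n$ whose task vector is drawn from the mixture $$w\sim\tfrac12\mathcal N(0,\Sigma_{s,1})+\tfrac12\mathcal N(0,\Sigma_{s,2}),\qquad \Sigma_{s,k}=U_{s,k}U_{s,k}^\top+\epsilon I_d .$$ Let $\theta\in[0,\pi/2]$ and $U_t=\cos(\theta)\,U_{s,1}+\sin(\theta)\,U_{s,2}$, and let test prompts $\widetilde Z$ of length $m$, with query label $\widetilde y_{m+1}$, be generated with test task vector $\widetilde w\sim\mathcal N(0,\Sigma_t)$, $\Sigma_t=U_tU_t^\top+\epsilon I_d$. Then, for every $\theta\in[0,\pi/2]$, $$\lim_{m\to\infty}\lim_{n\to\infty}\lim_{\epsilon\to0}\mathbb E\Big[\big(\widetilde y_{m+1}-g^\star_{\mathcal W}(\widetilde Z)\big)^2\Big]=\sigma^2 .$$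
   Context: Training data: $x_1,\dots,x_{n+1}\sim\mathcal N(0,I_d)$ independent, task vector $w\in\mathbb{R}^d$ (shared by the whole prompt) independent of the $x_i$, noise $\xi_i\sim\mathcal N(0,\sigma^2)$ independent of everything else, and $y_i=w^\top x_i+\xi_i$ for $i\in\{1,\dots,n+1\}$. Prompt: $Z\in\mathbb{R}^{(n+1)\times(d+1)}$ with rows $z_i^\top=(x_i^\top,y_i)$ for $i\le n$ and $z_{n+1}^\top=(x_{n+1}^\top,0)$; masked prompt $Z_{\mathcal M}$ is $Z$ with its last row replaced by zero. Linear attention with weights $\mathcal W=\{W_Q,W_K,W_V\}$, each in $\mathbb{R}^{(d+1)\times(d+1)}$, and $p=(0_d^\top,1)^\top$: $$g_{\mathcal W}(Z)=\frac1n\big(z_{n+1}^\top W_QW_K^\top Z_{\mathcal M}^\top\big)Z_{\mathcal M}W_Vp .$$ The optimal model $g^\star_{\mathcal W}$ uses weights $\mathcal W^\star$ minimizing the training loss $\mathcal L(\mathcal W)=\mathbb E[(y_{n+1}-g_{\mathcal W}(Z))^2]$ (so it depends on $n$ and $\epsilon$). Test data: $x_1,\dots,x_{m+1}\sim\mathcal N(0,I_d)$ independent, $\widetilde w$ independent of them, $\widetilde y_j=\widetilde w^\top x_j+\xi_j$ with $\xi_j\sim\mathcal N(0,\sigma^2)$ independent, $j\in\{1,\dots,m+1\}$, all independent of the training data. The test prompt $\widetilde Z\in\mathbb{R}^{(m+1)\times(d+1)}$ has rows $(x_j^\top,\widetilde y_j)$ for $j\le m$ and last row $\widetilde z_{m+1}^\top=(x_{m+1}^\top,0)$;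 with $\widetilde Z_{\mathcal M}$ its masked version, the test prediction is $$g^\star_{\mathcal W}(\widetilde Z)=\frac1m\big(\widetilde z_{m+1}^\top W_Q^\star W_K^{\star\top}\widetilde Z_{\mathcal M}^\top\big)\widetilde Z_{\mathcal M}W_V^\star p ,$$ normalized by $m$ instead of $n$. The expectation in the test risk is over all test randomness. *)

theory Defs
  imports "HOL-Probability.Probability"
begin

section \<open>Gaussian laws\<close>

text \<open>
  The density of the centred Gaussian law on \<open>\<real>\<^sup>d\<close> with covariance matrix \<open>S\<close>.  It is meaningful
  only for symmetric positive definite \<open>S\<close>, which is the only case used.
\<close>

definition gauss_density :: "real^'d^'d \<Rightarrow> real^'d \<Rightarrow> real" where
  "gauss_density S x =
     exp (- (x \<bullet> (matrix_inv S *v x)) / 2) / sqrt ((2 * pi) ^ CARD('d) * det S)"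

definition gauss_law :: "real^'d^'d \<Rightarrow> (real^'d) measure" where
  "gauss_law S = density lborel (\<lambda>x. ennreal (gauss_density S x))"

text \<open>The mixture of two such laws, each with weight one half.\<close>

definition gauss_mixture :: "real^'d^'d \<Rightarrow> real^'d^'d \<Rightarrow> (real^'d) measure" where
  "gauss_mixture S T =
     density lborel (\<lambda>x. ennreal (1/2 * gauss_density S x + 1/2 * gauss_density T x))"

text \<open>
  The univariate law with mean zero and variance \<open>\<sigma>\<^sup>2\<close>; the case \<open>\<sigma> = 0\<close> (no noise) is the
  Dirac measure at zero, for which the library's normal density is not meaningful.
\<close>

definition noise_law :: "real \<Rightarrow> real measure" where
  "noise_law \<sigma> =
     (if \<sigma> = 0 then return borel 0 else density lborel (\<lambda>x. ennreal (normal_density 0 \<sigma> x)))"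

text \<open>The covariance \<open>U U\<^sup>T + \<epsilon> I\<close>; a \<open>d \<times> r\<close> matrix has type \<open>real^'r^'d\<close>.\<close>

definition spiked_cov :: "real^'r^'d \<Rightarrow> real \<Rightarrow> real^'d^'d" where
  "spiked_cov U \<epsilon> = U ** transpose U + \<epsilon> *\<^sub>R mat 1"


section \<open>Prompts and linear attention\<close>

text \<open>
  Vectors in \<open>\<real>\<^sup>d\<^sup>+\<^sup>1\<close> are indexed by \<open>'d option\<close>, where \<open>None\<close> is the last coordinate.  A matrix with
  \<open>n + 1\<close> rows is a function from row numbers, of which only \<open>1, \<dots>, n + 1\<close> are ever used.
\<close>

definition snoc_vec :: "real^'d \<Rightarrow> real \<Rightarrow> real^('d option)" where
  "snoc_vec x y = (\<chi> i. case i of Some j \<Rightarrow> x $ j | None \<Rightarrow> y)"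

definition prompt :: "nat \<Rightarrow> (nat \<Rightarrow> real^'d) \<Rightarrow> (nat \<Rightarrow> real) \<Rightarrow> nat \<Rightarrow> real^('d option)" where
  "prompt n x y i = (if i = n + 1 then snoc_vec (x i) 0 else snoc_vec (x i) (y i))"

definition masked :: "nat \<Rightarrow> (nat \<Rightarrow> real^('d::finite option)) \<Rightarrow> nat \<Rightarrow> real^('d option)" where
  "masked n Z i = (if i = n + 1 then 0 else Z i)"

type_synonym 'd weights =
  "(real^('d option)^('d option)) \<times> (real^('d option)^('d option)) \<times> (real^('d option)^('d option))"

text \<open>
  The sum over the rows \<open>i\<close> is the product of the row vector \<open>z\<^sub>n\<^sub>+\<^sub>1\<^sup>T W\<^sub>Q W\<^sub>K\<^sup>T Z\<^sub>M\<^sup>T\<close>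
  with the column vector \<open>Z\<^sub>M W\<^sub>V p\<close>.
\<close>

definition linear_attention ::
    "'d::finite weights \<Rightarrow> nat \<Rightarrow> (nat \<Rightarrow> real^('d option)) \<Rightarrow> real" where
  "linear_attention W n Z =
     (case W of (WQ, WK, WV) \<Rightarrow>
        (1 / real n) *
        (\<Sum>i = 1..n + 1. ((Z (n + 1) v* (WQ ** transpose WK)) \<bullet> masked n Z i) *
                         (masked n Z i \<bullet> (WV *v snoc_vec 0 1))))"


section \<open>Data distribution and risk\<close>

text \<open>
  The joint law of task vector, inputs \<open>x\<^sub>1, \<dots>, x\<^sub>n\<^sub>+\<^sub>1\<close> and noise \<open>\<xi>\<^sub>1, \<dots>, \<xi>\<^sub>n\<^sub>+\<^sub>1\<close>, all independent,
  for a task vector with law \<open>T\<close>.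
\<close>

definition data_law ::
    "(real^'d) measure \<Rightarrow> real \<Rightarrow> nat \<Rightarrow> ((real^'d) \<times> (nat \<Rightarrow> real^'d) \<times> (nat \<Rightarrow> real)) measure" where
  "data_law T \<sigma> n =
     T \<Otimes>\<^sub>M ((\<Pi>\<^sub>M i\<in>{1..n + 1}. gauss_law (mat 1)) \<Otimes>\<^sub>M (\<Pi>\<^sub>M i\<in>{1..n + 1}. noise_law \<sigma>))"

definition label :: "real^'d \<Rightarrow> (nat \<Rightarrow> real^'d) \<Rightarrow> (nat \<Rightarrow> real) \<Rightarrow> nat \<Rightarrow> real" where
  "label w x \<xi> i = w \<bullet> x i + \<xi> i"

text \<open>
  The mean squared error on prompts of length \<open>n\<close>.  The integrand is a polynomial in Gaussian
  variables, hence integrable, so the Bochner integral never takes its default value here.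
  Taken with the training task law it is the training loss, with the test task law the test risk.
\<close>

definition risk :: "(real^'d) measure \<Rightarrow> real \<Rightarrow> nat \<Rightarrow> 'd::finite weights \<Rightarrow> real" where
  "risk T \<sigma> n W =
     (\<integral>(w, x, \<xi>). (label w x \<xi> (n + 1) - linear_attention W n (prompt n x (label w x \<xi>)))\<^sup>2
        \<partial>(data_law T \<sigma> n))"

end

theory Submission
  imports Defs
begin

text \<open>
  Write \<open>A\<close>, \<open>b\<close> for the blocks of \<open>W\<^sub>Q W\<^sub>K\<^sup>T\<close> that act on \<open>(x\<^sub>n\<^sub>+\<^sub>1, 0)\<close> and \<open>(u, c) = W\<^sub>V p\<close>.  The prediction is
  \<open>x\<^sub>n\<^sub>+\<^sub>1 \<bullet> h\<close> with \<open>h = B s + e\<close>, where \<open>B = c A + b u\<^sup>T\<close>, \<open>s\<close> is the average of the \<open>y\<^sub>i x\<^sub>i\<close>, and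
  \<open>e\<close> is even under the measure-preserving sign flip \<open>(w, \<xi>) \<mapsto> (-w, -\<xi>)\<close>, under which \<open>w - B s\<close> is odd.
  Hence the risk is \<open>\<sigma>\<^sup>2 + E |w - B s|\<^sup>2 + E |e|\<^sup>2\<close>.  With \<open>S = E w w\<^sup>T\<close> the middle term is a strictly convex
  quadratic in \<open>B\<close>, minimised by \<open>B = S C\<^sup>-\<^sup>1\<close> for \<open>C = (1 + 1/n) S + ((tr S + \<sigma>\<^sup>2)/n) I\<close>, and \<open>e\<close> can be
  made zero; so optimal weights have this \<open>B\<close> and \<open>e = 0\<close> almost surely.  The latter forces \<open>c b = 0\<close>
  and \<open>A = 0\<close> or \<open>u = 0\<close>, so \<open>e\<close> also vanishes on test prompts of any length.  For the mixture
  \<open>S = P/2 + \<epsilon> I\<close> with \<open>P\<close> the projection onto the span of both subspaces, and \<open>B \<longrightarrow> \<beta> P\<close> as \<open>\<epsilon> \<longrightarrow> 0\<close>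
  with \<open>\<beta> \<longrightarrow> 1\<close> as \<open>n \<longrightarrow> \<infinity>\<close>.  Since \<open>P U\<^sub>t = U\<^sub>t\<close>, the test error tends to \<open>\<sigma>\<^sup>2\<close>.
\<close>


section \<open>Linear change of variables\<close>

text \<open>The triple of weight matrices is far from unique at the optimum, so nothing can be said
  about the matrices themselves; only the readout \<open>B\<close> and the vanishing products are
  determined, and neither refers to a prompt length. Extracting the products from
  \<open>E |e|^2 = 0\<close> is done with test functions: 1 and \<open>w \<bullet> w\<close>
  separate the part of \<open>e\<close> carried by the squared labels from the part built from the
  inputs alone, because \<open>w \<bullet> w\<close> is not almost surely constant under the
  training law; products of two coordinates of one input then isolate \<open>A\<close> and
  \<open>u\<close>. The matrix \<open>C\<close> is the second moment of \<open>s\<close>: two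
  distinct rows contribute \<open>S\<close>, while a repeated row adds a further Gaussian pairing
  \<open>S\<close>, the trace term and the noise, with weight \<open>1/n\<close>. Its multiple of
  the identity tends to \<open>(r + \<sigma>^2)/n > 0\<close> as \<epsilon> tends to 0, so
  \<open>B\<close> has a limit although \<open>S\<close> becomes singular. The laws are given by
  densities. Their moments and symmetry are obtained from the standard law, a product of univariate
  normals, by a linear change of variables with a root of the covariance.\<close>

lemma prod_Basis_cart: "(\<Prod>b\<in>Basis. f b) = (\<Prod>i\<in>UNIV. f (axis (i::'n::finite) (1::real)))"
proof -
  have "Basis = range (\<lambda>i::'n. axis i (1::real))"
    by (auto simp: Basis_vec_def)
  moreover have "inj (\<lambda>i::'n. axis i (1::real))"
    by (auto simp: inj_on_def axis_eq_axis)
  ultimately show ?thesis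
    using prod.reindex[of "\<lambda>i::'n. axis i (1::real)" UNIV f] by simp
qed

text \<open>The preimage of a box is the box with permuted sides, which has the same volume, and
  boxes determine Lebesgue measure.\<close>

lemma lborel_distr_permute_coords:
  assumes p: "bij (p :: 'n::finite \<Rightarrow> 'n)"
  shows "distr lborel borel (\<lambda>x::real^'n. \<chi> i. x $ p i) = lborel"
proof (rule lborel_eqI[symmetric])
  fix l u :: "real^'n" assume le: "\<And>b. b \<in> Basis \<Longrightarrow> l \<bullet> b \<le> u \<bullet> b"
  let ?q = "inv p"
  have le': "l $ i \<le> u $ i" for i
    using le[of "axis i 1"] by (simp add: inner_axis axis_in_Basis_iff)
  have meas: "(\<lambda>x::real^'n. \<chi> i. x $ p i) \<in> borel_measurable borel"
    by (intro borel_measurable_continuous_onI continuous_intros)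
  have all: "(\<forall>i. P i (p i)) \<longleftrightarrow> (\<forall>i. P (?q i) i)" for P
    using p by (metis bij_inv_eq_iff)
  have "(\<lambda>x::real^'n. \<chi> i. x $ p i) -` box l u = box (\<chi> i. l $ ?q i) (\<chi> i. u $ ?q i)"
    using all[of "\<lambda>i j. l $ i < x $ j \<and> x $ j < u $ i" for x]
    by (simp add: mem_box_cart vimage_def set_eq_iff)
  then have "emeasure (distr lborel borel (\<lambda>x::real^'n. \<chi> i. x $ p i)) (box l u) =
      emeasure lborel (box (\<chi> i. l $ ?q i) (\<chi> i. u $ ?q i))"
    by (simp add: emeasure_distr meas)
  also have "\<dots> = ennreal (\<Prod>b\<in>Basis. ((\<chi> i. u $ ?q i) - (\<chi> i. l $ ?q i)) \<bullet> b)"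
    using le' by (subst emeasure_lborel_box) (auto simp: Basis_vec_def inner_axis)
  also have "(\<Prod>b\<in>Basis. ((\<chi> i. u $ ?q i) - (\<chi> i. l $ ?q i)) \<bullet> b) = (\<Prod>i\<in>UNIV. u $ ?q i - l $ ?q i)"
    by (simp only: prod_Basis_cart) (simp add: inner_axis)
  also have "(\<Prod>i\<in>UNIV. u $ ?q i - l $ ?q i) = (\<Prod>i\<in>UNIV. u $ i - l $ i)"
    using prod.reindex_bij_betw[of ?q UNIV UNIV "\<lambda>i. u $ i - l $ i"] p by (simp add: bij_imp_bij_inv)
  also have "\<dots> = (\<Prod>b\<in>Basis. (u - l) \<bullet> b)"
    by (simp add: prod_Basis_cart inner_axis)
  finally show "emeasure (distr lborel borel (\<lambda>x::real^'n. \<chi> i. x $ p i)) (box l u) =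
      ennreal (\<Prod>b\<in>Basis. (u - l) \<bullet> b)" .
qed simp

text \<open>With coordinate \<open>m\<close> integrated innermost, the shear only translates that
  coordinate by the value of coordinate \<open>n\<close>, which is fixed there because
  \<open>m \<noteq> n\<close>.\<close>

lemma nn_integral_lborel_shear:
  fixes f :: "real^'n \<Rightarrow> ennreal"
  assumes f[measurable]: "f \<in> borel_measurable borel" and mn: "m \<noteq> n"
  shows "(\<integral>\<^sup>+x. f (x + (x $ n) *\<^sub>R axis m 1) \<partial>lborel) = (\<integral>\<^sup>+x. f x \<partial>lborel)"
proof -
  interpret product_sigma_finite "\<lambda>_::real^'n. lborel :: real measure" ..
  let ?m = "axis m (1::real)" and ?n = "axis n (1::real)"
  define B where "B = Basis - {?m}"
  have fin: "finite B" "?m \<notin> B" and Bas: "Basis = insert ?m B" and nB: "?n \<in> B"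
    using mn by (auto simp: B_def axis_eq_axis axis_in_Basis_iff)
  have [measurable]: "(\<lambda>x::real^'n. x $ n) \<in> borel_measurable borel"
    by (intro borel_measurable_continuous_onI continuous_intros)
  define S where "S g = (\<Sum>b\<in>B. g b *\<^sub>R b)" for g :: "real^'n \<Rightarrow> real"
  have Sm: "S (g(?m := y)) = S g" for g y
    unfolding S_def using fin by (intro sum.cong) auto
  have Sn: "S g $ n = g ?n" for g
  proof -
    have "S g $ n = (\<Sum>b\<in>B. g b * b $ n)" by (simp add: S_def)
    also have "\<dots> = (\<Sum>b\<in>{?n}. g b * b $ n)"
      using nB fin(1) by (intro sum.mono_neutral_right) (auto simp: B_def Basis_vec_def axis_eq_axis, simp add: axis_def)
    finally show ?thesis by simp
  qed
  \<comment> \<open>Fubini along \<open>axis m 1\<close>: \<open>S g\<close> is the point whose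
    other coordinates are given by \<open>g\<close>.\<close>
  have red: "(\<integral>\<^sup>+x. h x \<partial>lborel) = (\<integral>\<^sup>+g. (\<integral>\<^sup>+y. h (S g + y *\<^sub>R ?m) \<partial>lborel) \<partial>(\<Pi>\<^sub>M b\<in>B. lborel))"
    if [measurable]: "h \<in> borel_measurable borel" for h :: "real^'n \<Rightarrow> ennreal"
  proof -
    have "(\<integral>\<^sup>+x. h x \<partial>lborel) = (\<integral>\<^sup>+g. h (\<Sum>b\<in>insert ?m B. g b *\<^sub>R b) \<partial>(\<Pi>\<^sub>M b\<in>insert ?m B. lborel))"
      by (subst lborel_eq, subst nn_integral_distr) (auto simp: Bas)
    also have "\<dots> = (\<integral>\<^sup>+g. (\<integral>\<^sup>+y. h (\<Sum>b\<in>insert ?m B. (g(?m := y)) b *\<^sub>R b) \<partial>lborel) \<partial>(\<Pi>\<^sub>M b\<in>B. lborel))"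
      using fin by (intro product_nn_integral_insert) measurable
    also have "\<dots> = (\<integral>\<^sup>+g. (\<integral>\<^sup>+y. h (S g + y *\<^sub>R ?m) \<partial>lborel) \<partial>(\<Pi>\<^sub>M b\<in>B. lborel))"
    proof (intro nn_integral_cong arg_cong[where f=h])
      fix g y
      have "(\<Sum>b\<in>insert ?m B. (g(?m := y)) b *\<^sub>R b) = y *\<^sub>R ?m + S (g(?m := y))"
        using fin by (simp add: S_def)
      then show "(\<Sum>b\<in>insert ?m B. (g(?m := y)) b *\<^sub>R b) = S g + y *\<^sub>R ?m"
        by (simp only: Sm add.commute)
    qed
    finally show ?thesis .
  qed
  have "(\<integral>\<^sup>+x. f (x + (x $ n) *\<^sub>R ?m) \<partial>lborel) =
      (\<integral>\<^sup>+g. (\<integral>\<^sup>+y. f ((S g + y *\<^sub>R ?m) + ((S g + y *\<^sub>R ?m) $ n) *\<^sub>R ?m) \<partial>lborel) \<partial>(\<Pi>\<^sub>M b\<in>B. lborel))"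
    by (rule red) measurable
  also have "\<dots> = (\<integral>\<^sup>+g. (\<integral>\<^sup>+y. f (S g + (g ?n + 1 * y) *\<^sub>R ?m) \<partial>lborel) \<partial>(\<Pi>\<^sub>M b\<in>B. lborel))"
    using mn by (intro nn_integral_cong arg_cong[where f=f]) (simp add: Sn axis_def algebra_simps)
  also have "\<dots> = (\<integral>\<^sup>+g. (\<integral>\<^sup>+y. f (S g + y *\<^sub>R ?m) \<partial>lborel) \<partial>(\<Pi>\<^sub>M b\<in>B. lborel))"
  proof (rule nn_integral_cong)
    fix g
    show "(\<integral>\<^sup>+y. f (S g + (g ?n + 1 * y) *\<^sub>R ?m) \<partial>lborel) = (\<integral>\<^sup>+y. f (S g + y *\<^sub>R ?m) \<partial>lborel)"
      using nn_integral_real_affine[of "\<lambda>y. f (S g + y *\<^sub>R ?m)" 1 "g ?n"] by simp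
  qed
  also have "\<dots> = (\<integral>\<^sup>+x. f x \<partial>lborel)" by (rule red[symmetric]) measurable
  finally show ?thesis .
qed

lemma nn_integral_lborel_diagonal:
  fixes f :: "real^'n \<Rightarrow> ennreal"
  assumes [measurable]: "f \<in> borel_measurable borel" and c: "\<And>i. c i \<noteq> 0"
  shows "(\<integral>\<^sup>+x. f x \<partial>lborel) = ennreal (\<Prod>i\<in>UNIV. \<bar>c i\<bar>) * (\<integral>\<^sup>+x. f (\<chi> i. c i * x $ i) \<partial>lborel)"
proof -
  \<comment> \<open>The affine rule for \<open>lborel\<close> takes scale factors indexed by basis
    vectors; \<open>c'\<close> is the linear functional with value \<open>c i\<close> at
    \<open>axis i 1\<close>.\<close>
  define c' where "c' b = (\<Sum>i\<in>UNIV. c i * b $ i)" for b :: "real^'n"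
  have c'[simp]: "c' (axis i 1) = c i" for i
    by (simp add: c'_def axis_def if_distrib cong: if_cong)
  have nz: "j \<in> Basis \<Longrightarrow> c' j \<noteq> 0" for j
    using c by (auto simp: Basis_vec_def)
  have T: "(\<Sum>j\<in>Basis. (c' j * (x \<bullet> j)) *\<^sub>R j) = (\<chi> i. c i * x $ i)" for x :: "real^'n"
  proof -
    have "(\<Sum>j\<in>Basis. (c' j * (x \<bullet> j)) *\<^sub>R j) \<bullet> axis i 1 = c i * x $ i" for i
      by (subst inner_sum_left_Basis) (auto simp: inner_axis axis_in_Basis_iff)
    then show ?thesis by (simp add: vec_eq_iff inner_axis)
  qed
  have meas: "(\<lambda>x::real^'n. \<chi> i. c i * x $ i) \<in> borel_measurable borel"
    by (intro borel_measurable_continuous_onI continuous_intros)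
  have "(\<integral>\<^sup>+x. f x \<partial>lborel) =
    (\<integral>\<^sup>+x. f x \<partial>density (distr lborel borel (\<lambda>x. \<chi> i. c i * x $ i)) (\<lambda>_. ennreal (\<Prod>i\<in>UNIV. \<bar>c i\<bar>)))"
    using lborel_affine_euclidean[of c' 0, OF nz] by (simp add: T prod_Basis_cart)
  also have "\<dots> = ennreal (\<Prod>i\<in>UNIV. \<bar>c i\<bar>) * (\<integral>\<^sup>+x. f (\<chi> i. c i * x $ i) \<partial>lborel)"
    using meas by (simp add: nn_integral_density nn_integral_distr nn_integral_cmult)
  finally show ?thesis .
qed

text \<open>
  The library's linear change of variables needs a well-ordered index type; elementary matrices
  give it for every finite one.
\<close>

lemma nn_integral_lborel_linear:
  fixes A :: "real^'n^'n" and f :: "real^'n \<Rightarrow> ennreal"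
  assumes "f \<in> borel_measurable borel" "det A \<noteq> 0"
  shows "(\<integral>\<^sup>+x. f x \<partial>lborel) = ennreal \<bar>det A\<bar> * (\<integral>\<^sup>+x. f (A *v x) \<partial>lborel)"
proof -
  \<comment> \<open>The condition on the determinant sits inside \<open>P\<close>: it makes the case
    of a zero row vacuous, and for a product it passes to both factors.\<close>
  define P where "P A \<longleftrightarrow> (det A \<noteq> 0 \<longrightarrow> (\<forall>f\<in>borel_measurable borel.
    (\<integral>\<^sup>+x. f x \<partial>lborel) = ennreal \<bar>det A\<bar> * (\<integral>\<^sup>+x. f (A *v x) \<partial>lborel)))" for A :: "real^'n^'n"
  have "P A"
  proof (rule induct_matrix_elementary_alt)
    fix A B :: "real^'n^'n" assume P: "P A" "P B"
    show "P (A ** B)"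
      unfolding P_def
    proof (intro impI ballI)
      fix f :: "real^'n \<Rightarrow> ennreal"
      assume d: "det (A ** B) \<noteq> 0" and [measurable]: "f \<in> borel_measurable borel"
      have [measurable]: "(*v) A \<in> borel_measurable borel"
        by (intro borel_measurable_continuous_onI matrix_vector_mult_linear_continuous_on)
      from d have AB: "det A \<noteq> 0" "det B \<noteq> 0" by (auto simp: det_mul)
      have "(\<integral>\<^sup>+x. f x \<partial>lborel) = ennreal \<bar>det A\<bar> * (\<integral>\<^sup>+x. f (A *v x) \<partial>lborel)"
        using P(1)[unfolded P_def, rule_format, of f] AB by simp
      also have "(\<integral>\<^sup>+x. f (A *v x) \<partial>lborel) = ennreal \<bar>det B\<bar> * (\<integral>\<^sup>+x. f (A *v (B *v x)) \<partial>lborel)"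
        using P(2)[unfolded P_def, rule_format, of "\<lambda>x. f (A *v x)"] AB by simp
      finally show "(\<integral>\<^sup>+x. f x \<partial>lborel) = ennreal \<bar>det (A ** B)\<bar> * (\<integral>\<^sup>+x. f ((A ** B) *v x) \<partial>lborel)"
        by (simp add: det_mul abs_mult ennreal_mult mult.assoc matrix_vector_mul_assoc)
    qed
  next
    fix A :: "real^'n^'n" and i assume "row i A = 0"
    then show "P A" by (simp add: P_def det_zero_row)
  next
    fix A :: "real^'n^'n" assume diag: "\<And>i j. i \<noteq> j \<Longrightarrow> A $ i $ j = 0"
    have "A *v x = (\<chi> i. A $ i $ i * x $ i)" for x
    proof -
      have "(\<Sum>j\<in>UNIV. A $ i $ j * x $ j) = (\<Sum>j\<in>{i}. A $ i $ j * x $ j)" for i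
        by (rule sum.mono_neutral_right) (auto simp: diag)
      then show ?thesis by (simp add: matrix_vector_mult_def vec_eq_iff)
    qed
    then show "P A"
      unfolding P_def using nn_integral_lborel_diagonal[of _ "\<lambda>i. A $ i $ i"]
      by (simp add: det_diagonal[OF diag] abs_prod)
  next
    fix m n :: 'n assume mn: "m \<noteq> n"
    let ?p = "Transposition.transpose m n" and ?M = "(\<chi> i j. mat 1 $ i $ Transposition.transpose m n j) :: real^'n^'n"
    have "det ?M = of_int (sign ?p) * det (mat 1 :: real^'n^'n)"
      by (rule det_permute_columns) (simp add: permutes_swap_id)
    then have d: "\<bar>det ?M\<bar> = 1" by (simp add: sign_def)
    have Mx: "?M *v x = (\<chi> i. x $ ?p i)" for x
    proof -
      have "(mat 1 :: real^'n^'n) $ i $ ?p j * x $ j = (if j = ?p i then x $ j else 0)" for i j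
        by (auto simp: mat_def)
      then show ?thesis
        by (simp add: matrix_vector_mult_def vec_eq_iff)
    qed
    have [measurable]: "(\<lambda>x::real^'n. \<chi> i. x $ ?p i) \<in> borel_measurable borel"
      by (intro borel_measurable_continuous_onI continuous_intros)
    show "P ?M"
      unfolding P_def
    proof (intro impI ballI)
      fix f :: "real^'n \<Rightarrow> ennreal" assume [measurable]: "f \<in> borel_measurable borel"
      have "(\<integral>\<^sup>+x. f x \<partial>lborel) = (\<integral>\<^sup>+x. f x \<partial>distr lborel borel (\<lambda>x::real^'n. \<chi> i. x $ ?p i))"
        by (simp add: lborel_distr_permute_coords)
      also have "\<dots> = (\<integral>\<^sup>+x. f (?M *v x) \<partial>lborel)"
        by (simp add: nn_integral_distr Mx)
      finally show "(\<integral>\<^sup>+x. f x \<partial>lborel) = ennreal \<bar>det ?M\<bar> * (\<integral>\<^sup>+x. f (?M *v x) \<partial>lborel)"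
        unfolding d by simp
    qed
  next
    fix m n :: 'n assume mn: "m \<noteq> n"
    let ?M = "(\<chi> i j. of_bool (i = m \<and> j = n \<or> i = j)) :: real^'n^'n"
    have "?M = (\<chi> k. if k = m then row m (mat 1) + 1 *s row n (mat 1) else row k (mat 1))"
      using mn by (auto simp: vec_eq_iff row_def mat_def)
    then have d: "det ?M = 1"
      using det_row_operation[OF mn, of "mat 1 :: real^'n^'n" 1] by simp
    have Mx: "?M *v x = x + (x $ n) *\<^sub>R axis m 1" for x
    proof -
      have "(\<Sum>j\<in>UNIV. of_bool (i = m \<and> j = n \<or> i = j) * x $ j) = x $ i + (if i = m then x $ n else 0)" for i
      proof -
        have "(\<Sum>j\<in>UNIV. of_bool (i = m \<and> j = n \<or> i = j) * x $ j) =
          (\<Sum>j\<in>UNIV. (if j = i then x $ j else 0) + (if j = n then (if i = m then x $ n else 0) else 0))"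
          using mn by (intro sum.cong) auto
        then show ?thesis by (simp add: sum.distrib)
      qed
      then show ?thesis
        by (auto simp: matrix_vector_mult_def vec_eq_iff axis_def)
    qed
    show "P ?M"
      unfolding P_def d Mx using nn_integral_lborel_shear[OF _ mn] by simp
  qed
  with assms show ?thesis by (simp add: P_def)
qed


section \<open>Random variables with all moments; Gaussian laws\<close>

text \<open>Integrability alone is not inherited by products. Asking for all absolute moments gives
  a class closed under sums and products, so that integrability of any polynomial in the data
  follows from its syntax.\<close>

definition all_moments :: "'a measure \<Rightarrow> ('a \<Rightarrow> real) \<Rightarrow> bool" where
  "all_moments M f \<longleftrightarrow> f \<in> borel_measurable M \<and> (\<forall>k. integrable M (\<lambda>x. \<bar>f x\<bar> ^ k))"

lemma all_moments_measurable: "all_moments M f \<Longrightarrow> f \<in> borel_measurable M"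
  by (simp add: all_moments_def)

lemma all_moments_integrable: "all_moments M f \<Longrightarrow> integrable M f"
  unfolding all_moments_def using integrable_abs_cancel[of M f] by (auto dest: spec[of _ 1])

lemma (in prob_space) all_moments_const: "all_moments M (\<lambda>_. c)"
  by (simp add: all_moments_def)

text \<open>By \<open>a * b \<le> a^2 + b^2\<close>, moments of order \<open>2 * k\<close> of the
  factors dominate the moment of order \<open>k\<close> of the product.\<close>

lemma all_moments_mult:
  assumes f: "all_moments M f" and g: "all_moments M g"
  shows "all_moments M (\<lambda>x. f x * g x)"
  unfolding all_moments_def
proof (intro conjI allI)
  have [measurable]: "f \<in> borel_measurable M" "g \<in> borel_measurable M"
    using assms by (auto simp: all_moments_def)
  show "(\<lambda>x. f x * g x) \<in> borel_measurable M" by measurable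
  fix k
  have int: "integrable M (\<lambda>x. \<bar>f x\<bar> ^ (2 * k) + \<bar>g x\<bar> ^ (2 * k))"
    using assms by (auto simp: all_moments_def)
  show "integrable M (\<lambda>x. \<bar>f x * g x\<bar> ^ k)"
  proof (rule Bochner_Integration.integrable_bound[OF int])
    have "a * b \<le> a\<^sup>2 + b\<^sup>2" if "0 \<le> a" "0 \<le> b" for a b :: real
      using sum_squares_bound[of a b] mult_nonneg_nonneg[OF that] by linarith
    from this[of "\<bar>f x\<bar> ^ k" "\<bar>g x\<bar> ^ k" for x]
    have "\<bar>f x * g x\<bar> ^ k \<le> \<bar>f x\<bar> ^ (2 * k) + \<bar>g x\<bar> ^ (2 * k)" for x
      by (simp only: abs_mult power_mult_distrib mult.commute[of 2] power_mult zero_le_power abs_ge_zero)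
    then show "AE x in M. norm (\<bar>f x * g x\<bar> ^ k) \<le> norm (\<bar>f x\<bar> ^ (2 * k) + \<bar>g x\<bar> ^ (2 * k))"
      by (auto intro!: AE_I2 order_trans[OF _ abs_ge_self])
  qed measurable
qed

lemma all_moments_add:
  assumes f: "all_moments M f" and g: "all_moments M g"
  shows "all_moments M (\<lambda>x. f x + g x)"
  unfolding all_moments_def
proof (intro conjI allI)
  have [measurable]: "f \<in> borel_measurable M" "g \<in> borel_measurable M"
    using assms by (auto simp: all_moments_def)
  show "(\<lambda>x. f x + g x) \<in> borel_measurable M" by measurable
  fix k
  have int: "integrable M (\<lambda>x. 2 ^ k * (\<bar>f x\<bar> ^ k + \<bar>g x\<bar> ^ k))"
    using assms by (auto simp: all_moments_def)
  show "integrable M (\<lambda>x. \<bar>f x + g x\<bar> ^ k)"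
  proof (rule Bochner_Integration.integrable_bound[OF int])
    have "\<bar>a + b\<bar> ^ k \<le> 2 ^ k * (\<bar>a\<bar> ^ k + \<bar>b\<bar> ^ k)" for a b :: real
    proof -
      have "\<bar>a + b\<bar> ^ k \<le> (2 * max \<bar>a\<bar> \<bar>b\<bar>) ^ k" by (intro power_mono) auto
      also have "\<dots> \<le> 2 ^ k * (\<bar>a\<bar> ^ k + \<bar>b\<bar> ^ k)" by (auto simp: power_mult_distrib max_def)
      finally show ?thesis .
    qed
    then show "AE x in M. norm (\<bar>f x + g x\<bar> ^ k) \<le> norm (2 ^ k * (\<bar>f x\<bar> ^ k + \<bar>g x\<bar> ^ k))"
      by (auto intro!: AE_I2 order_trans[OF _ abs_ge_self])
  qed measurable
qed

lemma (in prob_space) all_moments_cmult: "all_moments M f \<Longrightarrow> all_moments M (\<lambda>x. c * f x)"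
  by (rule all_moments_mult[OF all_moments_const])

lemma (in prob_space) all_moments_diff:
  assumes "all_moments M f" "all_moments M g"
  shows "all_moments M (\<lambda>x. f x - g x)"
  using all_moments_add[OF assms(1) all_moments_cmult[OF assms(2), of "-1"]] by simp

lemma (in prob_space) all_moments_sum:
  "(\<And>i. i \<in> I \<Longrightarrow> all_moments M (f i)) \<Longrightarrow> all_moments M (\<lambda>x. \<Sum>i\<in>I. f i x)"
  by (induction I rule: infinite_finite_induct) (auto intro: all_moments_add all_moments_const)

lemma (in prob_space) all_moments_power:
  "all_moments M f \<Longrightarrow> all_moments M (\<lambda>x. f x ^ n)"
  by (induction n) (auto intro: all_moments_mult all_moments_const)

lemma all_moments_distr:
  assumes "g \<in> measurable M N"
  shows "all_moments (distr M N g) f \<Longrightarrow> all_moments M (\<lambda>x. f (g x))"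
  using assms unfolding all_moments_def by (auto simp: integrable_distr_eq)

lemma all_moments_distrI:
  assumes "g \<in> measurable M N" "f \<in> borel_measurable N" "all_moments M (\<lambda>x. f (g x))"
  shows "all_moments (distr M N g) f"
  using assms unfolding all_moments_def by (auto simp: integrable_distr_eq)

lemmas (in prob_space) all_moments_intros =
  all_moments_const all_moments_mult all_moments_add all_moments_diff all_moments_sum all_moments_power

section \<open>Moments of the univariate standard normal law\<close>

abbreviation std_normal_law :: "real measure" where
  "std_normal_law \<equiv> density lborel (\<lambda>x. ennreal (std_normal_density x))"

lemma prob_space_std_normal_law: "prob_space std_normal_law"
  by (rule prob_space_normal_density) simp

lemma integrable_std_normal_law_power: "integrable std_normal_law (\<lambda>x. x ^ k)"
  by (subst integrable_density) (auto simp: integrable_std_normal_moment)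

lemma all_moments_std_normal_law: "all_moments std_normal_law (\<lambda>x. x)"
  unfolding all_moments_def
proof (intro conjI allI)
  show "integrable std_normal_law (\<lambda>x. \<bar>x\<bar> ^ k)" for k
    by (subst integrable_density) (auto simp: integrable_std_normal_moment_abs)
qed simp

lemma integral_std_normal_law: "(\<integral>x. f x \<partial>std_normal_law) = (\<integral>x. std_normal_density x * f x \<partial>lborel)"
  if [measurable]: "f \<in> borel_measurable borel" for f :: "real \<Rightarrow> real"
  by (subst integral_density) auto

text \<open>Order four suffices: a repeated row in the square of \<open>s\<close> is quartic in one
  input, and so are the integrals used to analyse the residual.\<close>

lemma integral_std_normal_law_power:
  shows "(\<integral>x. x ^ 0 \<partial>std_normal_law) = 1" "(\<integral>x. x ^ 1 \<partial>std_normal_law) = 0"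
    "(\<integral>x. x ^ 2 \<partial>std_normal_law) = 1" "(\<integral>x. x ^ 3 \<partial>std_normal_law) = 0"
    "(\<integral>x. x ^ 4 \<partial>std_normal_law) = 3"
  using integral_std_normal_moment_even[of 0] integral_std_normal_moment_even[of 1]
    integral_std_normal_moment_even[of 2] integral_std_normal_moment_odd[of 0] integral_std_normal_moment_odd[of 1]
  by (simp_all add: integral_std_normal_law fact_numeral del: power_one_right power_0)
    (simp_all add: eval_nat_numeral)

text \<open>\<open>matrix_inv\<close> is a choice among two-sided inverses; a one-sided inverse of a
  square matrix is two-sided and unique, which fixes the choice.\<close>

lemma matrix_inv_eq:
  fixes A B :: "real^'n^'n"
  assumes AB: "A ** B = mat 1"
  shows "matrix_inv A = B"
  unfolding matrix_inv_def
proof (rule some_equality)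
  show BA: "A ** B = mat 1 \<and> B ** A = mat 1"
    using AB matrix_left_right_inverse by blast
  fix C assume "A ** C = mat 1 \<and> C ** A = mat 1"
  then have "B = (C ** A) ** B" by simp
  also have "\<dots> = C ** (A ** B)" by (simp only: matrix_mul_assoc)
  finally show "C = B" using AB by simp
qed

lemma inv_mat_1: "matrix_inv (mat 1 :: real^'n^'n) = mat 1"
  by (rule matrix_inv_eq) simp

lemma gauss_density_std: "gauss_density (mat 1) x = (\<Prod>i\<in>UNIV. std_normal_density (x $ i))"
proof -
  have "(\<Prod>i\<in>UNIV. std_normal_density (x $ i)) =
      (1 / sqrt (2 * pi)) ^ CARD('a) * exp (\<Sum>i\<in>UNIV. - (x $ i)\<^sup>2 / 2)"
    by (simp add: std_normal_density_def prod.distrib exp_sum prod_dividef power_one_over)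
  also have "(\<Sum>i\<in>UNIV. - (x $ i)\<^sup>2 / 2) = - (x \<bullet> x) / 2"
    by (simp add: inner_vec_def power2_eq_square sum_negf sum_divide_distrib)
  finally show ?thesis
    by (simp add: gauss_density_def inv_mat_1 real_sqrt_power real_sqrt_mult power_mult_distrib power_one_over)
qed

lemma measurable_vec_lambda[measurable]:
  "(\<lambda>f. \<chi> i. f i) \<in> measurable (\<Pi>\<^sub>M i\<in>(UNIV::'n::finite set). std_normal_law) (borel :: (real^'n) measure)"
proof -
  have "(\<lambda>f. \<Sum>i\<in>UNIV. f i *\<^sub>R axis i (1::real)) \<in> measurable (\<Pi>\<^sub>M i\<in>(UNIV::'n set). std_normal_law) borel"
    by measurable
  moreover have "(\<chi> i. f i) = (\<Sum>i\<in>UNIV. f i *\<^sub>R axis i (1::real))" for f :: "'n \<Rightarrow> real"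
    by (simp add: vec_eq_iff axis_def if_distrib cong: if_cong)
  ultimately show ?thesis by simp
qed

lemma measurable_vec_nth[measurable]: "(\<lambda>x::real^'n. x $ i) \<in> borel_measurable borel"
  by (intro borel_measurable_continuous_onI continuous_intros)

text \<open>The density factorises over the coordinates, so the image of the law under taking
  coordinates agrees with the product measure on rectangles. Reassembling the vector inverts that
  map.\<close>

lemma gauss_law_std_eq_PiM:
  "gauss_law (mat 1 :: real^'n^'n) = distr (\<Pi>\<^sub>M i\<in>UNIV. std_normal_law) borel (\<lambda>f. \<chi> i. f i)"
proof -
  interpret N: prob_space std_normal_law by (rule prob_space_std_normal_law)
  interpret product_sigma_finite "\<lambda>_::'n. std_normal_law" ..
  let ?G = "gauss_law (mat 1 :: real^'n^'n)" and ?P = "\<Pi>\<^sub>M i\<in>(UNIV::'n set). std_normal_law"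
  have sG[measurable_cong]: "sets ?G = sets borel" by (simp add: gauss_law_def)
  have [measurable]: "(\<lambda>x::real^'n. \<lambda>i. x $ i) \<in> measurable borel ?P"
    by (rule measurable_PiM_single') (auto simp: space_PiM)
  have dens: "(\<lambda>x::real^'n. gauss_density (mat 1) x) \<in> borel_measurable borel"
    unfolding gauss_density_std by measurable
  have "distr ?G ?P (\<lambda>x i. x $ i) = ?P"
  proof (rule PiM_eqI)
    fix A :: "'n \<Rightarrow> real set" assume A: "\<And>i. i \<in> UNIV \<Longrightarrow> A i \<in> sets std_normal_law"
    then have [measurable]: "A i \<in> sets borel" for i by simp
    have pre: "(\<lambda>x::real^'n. \<lambda>i. x $ i) -` Pi\<^sub>E UNIV A = {x. \<forall>i. x $ i \<in> A i}"
      by (auto simp: PiE_def)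
    have "emeasure (distr ?G ?P (\<lambda>x i. x $ i)) (Pi\<^sub>E UNIV A) = emeasure ?G {x. \<forall>i. x $ i \<in> A i}"
      using A by (subst emeasure_distr) (auto simp: pre sets_eq_imp_space_eq[OF sG] intro!: sets_PiM_I_finite)
    also have "\<dots> = (\<integral>\<^sup>+x. ennreal (gauss_density (mat 1) x) * indicator {x. \<forall>i. x $ i \<in> A i} x \<partial>lborel)"
      unfolding gauss_law_def using dens by (subst emeasure_density) auto
    \<comment> \<open>The product formula for \<open>lborel\<close> runs over \<open>Basis\<close>;
      the \<open>SOME\<close> recovers the index from the basis vector.\<close>
    also have "\<dots> = (\<integral>\<^sup>+x. (\<Prod>b\<in>Basis. ennreal (std_normal_density (x \<bullet> b)) * indicator (A (SOME i. b = axis i 1)) (x \<bullet> b)) \<partial>(lborel :: (real^'n) measure))"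
    proof (rule nn_integral_cong)
      fix x :: "real^'n"
      have "indicator {x. \<forall>i. x $ i \<in> A i} x = (\<Prod>i\<in>UNIV. indicator (A i) (x $ i) :: ennreal)"
      proof (cases "\<forall>i. x $ i \<in> A i")
        case False
        then obtain i where "x $ i \<notin> A i" by auto
        then have "(\<Prod>i\<in>UNIV. indicator (A i) (x $ i) :: ennreal) = 0"
          by (intro prod_zero) (auto intro!: exI[of _ i])
        with False show ?thesis by simp
      qed simp
      then show "ennreal (gauss_density (mat 1) x) * indicator {x. \<forall>i. x $ i \<in> A i} x =
        (\<Prod>b\<in>Basis. ennreal (std_normal_density (x \<bullet> b)) * indicator (A (SOME i. b = axis i 1)) (x \<bullet> b))"
        by (simp add: prod_Basis_cart gauss_density_std axis_eq_axis inner_axis prod_ennreal prod.distrib)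
    qed
    also have "\<dots> = (\<Prod>b\<in>(Basis::(real^'n) set).
        \<integral>\<^sup>+x. ennreal (std_normal_density x) * indicator (A (SOME i. b = axis i 1)) x \<partial>lborel)"
      by (rule nn_integral_lborel_prod) auto
    also have "\<dots> = (\<Prod>i\<in>UNIV. \<integral>\<^sup>+x. ennreal (std_normal_density x) * indicator (A i) x \<partial>lborel)"
      by (simp add: prod_Basis_cart axis_eq_axis)
    also have "\<dots> = (\<Prod>i\<in>UNIV. emeasure std_normal_law (A i))"
      by (intro prod.cong) (auto simp: emeasure_density)
    finally show "emeasure (distr ?G ?P (\<lambda>x i. x $ i)) (Pi\<^sub>E UNIV A) = (\<Prod>i\<in>UNIV. emeasure std_normal_law (A i))" .
  qed auto
  then have "distr ?P borel (\<lambda>f. \<chi> i. f i) = distr (distr ?G ?P (\<lambda>x i. x $ i)) borel (\<lambda>f. \<chi> i. f i)"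
    by simp
  also have "\<dots> = distr ?G borel (\<lambda>x. x)"
    by (subst distr_distr) (auto simp: o_def)
  also have "\<dots> = ?G"
    by (rule distr_id2) (simp add: gauss_law_def)
  finally show ?thesis ..
qed


text \<open>What the argument uses of a task law: finite moments, the matrix of second moments and
  invariance under negation. The Gaussian test law and the training mixture are both instances,
  although the mixture is not Gaussian.\<close>

locale centred_law = prob_space T for T :: "(real^'d) measure" +
  fixes S :: "real^'d^'d"
  assumes sets_T[measurable_cong]: "sets T = sets borel"
    and coord_moments: "all_moments T (\<lambda>w. w $ k)"
    and second_moment: "(\<integral>w. w $ k * w $ l \<partial>T) = S $ k $ l"
    and symmetric: "distr T borel uminus = T"

text \<open>Writing a coordinate as a monomial in all coordinates turns a product of coordinates
  into one monomial with added exponents, whose integral factorises.\<close>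

lemma prod_power_of_bool:
  "x $ k = (\<Prod>b\<in>UNIV. (x $ b) ^ of_bool (b = k))" for x :: "real^'d"
proof -
  have "(\<Prod>b\<in>UNIV. (x $ b) ^ of_bool (b = k)) = (\<Prod>b\<in>UNIV. if b = k then x $ b else 1)"
    by (intro prod.cong) auto
  then show ?thesis by simp
qed

abbreviation std_gauss :: "(real^'d) measure" where
  "std_gauss \<equiv> gauss_law (mat 1)"

lemma prob_space_std_gauss: "prob_space (std_gauss :: (real^'d) measure)"
  unfolding gauss_law_std_eq_PiM
  by (intro prob_space.prob_space_distr prob_space_PiM prob_space_std_normal_law) measurable

lemma sets_gauss_law[simp, measurable_cong]: "sets (gauss_law S) = sets borel"
  by (simp add: gauss_law_def)

lemma integral_std_gauss_prod:
  "(\<integral>x. (\<Prod>b\<in>UNIV. (x $ b) ^ c b) \<partial>(std_gauss :: (real^'d) measure)) = (\<Prod>b\<in>UNIV. \<integral>x. x ^ c b \<partial>std_normal_law)"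
proof -
  interpret N: prob_space std_normal_law by (rule prob_space_std_normal_law)
  interpret product_sigma_finite "\<lambda>_::'d. std_normal_law" ..
  show ?thesis
    unfolding gauss_law_std_eq_PiM
    by (subst integral_distr, measurable)
      (simp add: product_integral_prod[where f="\<lambda>b x. x ^ c b"] integrable_std_normal_law_power)
qed

lemma all_moments_std_gauss: "all_moments (std_gauss :: (real^'d) measure) (\<lambda>x. x $ k)"
proof -
  interpret N: prob_space std_normal_law by (rule prob_space_std_normal_law)
  have "distr (\<Pi>\<^sub>M i\<in>(UNIV::'d set). std_normal_law) std_normal_law (\<lambda>f. f k) = std_normal_law"
    by (rule distr_PiM_component) (auto intro: prob_space_std_normal_law)
  then have "all_moments (\<Pi>\<^sub>M i\<in>(UNIV::'d set). std_normal_law) (\<lambda>f. f k)"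
    using all_moments_distr[of "\<lambda>f. f k" "\<Pi>\<^sub>M i\<in>(UNIV::'d set). std_normal_law" std_normal_law "\<lambda>x. x"] all_moments_std_normal_law
    by simp
  then show ?thesis
    unfolding gauss_law_std_eq_PiM by (intro all_moments_distrI) auto
qed

lemma std_gauss_second_moment:
  "(\<integral>x. x $ k * x $ l \<partial>(std_gauss :: (real^'d) measure)) = of_bool (k = l)"
proof -
  define c where "c b = of_bool (b = k) + (of_bool (b = l) :: nat)" for b :: 'd
  have "(\<integral>x. x $ k * x $ l \<partial>(std_gauss :: (real^'d) measure)) = (\<integral>x. (\<Prod>b\<in>UNIV. (x $ b) ^ c b) \<partial>(std_gauss :: (real^'d) measure))"
    unfolding c_def power_add prod.distrib prod_power_of_bool[symmetric] ..
  also have "\<dots> = (\<Prod>b\<in>UNIV. \<integral>x. x ^ c b \<partial>std_normal_law)"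
    by (rule integral_std_gauss_prod)
  also have "\<dots> = of_bool (k = l)"
  proof (cases "k = l")
    case True
    have "(\<integral>x. x ^ c b \<partial>std_normal_law) = 1" for b
      using integral_std_normal_law_power by (cases "b = k") (auto simp: c_def True numeral_2_eq_2)
    with True show ?thesis by simp
  next
    case False
    then have "(\<integral>x. x ^ c k \<partial>std_normal_law) = 0"
      using integral_std_normal_law_power by (simp add: c_def)
    with False show ?thesis by (auto intro!: prod_zero bexI[of _ k])
  qed
  finally show ?thesis .
qed

text \<open>Isserlis' formula: one summand for each pairing of the four indices. The proof looks at
  the multiplicities \<open>c b\<close> of the coordinates: an odd one kills both sides, a single
  coordinate gives 3 on both sides, and two distinct pairs give 1.\<close>

lemma std_gauss_fourth_moment:
  "(\<integral>x. x $ i * x $ j * (x $ k * x $ l) \<partial>(std_gauss :: (real^'d) measure)) =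
    of_bool (i = j \<and> k = l) + of_bool (i = k \<and> j = l) + of_bool (i = l \<and> j = k)"
proof -
  define c where "c b = of_bool (b = i) + of_bool (b = j) + (of_bool (b = k) + (of_bool (b = l) :: nat))" for b :: 'd
  let ?m = "\<lambda>n. \<integral>x. x ^ n \<partial>std_normal_law"
  have "(\<integral>x. x $ i * x $ j * (x $ k * x $ l) \<partial>(std_gauss :: (real^'d) measure)) = (\<integral>x. (\<Prod>b\<in>UNIV. (x $ b) ^ c b) \<partial>(std_gauss :: (real^'d) measure))"
    unfolding c_def power_add prod.distrib prod_power_of_bool[symmetric] ..
  also have "\<dots> = (\<Prod>b\<in>UNIV. ?m (c b))"
    by (rule integral_std_gauss_prod)
  also have "\<dots> = of_bool (i = j \<and> k = l) + of_bool (i = k \<and> j = l) + of_bool (i = l \<and> j = k)"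
  proof -
    have odd: "(\<Prod>b\<in>UNIV. ?m (c b)) = 0" if "c a = 1 \<or> c a = 3" for a
    proof -
      have "?m (c a) = 0" using that integral_std_normal_law_power by auto
      then show ?thesis by (auto intro!: prod_zero bexI[of _ a])
    qed
    \<comment> \<open>Multiplicities are at most 4, and the value 4 means that all indices coincide;
      otherwise some multiplicity is odd or all are 0 or 2.\<close>
    consider "i = j" "j = k" "k = l" | "\<exists>a. c a = 1 \<or> c a = 3"
      | "i \<noteq> j \<or> j \<noteq> k \<or> k \<noteq> l" "\<forall>b. c b = 0 \<or> c b = 2"
    proof -
      have "c b \<le> 4" for b by (auto simp: c_def)
      moreover have "c b = 4 \<Longrightarrow> i = j \<and> j = k \<and> k = l" for b
        by (auto simp: c_def of_bool_def split: if_splits)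
      moreover have "n = 0 \<or> n = 1 \<or> n = 2 \<or> n = 3 \<or> n = 4" if "n \<le> 4" for n :: nat
        using that by auto
      ultimately show ?thesis using that by metis
    qed
    then show ?thesis
    proof cases
      case 1
      then have "c b = (if b = i then 4 else 0)" for b by (simp add: c_def)
      then have "(\<Prod>b\<in>UNIV. ?m (c b)) = (\<Prod>b\<in>UNIV. if b = i then 3 else 1)"
        using integral_std_normal_law_power by (intro prod.cong) auto
      with 1 show ?thesis by simp
    next
      case 2
      then obtain a where a: "c a = 1 \<or> c a = 3" by auto
      \<comment> \<open>Any valid pairing groups equal indices in twos, so it makes every
        multiplicity even.\<close>
      have "even (c a)" if "i = j \<and> k = l \<or> i = k \<and> j = l \<or> i = l \<and> j = k"
        using that by (elim disjE conjE) (simp_all add: c_def)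
      with a have no: "\<not> (i = j \<and> k = l)" "\<not> (i = k \<and> j = l)" "\<not> (i = l \<and> j = k)"
        by auto
      show ?thesis
        unfolding odd[OF a] by (simp only: no of_bool_eq add_0_right)
    next
      case 3
      have "?m (c b) = 1" for b
        using 3(2)[rule_format, of b] integral_std_normal_law_power by auto
      then have prod1: "(\<Prod>b\<in>UNIV. ?m (c b)) = 1" by simp
      have "(i = j \<and> k = l) \<or> (i = k \<and> j = l) \<or> (i = l \<and> j = k)"
      proof -
        have pos: "0 < c i" "0 < c j" "0 < c k" by (simp_all add: c_def)
        then have c2: "c i = 2" "c j = 2" "c k = 2" using 3(2) by (metis less_irrefl)+
        consider "i = j" | "i \<noteq> j" "i = k" | "i \<noteq> j" "i \<noteq> k" by blast
        then show ?thesis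
        proof cases
          case 1
          then have "k = l" using c2(1,3) by (cases "k = l"; cases "i = k"; auto simp: c_def of_bool_def split: if_splits)
          with 1 show ?thesis by simp
        next
          case 2
          then have "j = l" using c2(1,2) by (cases "j = l"; simp add: c_def)
          with 2 show ?thesis by simp
        next
          case 3
          then have "i = l" using c2(1) by (cases "i = l"; simp add: c_def)
          moreover from this 3 have "j = k" using c2(2) by (cases "j = k"; simp add: c_def)
          ultimately show ?thesis by simp
        qed
      qed
      then have "1 = (of_bool (i = j \<and> k = l) + of_bool (i = k \<and> j = l) + of_bool (i = l \<and> j = k) :: real)"
        using 3(1) by (elim disjE conjE) auto
      then show ?thesis unfolding prod1 .
    qed
  qed
  finally show ?thesis .
qed

section \<open>Gaussian laws as linear images of the standard law\<close>

lemma gauss_density_measurable[measurable]: "gauss_density R \<in> borel_measurable borel"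
proof -
  have [measurable]: "(\<lambda>x. x \<bullet> (matrix_inv R *v x)) \<in> borel_measurable borel"
    by (intro borel_measurable_continuous_onI continuous_intros matrix_vector_mult_linear_continuous_on)
  show ?thesis unfolding gauss_density_def[abs_def] by measurable
qed

text \<open>With \<open>K\<close> the inverse of \<open>L\<close>, the inverse covariance is
  \<open>transpose K ** K\<close>, so the quadratic form at \<open>L *v y\<close> is
  \<open>y \<bullet> y\<close>. The normalising constants differ by
  \<open>\<bar>det L\<bar>\<close>, exactly the Jacobian.\<close>

lemma gauss_law_linear:
  fixes L :: "real^'d^'d"
  assumes S: "S = L ** transpose L" and L: "det L \<noteq> 0"
  shows "gauss_law S = distr std_gauss borel ((*v) L)"
proof (rule measure_eqI)
  have [measurable]: "(*v) L \<in> borel_measurable borel"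
    by (intro borel_measurable_continuous_onI matrix_vector_mult_linear_continuous_on)
  obtain K where K: "L ** K = mat 1" "K ** L = mat 1"
    using L invertible_det_nz[of L] by (auto simp: invertible_def)
  have "transpose L ** transpose K = mat 1"
    using K(2) by (metis matrix_transpose_mul transpose_mat)
  then have inv: "matrix_inv S = transpose K ** K"
    using K by (intro matrix_inv_eq) (metis S matrix_mul_assoc matrix_mul_rid)
  have quad: "(L *v y) \<bullet> (matrix_inv S *v (L *v y)) = y \<bullet> y" for y
  proof -
    have "K *v (L *v y) = y" by (simp add: matrix_vector_mul_assoc K)
    then have "matrix_inv S *v (L *v y) = y v* K"
      by (simp add: inv flip: matrix_vector_mul_assoc)
    then show ?thesis
      by (metis \<open>K *v (L *v y) = y\<close> dot_lmul_matrix inner_commute)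
  qed
  have "sqrt ((2 * pi) ^ CARD('d) * det S) = \<bar>det L\<bar> * sqrt ((2 * pi) ^ CARD('d))"
    by (simp add: S det_mul real_sqrt_mult)
  then have eq: "\<bar>det L\<bar> * gauss_density S (L *v y) = gauss_density (mat 1) y" for y
    using L quad[of y] by (simp add: gauss_density_def inv_mat_1)
  fix A assume "A \<in> sets (gauss_law S)"
  then have [measurable]: "A \<in> sets borel" by simp
  have "emeasure (gauss_law S) A = (\<integral>\<^sup>+x. ennreal (gauss_density S x) * indicator A x \<partial>lborel)"
    by (simp add: gauss_law_def emeasure_density)
  also have "\<dots> = ennreal \<bar>det L\<bar> * (\<integral>\<^sup>+y. ennreal (gauss_density S (L *v y)) * indicator A (L *v y) \<partial>lborel)"
    by (rule nn_integral_lborel_linear[OF _ L]) measurable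
  also have "\<dots> = (\<integral>\<^sup>+y. ennreal \<bar>det L\<bar> * (ennreal (gauss_density S (L *v y)) * indicator A (L *v y)) \<partial>lborel)"
    by (subst nn_integral_cmult) auto
  also have "\<dots> = (\<integral>\<^sup>+y. ennreal (gauss_density (mat 1) y) * indicator ((*v) L -` A) y \<partial>lborel)"
    by (intro nn_integral_cong) (simp add: eq[symmetric] ennreal_mult' mult.assoc indicator_def)
  also have "\<dots> = emeasure (std_gauss :: (real^'d) measure) ((*v) L -` A)"
    unfolding gauss_law_def using measurable_sets_borel[of "(*v) L" borel A] by (subst emeasure_density) auto
  also have "\<dots> = emeasure (distr std_gauss borel ((*v) L)) A"
    by (subst emeasure_distr) (auto simp: gauss_law_def)
  finally show "emeasure (gauss_law S) A = emeasure (distr std_gauss borel ((*v) L)) A" .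
qed simp

lemma centred_law_gauss_law:
  fixes L :: "real^'d^'d"
  assumes S: "S = L ** transpose L" and L: "det L \<noteq> 0"
  shows "centred_law (gauss_law S) S"
proof -
  interpret G: prob_space "std_gauss :: (real^'d) measure" by (rule prob_space_std_gauss)
  have [measurable]: "(*v) R \<in> borel_measurable borel" for R :: "real^'d^'d"
    by (intro borel_measurable_continuous_onI matrix_vector_mult_linear_continuous_on)
  have mx: "(*v) R \<in> measurable std_gauss borel" for R :: "real^'d^'d"
    by measurable
  have minus_mult: "(*v) (- L) = (\<lambda>x. - (L *v x))"
    by (simp add: fun_eq_iff matrix_vector_mult_def vec_eq_iff sum_negf)
  \<comment> \<open>\<open>- L\<close> is a root of the same covariance. The images of the standard
    law under \<open>L\<close> and \<open>- L\<close> therefore coincide, which is the symmetry of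
    the law. Squares of determinants are compared because the sign of \<open>det (- L)\<close>
    depends on the dimension.\<close>
  have S': "S = (- L) ** transpose (- L)"
    by (simp add: S matrix_matrix_mult_def transpose_def)
  then have "det (- L) * det (- L) = det L * det L"
    by (metis S det_mul det_transpose)
  with L have L': "det (- L) \<noteq> 0" by auto
  note gl = gauss_law_linear[OF S L]
  have int: "integrable std_gauss (\<lambda>x::real^'d. x $ p * x $ q)" for p q
    by (intro all_moments_integrable all_moments_mult all_moments_std_gauss)
  show ?thesis
  proof (intro centred_law.intro centred_law_axioms.intro)
    show "prob_space (gauss_law S)"
      unfolding gl by (rule G.prob_space_distr) measurable
    show "all_moments (gauss_law S) (\<lambda>w. w $ k)" for k
      unfolding gl by (intro all_moments_distrI mx)
        (auto simp: matrix_vector_mult_def intro!: G.all_moments_intros all_moments_std_gauss)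
    show "(\<integral>w. w $ k * w $ l \<partial>gauss_law S) = S $ k $ l" for k l
    proof -
      have "(\<integral>w. w $ k * w $ l \<partial>gauss_law S) = (\<integral>x. (L *v x) $ k * (L *v x) $ l \<partial>std_gauss)"
        unfolding gl by (subst integral_distr) auto
      also have "\<dots> = (\<integral>x. (\<Sum>p\<in>UNIV. \<Sum>q\<in>UNIV. (L $ k $ p * L $ l $ q) * (x $ p * x $ q)) \<partial>std_gauss)"
        by (simp add: matrix_vector_mult_def sum_product algebra_simps)
      also have "\<dots> = (\<Sum>p\<in>UNIV. \<Sum>q\<in>UNIV. (L $ k $ p * L $ l $ q) * of_bool (p = q))"
        by (subst Bochner_Integration.integral_sum, intro Bochner_Integration.integrable_sum integrable_mult_right int,
            subst Bochner_Integration.integral_sum, intro integrable_mult_right int)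
          (simp add: std_gauss_second_moment)
      also have "\<dots> = S $ k $ l"
        by (simp add: S matrix_matrix_mult_def transpose_def of_bool_def if_distrib cong: if_cong)
      finally show ?thesis .
    qed
    have "distr (gauss_law S) borel uminus = distr std_gauss borel ((*v) (- L))"
      unfolding gl by (subst distr_distr) (auto simp: o_def minus_mult)
    also have "\<dots> = gauss_law S"
      by (rule gauss_law_linear[OF S' L', symmetric])
    finally show "distr (gauss_law S) borel uminus = gauss_law S" .
  qed simp
qed

section \<open>Mixtures of two Gaussian laws\<close>

lemma integrable_gauss_mixture:
  fixes f :: "real^'d \<Rightarrow> real"
  assumes f1: "integrable (gauss_law S) f" and f2: "integrable (gauss_law R) f"
    and pos: "\<And>x. 0 \<le> gauss_density S x" "\<And>x. 0 \<le> gauss_density R x"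
  shows "integrable (gauss_mixture S R) f"
    and "(\<integral>x. f x \<partial>gauss_mixture S R) = 1/2 * (\<integral>x. f x \<partial>gauss_law S) + 1/2 * (\<integral>x. f x \<partial>gauss_law R)"
proof -
  have [measurable]: "f \<in> borel_measurable borel"
    using borel_measurable_integrable[OF f1] by simp
  have i1: "integrable lborel (\<lambda>x. gauss_density S x * f x)"
    using f1 pos unfolding gauss_law_def by (subst (asm) integrable_density) auto
  have i2: "integrable lborel (\<lambda>x. gauss_density R x * f x)"
    using f2 pos unfolding gauss_law_def by (subst (asm) integrable_density) auto
  have eq: "(1/2 * gauss_density S x + 1/2 * gauss_density R x) * f x =
    1/2 * (gauss_density S x * f x) + 1/2 * (gauss_density R x * f x)" for x
    by (simp add: algebra_simps)
  show "integrable (gauss_mixture S R) f"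
    unfolding gauss_mixture_def
  proof (subst integrable_density)
    show "integrable lborel (\<lambda>x. (1/2 * gauss_density S x + 1/2 * gauss_density R x) *\<^sub>R f x)"
      unfolding real_scaleR_def eq by (intro Bochner_Integration.integrable_add integrable_mult_right i1 i2)
  qed (use pos in auto)
  have "(\<integral>x. f x \<partial>gauss_mixture S R) =
      (\<integral>x. 1/2 * (gauss_density S x * f x) + 1/2 * (gauss_density R x * f x) \<partial>lborel)"
    unfolding gauss_mixture_def eq[symmetric] using pos
    by (subst integral_density) auto
  also have "\<dots> = 1/2 * (\<integral>x. gauss_density S x * f x \<partial>lborel) + 1/2 * (\<integral>x. gauss_density R x * f x \<partial>lborel)"
    using i1 i2 by simp
  also have "(\<integral>x. gauss_density S x * f x \<partial>lborel) = (\<integral>x. f x \<partial>gauss_law S)"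
    unfolding gauss_law_def using pos by (subst integral_density) auto
  also have "(\<integral>x. gauss_density R x * f x \<partial>lborel) = (\<integral>x. f x \<partial>gauss_law R)"
    unfolding gauss_law_def using pos by (subst integral_density) auto
  finally show "(\<integral>x. f x \<partial>gauss_mixture S R) = 1/2 * (\<integral>x. f x \<partial>gauss_law S) + 1/2 * (\<integral>x. f x \<partial>gauss_law R)" .
qed

text \<open>Nonnegativity of the densities enters because \<open>ennreal\<close> truncates negative
  values and is additive on nonnegative ones.\<close>

lemma emeasure_gauss_mixture:
  assumes [measurable]: "A \<in> sets borel"
    and pos: "\<And>x. 0 \<le> gauss_density S x" "\<And>x. 0 \<le> gauss_density R x"
  shows "emeasure (gauss_mixture S R) A = ennreal (1/2) * emeasure (gauss_law S) A + ennreal (1/2) * emeasure (gauss_law R) A"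
proof -
  have "emeasure (gauss_mixture S R) A =
      (\<integral>\<^sup>+x. ennreal (1/2 * gauss_density S x + 1/2 * gauss_density R x) * indicator A x \<partial>lborel)"
    unfolding gauss_mixture_def by (subst emeasure_density) auto
  also have "\<dots> = (\<integral>\<^sup>+x. ennreal (1/2) * (ennreal (gauss_density S x) * indicator A x) +
      ennreal (1/2) * (ennreal (gauss_density R x) * indicator A x) \<partial>lborel)"
    using pos by (intro nn_integral_cong) (simp only: ennreal_plus ennreal_mult' mult_nonneg_nonneg
        divide_nonneg_nonneg zero_le_one zero_le_numeral distrib_right mult.assoc)
  also have "\<dots> = ennreal (1/2) * (\<integral>\<^sup>+x. ennreal (gauss_density S x) * indicator A x \<partial>lborel) +
      ennreal (1/2) * (\<integral>\<^sup>+x. ennreal (gauss_density R x) * indicator A x \<partial>lborel)"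
    by (subst nn_integral_add, measurable, subst (1 2) nn_integral_cmult) auto
  finally show ?thesis
    unfolding gauss_law_def by (subst (1 2) emeasure_density) auto
qed

lemma centred_law_mixture:
  assumes S: "centred_law (gauss_law S) S" "\<And>x. 0 \<le> gauss_density S x"
    and R: "centred_law (gauss_law R) R" "\<And>x. 0 \<le> gauss_density R x"
  shows "centred_law (gauss_mixture S R) ((1/2) *\<^sub>R S + (1/2) *\<^sub>R R)"
proof -
  interpret S: centred_law "gauss_law S" S by fact
  interpret R: centred_law "gauss_law R" R by fact
  have sets_mix[measurable_cong]: "sets (gauss_mixture S R) = sets borel" by (simp add: gauss_mixture_def)
  show ?thesis
  proof (intro centred_law.intro centred_law_axioms.intro)
    have sp: "space (gauss_law S) = UNIV" "space (gauss_law R) = UNIV" "space (gauss_mixture S R) = UNIV"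
      using sets_eq_imp_space_eq[OF sets_mix] by (auto simp: sets_eq_imp_space_eq[OF sets_gauss_law])
    have "emeasure (gauss_mixture S R) UNIV = ennreal (1/2) + ennreal (1/2)"
      using S.emeasure_space_1 R.emeasure_space_1 by (simp add: emeasure_gauss_mixture S(2) R(2) sp)
    also have "\<dots> = ennreal (1/2 + 1/2)"
      by (rule ennreal_plus[symmetric]) auto
    also have "\<dots> = 1" by simp
    finally show "prob_space (gauss_mixture S R)"
      by (intro prob_spaceI) (simp add: sp)
    show "sets (gauss_mixture S R) = sets borel" by (rule sets_mix)
    show "all_moments (gauss_mixture S R) (\<lambda>w. w $ k)" for k
      using S.coord_moments[of k] R.coord_moments[of k]
      by (auto simp: all_moments_def intro!: integrable_gauss_mixture S(2) R(2))
    show "(\<integral>w. w $ k * w $ l \<partial>gauss_mixture S R) = ((1/2) *\<^sub>R S + (1/2) *\<^sub>R R) $ k $ l" for k l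
      by (subst integrable_gauss_mixture)
        (auto simp: S.second_moment R.second_moment S(2) R(2)
          intro!: all_moments_integrable all_moments_mult S.coord_moments R.coord_moments)
    show "distr (gauss_mixture S R) borel uminus = gauss_mixture S R"
    proof (rule measure_eqI)
      fix A assume "A \<in> sets (distr (gauss_mixture S R) borel uminus)"
      then have [measurable]: "A \<in> sets borel" by simp
      have B: "uminus -` A \<in> sets borel"
        using measurable_sets_borel[of uminus borel A] by simp
      have "emeasure (gauss_law S) (uminus -` A) = emeasure (distr (gauss_law S) borel uminus) A"
        "emeasure (gauss_law R) (uminus -` A) = emeasure (distr (gauss_law R) borel uminus) A"
        by (auto simp: emeasure_distr sp)
      then show "emeasure (distr (gauss_mixture S R) borel uminus) A = emeasure (gauss_mixture S R) A"
        using B by (subst emeasure_distr)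
          (auto simp: sp emeasure_gauss_mixture S(2) R(2) S.symmetric R.symmetric)
    qed (simp add: sets_mix)
  qed
qed

text \<open>A strictly positive density makes the mixture and Lebesgue measure share null sets. This
  reduces the non-constancy of \<open>w \<bullet> w\<close> under the training law to a statement
  about spheres.\<close>

lemma AE_gauss_mixture_imp_lborel:
  assumes "AE x in gauss_mixture S R. P x"
    and "\<And>x. 0 < gauss_density S x" "\<And>x. 0 < gauss_density R x"
  shows "AE x in lborel. P x"
proof -
  have "0 < 1/2 * gauss_density S x + 1/2 * gauss_density R x" for x
    using assms(2,3)[of x] by (intro add_pos_pos) auto
  then show ?thesis
    using assms(1) unfolding gauss_mixture_def by (subst (asm) AE_density) (auto simp: ennreal_less_zero_iff)
qed

section \<open>Spiked covariances and the algebra of a projection\<close>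

lemma matrix_add_rdistrib: "(A + B) ** C = A ** C + B ** (C :: real^'n^'m)"
  by (simp add: matrix_matrix_mult_def vec_eq_iff sum.distrib algebra_simps)

lemma matrix_scaleR_left: "(k *\<^sub>R A) ** B = k *\<^sub>R (A ** (B :: real^'n^'m))"
  by (simp add: scalar_matrix_assoc)

lemma matrix_scaleR_right: "A ** (k *\<^sub>R B) = k *\<^sub>R (A ** (B :: real^'n^'m))"
  by (simp add: matrix_scalar_ac scalar_matrix_assoc)

lemmas matrix_bilinear = matrix_add_ldistrib matrix_add_rdistrib matrix_scaleR_left matrix_scaleR_right

text \<open>Every covariance, root and inverse needed here is a combination of a projection and the
  identity. This rule reduces matrix equations among them to equations between two
  coefficients.\<close>

lemma projection_pencil_mult:
  fixes P :: "real^'d^'d"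
  assumes "P ** P = P"
  shows "(p *\<^sub>R P + q *\<^sub>R mat 1) ** (p' *\<^sub>R P + q' *\<^sub>R mat 1) =
    (p * p' + p * q' + q * p') *\<^sub>R P + (q * q') *\<^sub>R mat 1"
  by (simp add: matrix_bilinear assms algebra_simps)

lemma transpose_add: "transpose (A + B) = transpose A + transpose (B :: real^'n^'m)"
  by (simp add: transpose_def vec_eq_iff)

context
  fixes U :: "real^'r^'d" and \<epsilon> :: real
  assumes orth: "transpose U ** U = mat 1" and eps: "\<epsilon> > 0"
begin

lemma projection_orth: "(U ** transpose U) ** (U ** transpose U) = U ** transpose U"
  using orth by (metis matrix_mul_assoc matrix_mul_lid)

lemma spiked_cov_root:
  obtains L where "spiked_cov U \<epsilon> = L ** transpose L" "det L \<noteq> 0"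
proof -
  let ?P = "U ** transpose U"
  define a where "a = sqrt (1 + \<epsilon>)"
  define b where "b = sqrt \<epsilon>"
  \<comment> \<open>The covariance has eigenvalue \<open>1 + \<epsilon>\<close> on the range of the
    projection and \<epsilon> on its complement; \<open>L\<close> acts there by the square roots
    \<open>a\<close> and \<open>b\<close>.\<close>
  define L where "L = (a - b) *\<^sub>R ?P + b *\<^sub>R mat 1"
  have ab: "a \<noteq> 0" "b \<noteq> 0" "a * a = 1 + \<epsilon>" "b * b = \<epsilon>" using eps by (auto simp: a_def b_def)
  have "transpose L = L"
    by (simp add: L_def transpose_add transpose_scalar matrix_transpose_mul)
  moreover have "L ** L = spiked_cov U \<epsilon>"
    unfolding L_def projection_pencil_mult[OF projection_orth]
    using ab by (simp add: spiked_cov_def algebra_simps)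
  \<comment> \<open>The inverse of \<open>L\<close> has eigenvalues \<open>1 / a\<close> and
    \<open>1 / b\<close>; the sum shown to vanish is the coefficient of \<open>?P\<close> in the
    product.\<close>
  moreover have "(a - b) * (1 / a - 1 / b) + (a - b) * (1 / b) + b * (1 / a - 1 / b) = 0"
    using ab(1,2) by (simp add: field_simps)
  then have "L ** ((1 / a - 1 / b) *\<^sub>R ?P + (1 / b) *\<^sub>R mat 1) = mat 1"
    unfolding L_def projection_pencil_mult[OF projection_orth]
    using ab(2) by simp
  then have "det L \<noteq> 0"
    by (metis det_I det_mul mult_zero_left zero_neq_one)
  ultimately show thesis using that by metis
qed

lemma centred_law_spiked: "centred_law (gauss_law (spiked_cov U \<epsilon>)) (spiked_cov U \<epsilon>)"
proof -
  obtain L where "spiked_cov U \<epsilon> = L ** transpose L" "det L \<noteq> 0" by (rule spiked_cov_root)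
  then show ?thesis by (rule centred_law_gauss_law)
qed

lemma gauss_density_spiked_pos: "0 < gauss_density (spiked_cov U \<epsilon>) x"
proof -
  obtain L where L: "spiked_cov U \<epsilon> = L ** transpose L" "det L \<noteq> 0" by (rule spiked_cov_root)
  then have "det (spiked_cov U \<epsilon>) = (det L)\<^sup>2" by (simp add: det_mul power2_eq_square)
  with L(2) have "0 < det (spiked_cov U \<epsilon>)" by simp
  then show ?thesis by (simp add: gauss_density_def)
qed

end

section \<open>The noise law\<close>

lemma sets_noise_law[simp, measurable_cong]: "sets (noise_law \<sigma>) = sets borel"
  by (simp add: noise_law_def)

lemma integral_noise_law:
  "\<sigma> > 0 \<Longrightarrow> f \<in> borel_measurable borel \<Longrightarrow>
    (\<integral>x. f x \<partial>noise_law \<sigma>) = (\<integral>x. normal_density 0 \<sigma> x * f x \<partial>lborel)" for f :: "real \<Rightarrow> real"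
  unfolding noise_law_def by (subst if_not_P, simp, subst integral_density) (auto simp: normal_density_nonneg)

lemma prob_space_noise_law: "\<sigma> \<ge> 0 \<Longrightarrow> prob_space (noise_law \<sigma>)"
  by (auto simp: noise_law_def intro: prob_space_return prob_space_normal_density)

lemma all_moments_noise_law:
  assumes "\<sigma> \<ge> 0" shows "all_moments (noise_law \<sigma>) (\<lambda>x. x)"
proof (cases "\<sigma> = 0")
  case True
  have "integrable (return borel (0::real)) (\<lambda>x. \<bar>x\<bar> ^ k)" for k
    by (simp add: integrable_iff_bounded nn_integral_return)
  with True show ?thesis unfolding all_moments_def noise_law_def by simp
next
  case False
  with assms have "\<sigma> > 0" by simp
  have "integrable (noise_law \<sigma>) (\<lambda>x. \<bar>x\<bar> ^ k)" for k
    using integrable_normal_moment_abs[OF \<open>\<sigma> > 0\<close>, of 0 k] \<open>\<sigma> > 0\<close>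
    unfolding noise_law_def by (subst if_not_P, simp, subst integrable_density) (auto simp: normal_density_nonneg)
  then show ?thesis by (simp add: all_moments_def)
qed

lemma noise_law_moments:
  assumes "\<sigma> \<ge> 0"
  shows "(\<integral>x. x \<partial>noise_law \<sigma>) = 0" "(\<integral>x. x\<^sup>2 \<partial>noise_law \<sigma>) = \<sigma>\<^sup>2"
proof -
  have "(\<integral>x. x \<partial>noise_law \<sigma>) = 0 \<and> (\<integral>x. x\<^sup>2 \<partial>noise_law \<sigma>) = \<sigma>\<^sup>2"
  proof (cases "\<sigma> = 0")
    case True
    then show ?thesis by (simp add: noise_law_def integral_return)
  next
    case False
    with assms have "\<sigma> > 0" by simp
    then show ?thesis
      using integral_normal_moment_odd[of \<sigma> 0 0] integral_normal_moment_even[of \<sigma> 0 1]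
      by (simp add: integral_noise_law fact_numeral)
  qed
  then show "(\<integral>x. x \<partial>noise_law \<sigma>) = 0" "(\<integral>x. x\<^sup>2 \<partial>noise_law \<sigma>) = \<sigma>\<^sup>2" by auto
qed

lemma noise_law_symmetric: "distr (noise_law \<sigma>) borel uminus = noise_law \<sigma>"
proof (cases "\<sigma> = 0")
  case True
  then show ?thesis by (simp add: noise_law_def distr_return)
next
  case False
  have "density lborel (\<lambda>x. ennreal (normal_density 0 \<sigma> x)) =
      density (distr lborel borel uminus) (\<lambda>x. ennreal (normal_density 0 \<sigma> x))"
    by (simp add: lborel_distr_uminus)
  also have "\<dots> = distr (density lborel (\<lambda>x. ennreal (normal_density 0 \<sigma> (- x)))) borel uminus"
    by (rule density_distr) auto
  finally show ?thesis using False by (simp add: noise_law_def normal_density_def)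
qed


section \<open>The risk as a regression error\<close>

lemma sum_UNIV_option: "(\<Sum>i\<in>UNIV. f i) = f None + (\<Sum>i\<in>UNIV. f (Some (i :: 'd::finite)))"
  by (simp add: UNIV_option_conv sum.reindex)

text \<open>The vector whose inner product with the query input is the prediction. The sum stops at
  \<open>n\<close> since the masked last row contributes zero, so the vector does not depend on the
  query.\<close>

definition context_map ::
    "real^'d^'d \<Rightarrow> real^'d \<Rightarrow> real^'d \<Rightarrow> real \<Rightarrow> nat \<Rightarrow> real^'d \<Rightarrow> (nat \<Rightarrow> real^'d) \<Rightarrow> (nat \<Rightarrow> real) \<Rightarrow> real^'d" where
  "context_map A b u c n w x \<xi> =
     (1 / real n) *\<^sub>R (\<Sum>i = 1..n. (u \<bullet> x i + c * label w x \<xi> i) *\<^sub>R (A *v x i + label w x \<xi> i *\<^sub>R b))"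

text \<open>The query row ends in 0, so the prediction sees the product of query and key weights
  through its rows \<open>Some k\<close>. This block and \<open>key_vector\<close> are those rows,
  split at the label column.\<close>

definition key_matrix :: "'d::finite weights \<Rightarrow> real^'d^'d" where
  "key_matrix W = (\<chi> k l. (fst W ** transpose (fst (snd W))) $ Some k $ Some l)"

definition key_vector :: "'d::finite weights \<Rightarrow> real^'d" where
  "key_vector W = (\<chi> k. (fst W ** transpose (fst (snd W))) $ Some k $ None)"

definition value_vector :: "'d::finite weights \<Rightarrow> real^'d" where
  "value_vector W = (\<chi> k. (snd (snd W) *v snoc_vec 0 1) $ Some k)"

definition value_coeff :: "'d::finite weights \<Rightarrow> real" where
  "value_coeff W = (snd (snd W) *v snoc_vec 0 1) $ None"

lemma linear_attention_prompt:
  "linear_attention W n (prompt n x (label w x \<xi>)) =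
     x (n + 1) \<bullet> context_map (key_matrix W) (key_vector W) (value_vector W) (value_coeff W) n w x \<xi>"
proof -
  obtain WQ WK WV where W: "W = (WQ, WK, WV)" by (cases W) auto
  define M where "M = WQ ** transpose WK"
  define v where "v = WV *v snoc_vec 0 1"
  let ?y = "label w x \<xi>"
  have q: "prompt n x ?y (n + 1) = snoc_vec (x (n + 1)) 0" by (simp add: prompt_def)
  have key: "(snoc_vec a 0 v* M) \<bullet> snoc_vec z t = a \<bullet> (key_matrix W *v z + t *\<^sub>R key_vector W)" for a z :: "real^'a" and t
    by (simp add: dot_lmul_matrix inner_vec_def[of "snoc_vec a 0"] sum_UNIV_option snoc_vec_def
        matrix_vector_mult_def key_matrix_def key_vector_def W flip: M_def)
      (simp add: sum_UNIV_option inner_vec_def mult.commute add.commute)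
  have v: "v $ Some k = value_vector W $ k" "v $ None = value_coeff W" for k
    by (simp_all add: value_vector_def value_coeff_def W v_def)
  have val: "snoc_vec z t \<bullet> v = value_vector W \<bullet> z + value_coeff W * t" for z :: "real^'a" and t
    by (simp add: inner_vec_def sum_UNIV_option snoc_vec_def v mult.commute)
  have "linear_attention W n (prompt n x ?y) = (1 / real n) *
      (\<Sum>i = 1..n. ((snoc_vec (x (n + 1)) 0 v* M) \<bullet> snoc_vec (x i) (?y i)) * (snoc_vec (x i) (?y i) \<bullet> v))"
    unfolding linear_attention_def W case_prod_conv M_def[symmetric] v_def[symmetric] q
    by (simp add: masked_def prompt_def)
  also have "\<dots> = x (n + 1) \<bullet> context_map (key_matrix W) (key_vector W) (value_vector W) (value_coeff W) n w x \<xi>"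
    by (simp add: key val context_map_def inner_sum_right mult.commute)
  finally show ?thesis .
qed

text \<open>What is left of \<open>data_law\<close> once query input and query noise have been
  integrated out.\<close>

definition context_law ::
    "(real^'d) measure \<Rightarrow> real \<Rightarrow> nat \<Rightarrow> ((real^'d) \<times> (nat \<Rightarrow> real^'d) \<times> (nat \<Rightarrow> real)) measure" where
  "context_law T \<sigma> n = T \<Otimes>\<^sub>M ((\<Pi>\<^sub>M i\<in>{1..n}. std_gauss) \<Otimes>\<^sub>M (\<Pi>\<^sub>M i\<in>{1..n}. noise_law \<sigma>))"

lemma matrix_vector_mult_measurable[measurable]:
  "(\<lambda>x. A *v (f x)) \<in> borel_measurable M" if [measurable]: "f \<in> borel_measurable M" for A :: "real^'n^'m"
proof -
  have [measurable]: "(*v) A \<in> borel_measurable borel"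
    by (intro borel_measurable_continuous_onI matrix_vector_mult_linear_continuous_on)
  show ?thesis by measurable
qed

text \<open>The index set is kept general because the same function is integrated over
  \<open>{1..n + 1}\<close> with the query and over \<open>{1..n}\<close> without it.\<close>

lemma context_map_measurable:
  assumes [measurable_cong]: "sets T = sets borel" and "{1..n} \<subseteq> I"
  shows "(\<lambda>(w, x, \<xi>). context_map A b u c n w x \<xi>) \<in>
    borel_measurable (T \<Otimes>\<^sub>M ((\<Pi>\<^sub>M i\<in>I. std_gauss) \<Otimes>\<^sub>M (\<Pi>\<^sub>M i\<in>I. noise_law \<sigma>)))"
proof -
  let ?M = "T \<Otimes>\<^sub>M ((\<Pi>\<^sub>M i\<in>I. std_gauss :: (real^'a) measure) \<Otimes>\<^sub>M (\<Pi>\<^sub>M i\<in>I. noise_law \<sigma>))"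
  have "(\<lambda>p. (u \<bullet> fst (snd p) i + c * (fst p \<bullet> fst (snd p) i + snd (snd p) i)) *\<^sub>R
      (A *v fst (snd p) i + (fst p \<bullet> fst (snd p) i + snd (snd p) i) *\<^sub>R b)) \<in> borel_measurable ?M"
    if "i \<in> {1..n}" for i
  proof -
    have i: "i \<in> I" using that assms(2) by auto
    have "(\<lambda>p. fst (snd p) i) \<in> measurable ?M std_gauss" "(\<lambda>p. snd (snd p) i) \<in> measurable ?M (noise_law \<sigma>)"
      by (rule measurable_compose[OF measurable_compose[OF measurable_snd measurable_fst] measurable_component_singleton[OF i]],
          rule measurable_compose[OF measurable_compose[OF measurable_snd measurable_snd] measurable_component_singleton[OF i]])
    then have [measurable]: "(\<lambda>p. fst (snd p) i) \<in> borel_measurable ?M" "(\<lambda>p. snd (snd p) i) \<in> borel_measurable ?M"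
      by (simp_all cong: measurable_cong_sets)
    show ?thesis by measurable
  qed
  then show ?thesis
    unfolding context_map_def label_def case_prod_unfold
    by (intro borel_measurable_scaleR[OF borel_measurable_const] borel_measurable_sum)
qed

lemma context_map_query: "context_map A b u c n w (x(n + 1 := a)) (\<xi>(n + 1 := z)) = context_map A b u c n w x \<xi>"
  unfolding context_map_def label_def by (intro arg_cong2[where f=scaleR] refl sum.cong) auto

lemma nn_integral_noise_square:
  assumes "\<sigma> \<ge> 0"
  shows "(\<integral>\<^sup>+z. ennreal ((z + a)\<^sup>2) \<partial>noise_law \<sigma>) = ennreal (\<sigma>\<^sup>2 + a\<^sup>2)"
proof -
  interpret prob_space "noise_law \<sigma>" by (rule prob_space_noise_law) fact
  have int: "integrable (noise_law \<sigma>) (\<lambda>z. z)" "integrable (noise_law \<sigma>) (\<lambda>z. z\<^sup>2)"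
    using all_moments_noise_law[OF assms] by (auto intro!: all_moments_integrable all_moments_power)
  have eq: "(z + a)\<^sup>2 = z\<^sup>2 + 2 * a * z + a\<^sup>2" for z by (simp add: power2_eq_square algebra_simps)
  have "(\<integral>\<^sup>+z. ennreal ((z + a)\<^sup>2) \<partial>noise_law \<sigma>) = ennreal (\<integral>z. (z + a)\<^sup>2 \<partial>noise_law \<sigma>)"
  proof (intro nn_integral_eq_integral)
    show "integrable (noise_law \<sigma>) (\<lambda>z. (z + a)\<^sup>2)"
      unfolding eq by (intro Bochner_Integration.integrable_add integrable_mult_right int integrable_const)
  qed auto
  also have "(\<integral>z. (z + a)\<^sup>2 \<partial>noise_law \<sigma>) = (\<integral>z. z\<^sup>2 \<partial>noise_law \<sigma>) + 2 * a * (\<integral>z. z \<partial>noise_law \<sigma>) + a\<^sup>2"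
    unfolding eq using int prob_space by simp
  also have "\<dots> = \<sigma>\<^sup>2 + a\<^sup>2"
    by (simp add: noise_law_moments[OF assms])
  finally show ?thesis .
qed

lemma inner_square_expand: "(x \<bullet> v)\<^sup>2 = (\<Sum>k\<in>UNIV. \<Sum>l\<in>UNIV. (v $ k * v $ l) * (x $ k * x $ l))" for x :: "real^'d"
  by (simp add: inner_vec_def power2_eq_square sum_product algebra_simps)

lemma nn_integral_gauss_inner_square:
  assumes "0 \<le> s"
  shows "(\<integral>\<^sup>+x. ennreal (s + (x \<bullet> v)\<^sup>2) \<partial>(std_gauss :: (real^'d) measure)) = ennreal (s + (norm v)\<^sup>2)"
proof -
  interpret prob_space "std_gauss :: (real^'d) measure" by (rule prob_space_std_gauss)
  have int: "integrable (std_gauss :: (real^'d) measure) (\<lambda>x. x $ k * x $ l)" for k l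
    by (intro all_moments_integrable all_moments_mult all_moments_std_gauss)
  have int2: "integrable (std_gauss :: (real^'d) measure) (\<lambda>x. (x \<bullet> v)\<^sup>2)"
    unfolding inner_square_expand by (intro Bochner_Integration.integrable_sum integrable_mult_right int)
  have "(\<integral>x. (x \<bullet> v)\<^sup>2 \<partial>(std_gauss :: (real^'d) measure)) = (\<Sum>k\<in>UNIV. \<Sum>l\<in>UNIV. (v $ k * v $ l) * of_bool (k = l))"
    unfolding inner_square_expand
    by (subst Bochner_Integration.integral_sum, intro Bochner_Integration.integrable_sum integrable_mult_right int,
        subst Bochner_Integration.integral_sum, intro integrable_mult_right int)
      (simp add: std_gauss_second_moment)
  also have "\<dots> = (norm v)\<^sup>2"
    unfolding power2_norm_eq_inner by (simp add: inner_vec_def of_bool_def if_distrib cong: if_cong)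
  finally have "(\<integral>x. s + (x \<bullet> v)\<^sup>2 \<partial>(std_gauss :: (real^'d) measure)) = s + (norm v)\<^sup>2"
    using int2 by (simp add: prob_space)
  moreover have "(\<integral>\<^sup>+x. ennreal (s + (x \<bullet> v)\<^sup>2) \<partial>(std_gauss :: (real^'d) measure)) =
      ennreal (\<integral>x. s + (x \<bullet> v)\<^sup>2 \<partial>(std_gauss :: (real^'d) measure))"
    using int2 assms by (intro nn_integral_eq_integral) auto
  ultimately show ?thesis by simp
qed

text \<open>Integrating the query noise turns the squared error into \<open>\<sigma>^2\<close> plus
  the square of an inner product with the query input; integrating that input, whose covariance is
  the identity, turns the square into a squared norm. Working with nonnegative integrals lets
  Tonelli move the query coordinates innermost.\<close>

lemma nn_integral_query_error:
  fixes h :: "real^'d \<Rightarrow> (nat \<Rightarrow> real^'d) \<Rightarrow> (nat \<Rightarrow> real) \<Rightarrow> real^'d"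
  assumes \<sigma>: "\<sigma> \<ge> 0" and T: "prob_space T" and sets_T[measurable_cong]: "sets T = sets borel"
    and meas: "\<And>I. {1..n} \<subseteq> I \<Longrightarrow> (\<lambda>(w, x, \<xi>). h w x \<xi>) \<in>
      borel_measurable (T \<Otimes>\<^sub>M ((\<Pi>\<^sub>M i\<in>I. std_gauss) \<Otimes>\<^sub>M (\<Pi>\<^sub>M i\<in>I. noise_law \<sigma>)))"
    and query: "\<And>w x \<xi> a z. h w (x(n + 1 := a)) (\<xi>(n + 1 := z)) = h w x \<xi>"
  shows "(\<integral>\<^sup>+(w, x, \<xi>). ennreal ((\<xi> (n + 1) + x (n + 1) \<bullet> (w - h w x \<xi>))\<^sup>2) \<partial>data_law T \<sigma> n) =
    (\<integral>\<^sup>+(w, x, \<xi>). ennreal (\<sigma>\<^sup>2 + (norm (w - h w x \<xi>))\<^sup>2) \<partial>context_law T \<sigma> n)"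
proof -
  interpret T: prob_space T by fact
  interpret N: prob_space "noise_law \<sigma>" by (rule prob_space_noise_law) fact
  interpret G: prob_space "std_gauss :: (real^'d) measure" by (rule prob_space_std_gauss)
  interpret NP: product_sigma_finite "\<lambda>_::nat. noise_law \<sigma>" ..
  interpret GP: product_sigma_finite "\<lambda>_::nat. std_gauss :: (real^'d) measure" ..
  define q where "q = n + 1"
  let ?I = "{1..n}"
  let ?G = "\<lambda>I::nat set. \<Pi>\<^sub>M i\<in>I. std_gauss :: (real^'d) measure" and ?N = "\<lambda>I::nat set. \<Pi>\<^sub>M i\<in>I. noise_law \<sigma>"
  have ins: "{1..n + 1} = insert q ?I" and q: "q \<notin> ?I" by (auto simp: q_def)
  have sp: "space (noise_law \<sigma>) = UNIV"
    by (simp add: sets_eq_imp_space_eq[OF sets_noise_law])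
  note query = query[folded q_def]
  have PN: "prob_space (?N I)" and PG: "prob_space (?G I)" for I
    by (auto intro!: prob_space_PiM N.prob_space_axioms G.prob_space_axioms)
  interpret PN: prob_space "?N I" for I by (rule PN)
  interpret PG: prob_space "?G I" for I by (rule PG)
  interpret PGN: pair_prob_space "?G I" "?N J" for I J ..
  interpret PGN': pair_prob_space "std_gauss :: (real^'d) measure" "?N J" for J ..
  have h_q: "h w (x(q := a)) \<xi> = h w x \<xi>" "h w x (\<xi>(q := z)) = h w x \<xi>" for w x \<xi> a z
    using query[of w x a \<xi> "\<xi> q"] query[of w x "x q" \<xi> z] by (simp_all only: fun_upd_triv)
  have m1[measurable]: "(\<lambda>(w, x, \<xi>). h w x \<xi>) \<in> borel_measurable (T \<Otimes>\<^sub>M (?G (insert q ?I) \<Otimes>\<^sub>M ?N (insert q ?I)))"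
    by (rule meas) auto
  have m2[measurable]: "(\<lambda>(w, x, \<xi>). h w x \<xi>) \<in> borel_measurable (T \<Otimes>\<^sub>M (?G ?I \<Otimes>\<^sub>M ?N ?I))"
    by (rule meas) auto
  let ?E = "\<lambda>w x \<xi>. ennreal ((\<xi> q + x q \<bullet> (w - h w x \<xi>))\<^sup>2)"
  let ?R = "\<lambda>w x \<xi>. ennreal (\<sigma>\<^sup>2 + (norm (w - h w x \<xi>))\<^sup>2)"
  have mE: "(\<lambda>(w, x, \<xi>). ?E w x \<xi>) \<in> borel_measurable (T \<Otimes>\<^sub>M (?G (insert q ?I) \<Otimes>\<^sub>M ?N (insert q ?I)))"
    using m1 unfolding case_prod_unfold by measurable
  have mR: "(\<lambda>(w, x, \<xi>). ?R w x \<xi>) \<in> borel_measurable (T \<Otimes>\<^sub>M (?G ?I \<Otimes>\<^sub>M ?N ?I))"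
    using m2 unfolding case_prod_unfold by measurable
  have inner: "(\<integral>\<^sup>+x. \<integral>\<^sup>+\<xi>. ?E w x \<xi> \<partial>?N (insert q ?I) \<partial>?G (insert q ?I)) = (\<integral>\<^sup>+x. \<integral>\<^sup>+\<xi>. ?R w x \<xi> \<partial>?N ?I \<partial>?G ?I)"
    if w: "w \<in> space T" for w
  proof -
    have hw1[measurable]: "(\<lambda>(x, \<xi>). h w x \<xi>) \<in> borel_measurable (?G (insert q ?I) \<Otimes>\<^sub>M ?N (insert q ?I))"
      using measurable_compose[OF measurable_Pair1'[OF w] m1] by (simp add: case_prod_unfold)
    have hw2[measurable]: "(\<lambda>(x, \<xi>). h w x \<xi>) \<in> borel_measurable (?G ?I \<Otimes>\<^sub>M ?N ?I)"
      using measurable_compose[OF measurable_Pair1'[OF w] m2] by (simp add: case_prod_unfold)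
    \<comment> \<open>Between the two integrations the noise has already lost coordinate
      \<open>q\<close> while the inputs still have it. Refilling it with 0 does not change
      \<open>h\<close> and reduces measurability to the full space.\<close>
    have mixed[measurable]: "(\<lambda>(x, \<xi>). h w x \<xi>) \<in> borel_measurable (?G (insert q ?I) \<Otimes>\<^sub>M ?N ?I)"
    proof -
      have "(\<lambda>p. (fst p, (snd p)(q := 0))) \<in> measurable (?G (insert q ?I) \<Otimes>\<^sub>M ?N ?I) (?G (insert q ?I) \<Otimes>\<^sub>M ?N (insert q ?I))"
        by measurable (simp add: sp)
      from measurable_compose[OF this hw1] show ?thesis
        by (simp add: case_prod_unfold h_q)
    qed
    have "(\<integral>\<^sup>+x. \<integral>\<^sup>+\<xi>. ?E w x \<xi> \<partial>?N (insert q ?I) \<partial>?G (insert q ?I)) =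
        (\<integral>\<^sup>+x. \<integral>\<^sup>+\<xi>. ennreal (\<sigma>\<^sup>2 + (x q \<bullet> (w - h w x \<xi>))\<^sup>2) \<partial>?N ?I \<partial>?G (insert q ?I))"
    proof (rule nn_integral_cong)
      fix x assume x: "x \<in> space (?G (insert q ?I))"
      have [measurable]: "(\<lambda>\<xi>. h w x \<xi>) \<in> borel_measurable (?N (insert q ?I))"
        using measurable_compose[OF measurable_Pair1'[OF x] hw1] by simp
      have "(\<integral>\<^sup>+\<xi>. ?E w x \<xi> \<partial>?N (insert q ?I)) = (\<integral>\<^sup>+\<xi>. \<integral>\<^sup>+z. ?E w x (\<xi>(q := z)) \<partial>noise_law \<sigma> \<partial>?N ?I)"
        using q by (intro NP.product_nn_integral_insert) measurable
      also have "\<dots> = (\<integral>\<^sup>+\<xi>. ennreal (\<sigma>\<^sup>2 + (x q \<bullet> (w - h w x \<xi>))\<^sup>2) \<partial>?N ?I)"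
        using \<sigma> by (intro nn_integral_cong) (simp add: h_q nn_integral_noise_square del: ennreal_plus)
      finally show "(\<integral>\<^sup>+\<xi>. ?E w x \<xi> \<partial>?N (insert q ?I)) = (\<integral>\<^sup>+\<xi>. ennreal (\<sigma>\<^sup>2 + (x q \<bullet> (w - h w x \<xi>))\<^sup>2) \<partial>?N ?I)" .
    qed
    also have "\<dots> = (\<integral>\<^sup>+x. \<integral>\<^sup>+a. \<integral>\<^sup>+\<xi>. ennreal (\<sigma>\<^sup>2 + (a \<bullet> (w - h w x \<xi>))\<^sup>2) \<partial>?N ?I \<partial>std_gauss \<partial>?G ?I)"
      using q by (subst GP.product_nn_integral_insert, simp, simp, measurable) (simp add: h_q del: ennreal_plus)
    also have "\<dots> = (\<integral>\<^sup>+x. \<integral>\<^sup>+\<xi>. ?R w x \<xi> \<partial>?N ?I \<partial>?G ?I)"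
    proof (rule nn_integral_cong)
      fix x assume x: "x \<in> space (?G ?I)"
      have [measurable]: "(\<lambda>\<xi>. h w x \<xi>) \<in> borel_measurable (?N ?I)"
        using measurable_compose[OF measurable_Pair1'[OF x] hw2] by simp
      have "(\<integral>\<^sup>+a. \<integral>\<^sup>+\<xi>. ennreal (\<sigma>\<^sup>2 + (a \<bullet> (w - h w x \<xi>))\<^sup>2) \<partial>?N ?I \<partial>std_gauss) =
          (\<integral>\<^sup>+\<xi>. \<integral>\<^sup>+a. ennreal (\<sigma>\<^sup>2 + (a \<bullet> (w - h w x \<xi>))\<^sup>2) \<partial>std_gauss \<partial>?N ?I)"
        by (rule PGN'.Fubini'[symmetric]) measurable
      then show "(\<integral>\<^sup>+a. \<integral>\<^sup>+\<xi>. ennreal (\<sigma>\<^sup>2 + (a \<bullet> (w - h w x \<xi>))\<^sup>2) \<partial>?N ?I \<partial>std_gauss) = (\<integral>\<^sup>+\<xi>. ?R w x \<xi> \<partial>?N ?I)"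
        by (simp add: nn_integral_gauss_inner_square del: ennreal_plus)
    qed
    finally show ?thesis .
  qed
  have fub: "(\<integral>\<^sup>+(w, x, \<xi>). F w x \<xi> \<partial>(T \<Otimes>\<^sub>M (?G I \<Otimes>\<^sub>M ?N I))) = (\<integral>\<^sup>+w. \<integral>\<^sup>+x. \<integral>\<^sup>+\<xi>. F w x \<xi> \<partial>?N I \<partial>?G I \<partial>T)"
    if F: "(\<lambda>(w, x, \<xi>). F w x \<xi>) \<in> borel_measurable (T \<Otimes>\<^sub>M (?G I \<Otimes>\<^sub>M ?N I))" for F :: "real^'d \<Rightarrow> (nat \<Rightarrow> real^'d) \<Rightarrow> (nat \<Rightarrow> real) \<Rightarrow> ennreal" and I
  proof -
    have "(\<integral>\<^sup>+(w, x, \<xi>). F w x \<xi> \<partial>(T \<Otimes>\<^sub>M (?G I \<Otimes>\<^sub>M ?N I))) = (\<integral>\<^sup>+w. \<integral>\<^sup>+(x, \<xi>). F w x \<xi> \<partial>(?G I \<Otimes>\<^sub>M ?N I) \<partial>T)"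
      using PGN.nn_integral_fst[OF F] by simp
    also have "\<dots> = (\<integral>\<^sup>+w. \<integral>\<^sup>+x. \<integral>\<^sup>+\<xi>. F w x \<xi> \<partial>?N I \<partial>?G I \<partial>T)"
    proof (rule nn_integral_cong)
      fix w assume w: "w \<in> space T"
      have "(\<lambda>(x, \<xi>). F w x \<xi>) \<in> borel_measurable (?G I \<Otimes>\<^sub>M ?N I)"
        using measurable_compose[OF measurable_Pair1'[OF w] F] by (simp add: case_prod_unfold)
      from PN.nn_integral_fst[OF this] show "(\<integral>\<^sup>+(x, \<xi>). F w x \<xi> \<partial>(?G I \<Otimes>\<^sub>M ?N I)) = (\<integral>\<^sup>+x. \<integral>\<^sup>+\<xi>. F w x \<xi> \<partial>?N I \<partial>?G I)"
        by simp
    qed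
    finally show ?thesis .
  qed
  show ?thesis
    unfolding data_law_def context_law_def ins unfolding q_def[symmetric] fub[OF mE] fub[OF mR]
    by (rule nn_integral_cong) (rule inner)
qed

text \<open>For a nonnegative measurable integrand the Bochner integral is \<open>enn2real\<close>
  of the nonnegative one, even when that is infinite, so the identity transfers without a separate
  integrability argument.\<close>

lemma risk_eq:
  fixes W :: "'d::finite weights"
  assumes \<sigma>: "\<sigma> \<ge> 0" and T: "prob_space T" and sets_T[measurable_cong]: "sets T = sets borel"
  shows "risk T \<sigma> n W = (\<integral>(w, x, \<xi>). \<sigma>\<^sup>2 + (norm (w -
    context_map (key_matrix W) (key_vector W) (value_vector W) (value_coeff W) n w x \<xi>))\<^sup>2 \<partial>context_law T \<sigma> n)"
proof -
  define h where "h = context_map (key_matrix W) (key_vector W) (value_vector W) (value_coeff W) n"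
  have meas: "(\<lambda>(w, x, \<xi>). h w x \<xi>) \<in>
      borel_measurable (T \<Otimes>\<^sub>M ((\<Pi>\<^sub>M i\<in>I. std_gauss) \<Otimes>\<^sub>M (\<Pi>\<^sub>M i\<in>I. noise_law \<sigma>)))" if "{1..n} \<subseteq> I" for I
    unfolding h_def using sets_T that by (rule context_map_measurable)
  have meas1[measurable]: "(\<lambda>(w, x, \<xi>). h w x \<xi>) \<in>
      borel_measurable (T \<Otimes>\<^sub>M ((\<Pi>\<^sub>M i\<in>{1..n + 1}. std_gauss) \<Otimes>\<^sub>M (\<Pi>\<^sub>M i\<in>{1..n + 1}. noise_law \<sigma>)))"
    by (rule meas) auto
  have meas2[measurable]: "(\<lambda>(w, x, \<xi>). h w x \<xi>) \<in>
      borel_measurable (T \<Otimes>\<^sub>M ((\<Pi>\<^sub>M i\<in>{1..n}. std_gauss) \<Otimes>\<^sub>M (\<Pi>\<^sub>M i\<in>{1..n}. noise_law \<sigma>)))"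
    by (rule meas) auto
  have mE: "(\<lambda>(w, x, \<xi>). (\<xi> (n + 1) + x (n + 1) \<bullet> (w - h w x \<xi>))\<^sup>2) \<in> borel_measurable (data_law T \<sigma> n)"
    using meas1 unfolding case_prod_unfold data_law_def by measurable
  have mR: "(\<lambda>(w, x, \<xi>). \<sigma>\<^sup>2 + (norm (w - h w x \<xi>))\<^sup>2) \<in> borel_measurable (context_law T \<sigma> n)"
    using meas2 unfolding case_prod_unfold context_law_def by measurable
  have "risk T \<sigma> n W = (\<integral>(w, x, \<xi>). (\<xi> (n + 1) + x (n + 1) \<bullet> (w - h w x \<xi>))\<^sup>2 \<partial>data_law T \<sigma> n)"
    unfolding risk_def linear_attention_prompt h_def[symmetric]
    by (intro Bochner_Integration.integral_cong) (auto simp: label_def inner_diff_right inner_commute algebra_simps)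
  also have "\<dots> = enn2real (\<integral>\<^sup>+(w, x, \<xi>). ennreal ((\<xi> (n + 1) + x (n + 1) \<bullet> (w - h w x \<xi>))\<^sup>2) \<partial>data_law T \<sigma> n)"
    using mE by (subst integral_eq_nn_integral) (auto simp: case_prod_unfold)
  also have "\<dots> = enn2real (\<integral>\<^sup>+(w, x, \<xi>). ennreal (\<sigma>\<^sup>2 + (norm (w - h w x \<xi>))\<^sup>2) \<partial>context_law T \<sigma> n)"
    by (subst nn_integral_query_error[OF \<sigma> T sets_T meas]) (simp_all only: h_def context_map_query)
  also have "\<dots> = (\<integral>(w, x, \<xi>). \<sigma>\<^sup>2 + (norm (w - h w x \<xi>))\<^sup>2 \<partial>context_law T \<sigma> n)"
    using mR by (subst integral_eq_nn_integral) (auto simp: case_prod_unfold)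
  finally show ?thesis by (simp add: h_def)
qed


section \<open>Moments of the context\<close>

lemma distr_pair_fst_prob:
  assumes "prob_space M1" "prob_space M2"
  shows "distr (M1 \<Otimes>\<^sub>M M2) M1 fst = M1"
proof (rule measure_eqI)
  interpret M1: prob_space M1 by fact
  interpret M2: prob_space M2 by fact
  fix A assume "A \<in> sets (distr (M1 \<Otimes>\<^sub>M M2) M1 fst)"
  then have A: "A \<in> sets M1" by simp
  have "fst -` A \<inter> space (M1 \<Otimes>\<^sub>M M2) = A \<times> space M2"
    using sets.sets_into_space[OF A] by (auto simp: space_pair_measure)
  then show "emeasure (distr (M1 \<Otimes>\<^sub>M M2) M1 fst) A = emeasure M1 A"
    using A by (simp add: emeasure_distr M2.emeasure_pair_measure_Times M2.emeasure_space_1)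
qed simp

lemma distr_pair_snd_prob:
  assumes "prob_space M1" "prob_space M2"
  shows "distr (M1 \<Otimes>\<^sub>M M2) M2 snd = M2"
proof (rule measure_eqI)
  interpret M1: prob_space M1 by fact
  interpret M2: prob_space M2 by fact
  fix A assume "A \<in> sets (distr (M1 \<Otimes>\<^sub>M M2) M2 snd)"
  then have A: "A \<in> sets M2" by simp
  have "snd -` A \<inter> space (M1 \<Otimes>\<^sub>M M2) = space M1 \<times> A"
    using sets.sets_into_space[OF A] by (auto simp: space_pair_measure)
  then show "emeasure (distr (M1 \<Otimes>\<^sub>M M2) M2 snd) A = emeasure M2 A"
    using A by (simp add: emeasure_distr M2.emeasure_pair_measure_Times M1.emeasure_space_1)
qed simp

lemma all_moments_fst:
  assumes "prob_space M1" "prob_space M2" "all_moments M1 f"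
  shows "all_moments (M1 \<Otimes>\<^sub>M M2) (\<lambda>p. f (fst p))"
  using all_moments_distr[OF measurable_fst] distr_pair_fst_prob[OF assms(1,2)] assms(3) by metis

lemma all_moments_snd:
  assumes "prob_space M1" "prob_space M2" "all_moments M2 f"
  shows "all_moments (M1 \<Otimes>\<^sub>M M2) (\<lambda>p. f (snd p))"
  using all_moments_distr[OF measurable_snd] distr_pair_snd_prob[OF assms(1,2)] assms(3) by metis

lemma integral_pair_mult:
  fixes f g :: "_ \<Rightarrow> real"
  assumes p: "prob_space M1" "prob_space M2" and f: "all_moments M1 f" and g: "all_moments M2 g"
  shows "(\<integral>p. f (fst p) * g (snd p) \<partial>(M1 \<Otimes>\<^sub>M M2)) = (\<integral>x. f x \<partial>M1) * (\<integral>y. g y \<partial>M2)"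
proof -
  interpret M1: prob_space M1 by fact
  interpret M2: prob_space M2 by fact
  interpret pair_prob_space M1 M2 ..
  have "integrable (M1 \<Otimes>\<^sub>M M2) (\<lambda>p. f (fst p) * g (snd p))"
    by (intro all_moments_integrable all_moments_mult all_moments_fst all_moments_snd assms)
  from integral_fst'[OF this] show ?thesis by simp
qed

lemma all_moments_component:
  assumes "prob_space M" "i \<in> I" "all_moments M f"
  shows "all_moments (\<Pi>\<^sub>M i\<in>I. M) (\<lambda>x. f (x i))"
proof -
  have "distr (\<Pi>\<^sub>M i\<in>I. M) M (\<lambda>x. x i) = M"
    using assms by (intro distr_PiM_component) auto
  then show ?thesis
    using all_moments_distr[of "\<lambda>x. x i" "\<Pi>\<^sub>M i\<in>I. M" M f] assms by simp
qed

lemma integral_component: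
  fixes f :: "_ \<Rightarrow> real"
  assumes "prob_space M" "i \<in> I" "all_moments M f"
  shows "(\<integral>x. f (x i) \<partial>(\<Pi>\<^sub>M i\<in>I. M)) = (\<integral>x. f x \<partial>M)"
proof -
  have "distr (\<Pi>\<^sub>M i\<in>I. M) M (\<lambda>x. x i) = M"
    using assms by (intro distr_PiM_component) auto
  then have "(\<integral>x. f x \<partial>M) = (\<integral>x. f x \<partial>distr (\<Pi>\<^sub>M i\<in>I. M) M (\<lambda>x. x i))" by simp
  also have "\<dots> = (\<integral>x. f (x i) \<partial>(\<Pi>\<^sub>M i\<in>I. M))"
    using assms by (intro integral_distr) (auto simp: all_moments_def)
  finally show ?thesis ..
qed

lemma integral_two_components:
  fixes f g :: "_ \<Rightarrow> real"
  assumes M: "prob_space M" and I: "finite I" "i \<in> I" "j \<in> I" "i \<noteq> j"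
    and f: "all_moments M f" and g: "all_moments M g"
  shows "(\<integral>x. f (x i) * g (x j) \<partial>(\<Pi>\<^sub>M i\<in>I. M)) = (\<integral>x. f x \<partial>M) * (\<integral>x. g x \<partial>M)"
proof -
  interpret M: prob_space M by fact
  interpret product_sigma_finite "\<lambda>_. M" ..
  \<comment> \<open>Padding with the constant 1 makes the two factors a product over all of
    \<open>I\<close>; both products then collapse to the indices \<open>i\<close> and
    \<open>j\<close>.\<close>
  define h where "h k = (if k = i then f else if k = j then g else (\<lambda>_. 1))" for k
  have split: "(\<Prod>k\<in>I. F k) = F i * F j" if "\<And>k. k \<in> I - {i, j} \<Longrightarrow> F k = 1" for F :: "_ \<Rightarrow> real"
  proof -
    have "(\<Prod>k\<in>I. F k) = (\<Prod>k\<in>{i, j}. F k)"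
      using I that by (intro prod.mono_neutral_right) auto
    with I show ?thesis by simp
  qed
  have "(\<integral>x. (\<Prod>k\<in>I. h k (x k)) \<partial>(\<Pi>\<^sub>M i\<in>I. M)) = (\<Prod>k\<in>I. \<integral>x. h k x \<partial>M)"
    using I f g by (intro product_integral_prod) (auto simp: h_def all_moments_integrable)
  moreover have "(\<Prod>k\<in>I. h k (x k)) = f (x i) * g (x j)" for x
    using I by (subst split) (auto simp: h_def)
  moreover have "(\<Prod>k\<in>I. \<integral>x. h k x \<partial>M) = (\<integral>x. f x \<partial>M) * (\<integral>x. g x \<partial>M)"
    using I by (subst split) (auto simp: h_def M.prob_space)
  ultimately show ?thesis by simp
qed

text \<open>Instantiated twice in the end: with the training law at length \<open>n\<close> and with
  the test law at length \<open>m\<close>.\<close>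

locale context_model = centred_law T S for T :: "(real^'d) measure" and S +
  fixes \<sigma> :: real and n :: nat
  assumes sigma: "\<sigma> \<ge> 0" and n: "n \<ge> 1"
begin

definition "idx = {1..n}"

lemma idx: "finite idx" "card idx = n" "idx \<noteq> {}"
  using n by (auto simp: idx_def)

abbreviation "inputs_law \<equiv> \<Pi>\<^sub>M i\<in>idx. std_gauss :: (real^'d) measure"
abbreviation "noises_law \<equiv> \<Pi>\<^sub>M i\<in>idx. noise_law \<sigma>"
abbreviation "Q \<equiv> context_law T \<sigma> n"

lemma Q_eq: "Q = T \<Otimes>\<^sub>M (inputs_law \<Otimes>\<^sub>M noises_law)"
  by (simp add: context_law_def idx_def)

lemma prob_inputs: "prob_space inputs_law"
  by (intro prob_space_PiM prob_space_std_gauss)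

lemma prob_noises: "prob_space noises_law"
  by (intro prob_space_PiM prob_space_noise_law sigma)

lemma prob_pair: "prob_space (inputs_law \<Otimes>\<^sub>M noises_law)"
proof -
  interpret inputs: prob_space inputs_law by (rule prob_inputs)
  interpret noises: prob_space noises_law by (rule prob_noises)
  interpret pair_prob_space inputs_law noises_law ..
  show ?thesis by (rule prob_space_axioms)
qed

lemma prob_Q: "prob_space Q"
proof -
  interpret pair: prob_space "inputs_law \<Otimes>\<^sub>M noises_law" by (rule prob_pair)
  interpret P: pair_prob_space T "inputs_law \<Otimes>\<^sub>M noises_law" ..
  show ?thesis unfolding Q_eq by (rule P.prob_space_axioms)
qed

sublocale Q: prob_space Q by (rule prob_Q)

lemma all_moments_task: "all_moments T f \<Longrightarrow> all_moments Q (\<lambda>p. f (fst p))"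
  unfolding Q_eq by (intro all_moments_fst prob_space_axioms prob_pair)

lemma all_moments_inputs: "all_moments inputs_law f \<Longrightarrow> all_moments Q (\<lambda>p. f (fst (snd p)))"
  unfolding Q_eq
  by (intro all_moments_snd[where f="\<lambda>q. f (fst q)"] all_moments_fst prob_space_axioms prob_pair prob_inputs prob_noises)

lemma all_moments_noises: "all_moments noises_law f \<Longrightarrow> all_moments Q (\<lambda>p. f (snd (snd p)))"
  unfolding Q_eq
  by (intro all_moments_snd[where f="\<lambda>q. f (snd q)"] all_moments_snd prob_space_axioms prob_pair prob_inputs prob_noises)

lemma integral_Q_mult:
  assumes F: "all_moments T F" and g: "all_moments inputs_law g" and h: "all_moments noises_law h"
  shows "(\<integral>p. F (fst p) * (g (fst (snd p)) * h (snd (snd p))) \<partial>Q) =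
    (\<integral>w. F w \<partial>T) * ((\<integral>x. g x \<partial>inputs_law) * (\<integral>\<xi>. h \<xi> \<partial>noises_law))"
proof -
  have "all_moments (inputs_law \<Otimes>\<^sub>M noises_law) (\<lambda>q. g (fst q) * h (snd q))"
    by (intro all_moments_mult all_moments_fst all_moments_snd prob_inputs prob_noises g h)
  then show ?thesis
    unfolding Q_eq
    using integral_pair_mult[OF prob_space_axioms prob_pair F, of "\<lambda>q. g (fst q) * h (snd q)"]
      integral_pair_mult[OF prob_inputs prob_noises g h] by simp
qed

lemma all_moments_input_coord: "i \<in> idx \<Longrightarrow> all_moments inputs_law (\<lambda>x. x i $ k)"
  by (intro all_moments_component prob_space_std_gauss all_moments_std_gauss)

lemma all_moments_noise_coord: "i \<in> idx \<Longrightarrow> all_moments noises_law (\<lambda>\<xi>. \<xi> i)"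
  by (intro all_moments_component[where f="\<lambda>x. x"] prob_space_noise_law all_moments_noise_law sigma)

lemma integral_noise: "i \<in> idx \<Longrightarrow> (\<integral>\<xi>. \<xi> i \<partial>noises_law) = 0"
  by (simp add: integral_component[where f="\<lambda>x. x"] prob_space_noise_law all_moments_noise_law sigma noise_law_moments)

lemma integral_noise_mult:
  assumes "i \<in> idx" "j \<in> idx"
  shows "(\<integral>\<xi>. \<xi> i * \<xi> j \<partial>noises_law) = of_bool (i = j) * \<sigma>\<^sup>2"
proof (cases "i = j")
  case True
  interpret N: prob_space "noise_law \<sigma>" by (intro prob_space_noise_law sigma)
  have "(\<integral>\<xi>. \<xi> i * \<xi> i \<partial>noises_law) = (\<integral>z. z * z \<partial>noise_law \<sigma>)"
    using assms by (intro integral_component[where f="\<lambda>z. z * z"] N.prob_space_axioms all_moments_mult all_moments_noise_law sigma)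
  with True show ?thesis using noise_law_moments[OF sigma] by (simp add: power2_eq_square)
next
  case False
  have "(\<integral>\<xi>. \<xi> i * \<xi> j \<partial>noises_law) = (\<integral>z. z \<partial>noise_law \<sigma>) * (\<integral>z. z \<partial>noise_law \<sigma>)"
    using assms False idx(1) by (intro integral_two_components[where f="\<lambda>z. z" and g="\<lambda>z. z"]
      prob_space_noise_law all_moments_noise_law sigma) auto
  with False show ?thesis using noise_law_moments[OF sigma] by simp
qed

definition y :: "nat \<Rightarrow> (real^'d) \<times> (nat \<Rightarrow> real^'d) \<times> (nat \<Rightarrow> real) \<Rightarrow> real" where
  "y i p = label (fst p) (fst (snd p)) (snd (snd p)) i"

lemma y_expand: "y i p = (\<Sum>k\<in>UNIV. fst p $ k * fst (snd p) i $ k) + snd (snd p) i"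
  by (simp add: y_def label_def inner_vec_def)

lemma all_moments_y: "i \<in> idx \<Longrightarrow> all_moments Q (y i)"
  unfolding y_expand[abs_def]
  by (intro Q.all_moments_intros all_moments_task coord_moments
      all_moments_inputs[where f="\<lambda>x. x i $ _"] all_moments_input_coord
      all_moments_noises[where f="\<lambda>\<xi>. \<xi> i"] all_moments_noise_coord)

lemma integral_y:
  assumes F: "all_moments T F" and g: "all_moments inputs_law g" and i: "i \<in> idx"
  shows "(\<integral>p. F (fst p) * (g (fst (snd p)) * y i p) \<partial>Q) =
    (\<Sum>k\<in>UNIV. (\<integral>w. F w * w $ k \<partial>T) * (\<integral>x. g x * x i $ k \<partial>inputs_law))"
proof -
  interpret NN: prob_space noises_law by (rule prob_noises)
  let ?A = "\<lambda>k p. (F (fst p) * fst p $ k) * ((g (fst (snd p)) * fst (snd p) i $ k) * 1)"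
  let ?B = "\<lambda>p. F (fst p) * (g (fst (snd p)) * snd (snd p) i)"
  have Fk: "all_moments T (\<lambda>w. F w * w $ k)" and gk: "all_moments inputs_law (\<lambda>x. g x * x i $ k)" for k
    using i by (auto intro!: all_moments_mult F g coord_moments all_moments_input_coord)
  have intA: "integrable Q (?A k)" for k
    by (intro all_moments_integrable Q.all_moments_intros all_moments_task[OF Fk] all_moments_inputs[OF gk])
  have intB: "integrable Q ?B"
    using i by (intro all_moments_integrable Q.all_moments_intros all_moments_task[OF F] all_moments_inputs[OF g]
      all_moments_noises[where f="\<lambda>\<xi>. \<xi> i"] all_moments_noise_coord)
  have A: "(\<integral>p. ?A k p \<partial>Q) = (\<integral>w. F w * w $ k \<partial>T) * (\<integral>x. g x * x i $ k \<partial>inputs_law)" for k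
    using integral_Q_mult[OF Fk gk NN.all_moments_const[of 1]] NN.prob_space by simp
  have "(\<integral>p. F (fst p) * (g (fst (snd p)) * y i p) \<partial>Q) = (\<integral>p. (\<Sum>k\<in>UNIV. ?A k p) + ?B p \<partial>Q)"
    by (intro Bochner_Integration.integral_cong refl) (simp add: y_expand sum_distrib_left algebra_simps)
  also have "\<dots> = (\<Sum>k\<in>UNIV. \<integral>p. ?A k p \<partial>Q) + (\<integral>p. ?B p \<partial>Q)"
    by (subst Bochner_Integration.integral_add, intro Bochner_Integration.integrable_sum intA, rule intB,
        subst Bochner_Integration.integral_sum, rule intA, rule refl)
  also have "(\<integral>p. ?B p \<partial>Q) = 0"
    using i by (subst integral_Q_mult[OF F g]) (auto intro: all_moments_noise_coord simp: integral_noise)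
  finally show ?thesis by (simp only: A add_0_right)
qed

text \<open>\<open>F\<close> and \<open>g\<close> are test factors, chosen later as functions of the
  task and as monomials in the inputs. After substitution of the labels, independence splits every
  term; those with a single noise factor vanish, and the product of two noises survives when
  \<open>i = j\<close>.\<close>

lemma integral_yy:
  assumes F: "all_moments T F" and g: "all_moments inputs_law g" and i: "i \<in> idx" and j: "j \<in> idx"
  shows "(\<integral>p. F (fst p) * (g (fst (snd p)) * (y i p * y j p)) \<partial>Q) =
    (\<Sum>k\<in>UNIV. \<Sum>l\<in>UNIV. (\<integral>w. F w * w $ k * w $ l \<partial>T) * (\<integral>x. g x * x i $ k * x j $ l \<partial>inputs_law)) +
    (\<integral>w. F w \<partial>T) * (\<integral>x. g x \<partial>inputs_law) * (of_bool (i = j) * \<sigma>\<^sup>2)"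
proof -
  interpret NN: prob_space noises_law by (rule prob_noises)
  \<comment> \<open>Only the first label is expanded in \<open>?A\<close>, so that
    \<open>integral_y\<close> evaluates the remaining one.\<close>
  let ?A = "\<lambda>k p. (F (fst p) * fst p $ k) * ((g (fst (snd p)) * fst (snd p) i $ k) * y j p)"
  let ?B = "\<lambda>k p. (F (fst p) * fst p $ k) * ((g (fst (snd p)) * fst (snd p) j $ k) * snd (snd p) i)"
  let ?C = "\<lambda>p. F (fst p) * (g (fst (snd p)) * (snd (snd p) i * snd (snd p) j))"
  have Fk: "all_moments T (\<lambda>w. F w * w $ k)" for k
    by (intro all_moments_mult F coord_moments)
  have gk: "i \<in> idx \<Longrightarrow> all_moments inputs_law (\<lambda>x. g x * x i $ k)" for i k
    by (intro all_moments_mult g all_moments_input_coord)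
  have nn: "i \<in> idx \<Longrightarrow> all_moments Q (\<lambda>p. snd (snd p) i)" for i
    by (intro all_moments_noises[where f="\<lambda>\<xi>. \<xi> i"] all_moments_noise_coord)
  have intA: "integrable Q (?A k)" for k
    using i j by (intro all_moments_integrable all_moments_mult all_moments_task[OF Fk] all_moments_inputs[OF gk] all_moments_y)
  have intB: "integrable Q (?B k)" for k
    using i j by (intro all_moments_integrable all_moments_mult all_moments_task[OF Fk] all_moments_inputs[OF gk] nn)
  have intC: "integrable Q ?C"
    using i j by (intro all_moments_integrable all_moments_mult all_moments_task[OF F] all_moments_inputs[OF g] nn)
  have B: "(\<integral>p. ?B k p \<partial>Q) = 0" for k
    using i j by (subst integral_Q_mult[OF Fk gk]) (auto intro: all_moments_noise_coord simp: integral_noise)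
  have A: "(\<integral>p. ?A k p \<partial>Q) = (\<Sum>l\<in>UNIV. (\<integral>w. F w * w $ k * w $ l \<partial>T) * (\<integral>x. g x * x i $ k * x j $ l \<partial>inputs_law))" for k
    using i j by (subst integral_y[OF Fk gk]) auto
  have "(\<integral>p. F (fst p) * (g (fst (snd p)) * (y i p * y j p)) \<partial>Q) =
      (\<integral>p. (\<Sum>k\<in>UNIV. ?A k p) + ((\<Sum>k\<in>UNIV. ?B k p) + ?C p) \<partial>Q)"
  proof (intro Bochner_Integration.integral_cong refl)
    fix p
    have "F (fst p) * (g (fst (snd p)) * (y i p * y j p)) =
      (\<Sum>k\<in>UNIV. ?A k p) + F (fst p) * (g (fst (snd p)) * (snd (snd p) i * y j p))"
      unfolding y_expand[of i p] by (simp add: sum_distrib_left sum_distrib_right algebra_simps)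
    also have "F (fst p) * (g (fst (snd p)) * (snd (snd p) i * y j p)) = (\<Sum>k\<in>UNIV. ?B k p) + ?C p"
      unfolding y_expand[of j p] by (simp add: sum_distrib_left sum_distrib_right algebra_simps)
    finally show "F (fst p) * (g (fst (snd p)) * (y i p * y j p)) =
      (\<Sum>k\<in>UNIV. ?A k p) + ((\<Sum>k\<in>UNIV. ?B k p) + ?C p)" .
  qed
  also have "\<dots> = (\<Sum>k\<in>UNIV. \<integral>p. ?A k p \<partial>Q) + ((\<Sum>k\<in>UNIV. \<integral>p. ?B k p \<partial>Q) + (\<integral>p. ?C p \<partial>Q))"
  proof -
    have sA: "integrable Q (\<lambda>p. \<Sum>k\<in>UNIV. ?A k p)" and sB: "integrable Q (\<lambda>p. \<Sum>k\<in>UNIV. ?B k p)"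
      using intA intB by (auto intro!: Bochner_Integration.integrable_sum)
    have "(\<integral>p. (\<Sum>k\<in>UNIV. ?A k p) + ((\<Sum>k\<in>UNIV. ?B k p) + ?C p) \<partial>Q) =
      (\<integral>p. (\<Sum>k\<in>UNIV. ?A k p) \<partial>Q) + ((\<integral>p. (\<Sum>k\<in>UNIV. ?B k p) \<partial>Q) + (\<integral>p. ?C p \<partial>Q))"
      using sA sB intC by (simp only: Bochner_Integration.integral_add Bochner_Integration.integrable_add)
    then show ?thesis
      using intA intB by (simp only: Bochner_Integration.integral_sum)
  qed
  also have "(\<integral>p. ?C p \<partial>Q) = (\<integral>w. F w \<partial>T) * (\<integral>x. g x \<partial>inputs_law) * (of_bool (i = j) * \<sigma>\<^sup>2)"
    using i j by (subst integral_Q_mult[OF F g])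
      (auto intro: all_moments_noise_coord all_moments_mult simp: integral_noise_mult)
  finally show ?thesis by (simp only: A B sum.neutral_const add_0)
qed

end

text \<open>Contracted forms of the second and fourth moments; the three summands of the second
  formula are again the pairings. They serve to test the residual against products of two input
  coordinates.\<close>

lemma std_gauss_bilinear_moment:
  fixes u a :: "real^'d"
  shows "(\<integral>x. (u \<bullet> x) * (a \<bullet> x) \<partial>std_gauss) = u \<bullet> a"
    and "(\<integral>x. (u \<bullet> x) * (a \<bullet> x) * (x $ p * x $ q) \<partial>std_gauss) = of_bool (p = q) * (u \<bullet> a) + u $ p * a $ q + u $ q * a $ p"
proof -
  have int2: "integrable (std_gauss :: (real^'d) measure) (\<lambda>x. x $ k * x $ l)"
    and int4: "integrable (std_gauss :: (real^'d) measure) (\<lambda>x. x $ k * x $ l * (x $ p * x $ q))" for k l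
    by (intro all_moments_integrable all_moments_mult all_moments_std_gauss)+
  have prod: "(u \<bullet> x) * (a \<bullet> x) = (\<Sum>k\<in>UNIV. \<Sum>l\<in>UNIV. (u $ k * a $ l) * (x $ k * x $ l))" for x
    unfolding inner_vec_def inner_real_def sum_product by (intro sum.cong refl) simp
  have "(\<integral>x. (u \<bullet> x) * (a \<bullet> x) \<partial>std_gauss) = (\<integral>x. (\<Sum>k\<in>UNIV. \<Sum>l\<in>UNIV. (u $ k * a $ l) * (x $ k * x $ l)) \<partial>std_gauss)"
    unfolding prod ..
  also have "\<dots> = (\<Sum>k\<in>UNIV. \<Sum>l\<in>UNIV. (u $ k * a $ l) * of_bool (k = l))"
    using int2 by (simp only: Bochner_Integration.integral_sum Bochner_Integration.integrable_sum integrable_mult_right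
        Bochner_Integration.integral_mult_right_zero std_gauss_second_moment)
  finally show "(\<integral>x. (u \<bullet> x) * (a \<bullet> x) \<partial>std_gauss) = u \<bullet> a"
    by (simp add: inner_vec_def of_bool_def if_distrib cong: if_cong)
  have "(\<integral>x. (u \<bullet> x) * (a \<bullet> x) * (x $ p * x $ q) \<partial>std_gauss) =
      (\<integral>x. (\<Sum>k\<in>UNIV. \<Sum>l\<in>UNIV. (u $ k * a $ l) * (x $ k * x $ l * (x $ p * x $ q))) \<partial>std_gauss)"
    unfolding prod by (simp only: sum_distrib_right mult.assoc)
  also have "\<dots> = (\<Sum>k\<in>UNIV. \<Sum>l\<in>UNIV. (u $ k * a $ l) *
      (of_bool (k = l \<and> p = q) + of_bool (k = p \<and> l = q) + of_bool (k = q \<and> l = p)))"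
    using int4 by (simp only: Bochner_Integration.integral_sum Bochner_Integration.integrable_sum integrable_mult_right
        Bochner_Integration.integral_mult_right_zero std_gauss_fourth_moment)
  also have "\<dots> = of_bool (p = q) * (u \<bullet> a) + u $ p * a $ q + u $ q * a $ p"
  proof -
    have "(u $ k * a $ l) * (of_bool (k = l \<and> p = q) + of_bool (k = p \<and> l = q) + of_bool (k = q \<and> l = p)) =
        (if k = l then of_bool (p = q) * (u $ k * a $ l) else 0) +
        (if l = q then (if k = p then u $ k * a $ l else 0) else 0) +
        (if l = p then (if k = q then u $ k * a $ l else 0) else 0)" for k l
      by (simp add: distrib_left)
    then show ?thesis
      by (simp only: sum.distrib sum.delta sum.delta' finite UNIV_I if_True inner_vec_def inner_real_def sum_distrib_left)
  qed
  finally show "(\<integral>x. (u \<bullet> x) * (a \<bullet> x) * (x $ p * x $ q) \<partial>std_gauss) = of_bool (p = q) * (u \<bullet> a) + u $ p * a $ q + u $ q * a $ p" .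
qed

definition readout :: "real^'d^'d \<Rightarrow> real^'d \<Rightarrow> real^'d \<Rightarrow> real \<Rightarrow> real^'d^'d" where
  "readout A b u c = c *\<^sub>R A + (\<chi> k l. b $ k * u $ l)"

text \<open>The matrix of second moments of \<open>s\<close>. Since the inner product of matrices is
  entrywise, \<open>mat 1 \<bullet> S\<close> is the trace of \<open>S\<close>.\<close>

definition moment_matrix :: "real^'d^'d \<Rightarrow> real \<Rightarrow> nat \<Rightarrow> real^'d^'d" where
  "moment_matrix S \<sigma> n = (1 + 1 / real n) *\<^sub>R S + ((mat 1 \<bullet> S + \<sigma>\<^sup>2) / real n) *\<^sub>R mat 1"

text \<open>The mean of the squared norm of \<open>w - B s\<close>, written out through the moments
  of \<open>w\<close> and \<open>s\<close>. In this form minimising over \<open>B\<close> and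
  passing to the limit are matrix algebra.\<close>

definition regression_error :: "real^'d^'d \<Rightarrow> real \<Rightarrow> nat \<Rightarrow> real^'d^'d \<Rightarrow> real" where
  "regression_error S \<sigma> n B = mat 1 \<bullet> S - 2 * (B \<bullet> S) + (B ** moment_matrix S \<sigma> n) \<bullet> B"

lemma mat_1_inner: "mat 1 \<bullet> S = (\<Sum>k\<in>UNIV. (S :: real^'d^'d) $ k $ k)"
  by (simp add: inner_vec_def mat_def if_distrib if_distribR cong: if_cong)

context context_model
begin

lemma S_sym: "S $ k $ l = S $ l $ k"
  using second_moment[of k l] second_moment[of l k] by (simp add: mult.commute)

lemma input_second_moment:
  "i \<in> idx \<Longrightarrow> (\<integral>x. x i $ k * x i $ l \<partial>inputs_law) = of_bool (k = l)"
  by (subst integral_component[where f="\<lambda>x. x $ k * x $ l"])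
    (auto intro!: prob_space_std_gauss all_moments_mult all_moments_std_gauss simp: std_gauss_second_moment)

lemma input_fourth_moment:
  assumes "i \<in> idx" "j \<in> idx"
  shows "(\<integral>x. x i $ k * x j $ l * x i $ q * x j $ r \<partial>inputs_law) =
    of_bool (k = q \<and> l = r) + of_bool (i = j) * (of_bool (k = l \<and> q = r) + of_bool (k = r \<and> l = q))"
proof (cases "i = j")
  case True
  have "(\<integral>x. x i $ k * x i $ q * (x i $ l * x i $ r) \<partial>inputs_law) =
      (\<integral>x. x $ k * x $ q * (x $ l * x $ r) \<partial>std_gauss)"
    using assms by (intro integral_component[where f="\<lambda>x. x $ k * x $ q * (x $ l * x $ r)"]
      prob_space_std_gauss all_moments_mult all_moments_std_gauss)
  moreover have "x i $ k * x i $ q * (x i $ l * x i $ r) = x i $ k * x i $ l * x i $ q * x i $ r" for x :: "nat \<Rightarrow> real^'d"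
    by simp
  ultimately show ?thesis
    unfolding True[symmetric] std_gauss_fourth_moment by (simp add: eq_commute[of q l])
next
  case False
  have "(\<integral>x. (x i $ k * x i $ q) * (x j $ l * x j $ r) \<partial>inputs_law) =
      (\<integral>x. x $ k * x $ q \<partial>std_gauss) * (\<integral>x. x $ l * x $ r \<partial>std_gauss)"
    using assms False idx(1)
    by (intro integral_two_components[where f="\<lambda>x. x $ k * x $ q" and g="\<lambda>x. x $ l * x $ r"]
        prob_space_std_gauss all_moments_mult all_moments_std_gauss) auto
  moreover have "(x i $ k * x i $ q) * (x j $ l * x j $ r) = x i $ k * x j $ l * x i $ q * x j $ r" for x :: "nat \<Rightarrow> real^'d"
    by simp
  ultimately show ?thesis
    unfolding std_gauss_second_moment using False by (simp add: of_bool_conj)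
qed

definition s :: "(real^'d) \<times> (nat \<Rightarrow> real^'d) \<times> (nat \<Rightarrow> real) \<Rightarrow> real^'d" where
  "s p = (1 / real n) *\<^sub>R (\<Sum>i\<in>idx. y i p *\<^sub>R fst (snd p) i)"

definition residual :: "real^'d^'d \<Rightarrow> real^'d \<Rightarrow> real^'d \<Rightarrow> real \<Rightarrow> (real^'d) \<times> (nat \<Rightarrow> real^'d) \<times> (nat \<Rightarrow> real) \<Rightarrow> real^'d" where
  "residual A b u c p = (1 / real n) *\<^sub>R
     (\<Sum>i\<in>idx. (u \<bullet> fst (snd p) i) *\<^sub>R (A *v fst (snd p) i) + (c * (y i p)\<^sup>2) *\<^sub>R b)"

text \<open>Each summand is multiplied out and sorted by its degree in the label: the two terms of
  degree one make up the readout, those of degree zero and two the residual.\<close>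

lemma context_map_eq:
  "context_map A b u c n (fst p) (fst (snd p)) (snd (snd p)) = readout A b u c *v s p + residual A b u c p"
proof -
  have outer: "(\<chi> k l. b $ k * u $ l) *v z = (u \<bullet> z) *\<^sub>R b" for z
    by (simp add: matrix_vector_mult_def vec_eq_iff inner_vec_def sum_distrib_left mult_ac)
  have yterm: "(u \<bullet> z + c * t) *\<^sub>R (A *v z + t *\<^sub>R b) =
      t *\<^sub>R (readout A b u c *v z) + ((u \<bullet> z) *\<^sub>R (A *v z) + (c * t\<^sup>2) *\<^sub>R b)" for z t
    by (simp add: readout_def matrix_vector_mult_add_rdistrib outer scaleR_matrix_vector_assoc[symmetric]
        power2_eq_square algebra_simps)
  have "readout A b u c *v s p = (1 / real n) *\<^sub>R (\<Sum>i\<in>idx. y i p *\<^sub>R (readout A b u c *v fst (snd p) i))"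
    by (simp add: s_def matrix_vector_mult_scaleR linear_sum[OF matrix_vector_mul_linear] o_def)
  then show ?thesis
    unfolding residual_def context_map_def y_def[symmetric] idx_def[symmetric] yterm
    unfolding sum.distrib scaleR_add_right by (simp only: add.assoc)
qed

lemma all_moments_x: "i \<in> idx \<Longrightarrow> all_moments Q (\<lambda>p. fst (snd p) i $ k)"
  by (intro all_moments_inputs[where f="\<lambda>x. x i $ k"] all_moments_input_coord)

lemma all_moments_w: "all_moments Q (\<lambda>p. fst p $ k)"
  by (intro all_moments_task coord_moments)

lemma s_coord: "s p $ k = (1 / real n) * (\<Sum>i\<in>idx. y i p * fst (snd p) i $ k)"
  by (simp add: s_def)

lemma all_moments_s: "all_moments Q (\<lambda>p. s p $ k)"
  unfolding s_coord by (intro Q.all_moments_intros all_moments_y all_moments_x)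

lemma residual_coord: "residual A b u c p $ k = (1 / real n) *
   (\<Sum>i\<in>idx. (u \<bullet> fst (snd p) i) * (A $ k \<bullet> fst (snd p) i) + (c * b $ k) * (y i p * y i p))"
  by (simp add: residual_def matrix_vector_mul_component power2_eq_square mult_ac)

lemma all_moments_residual: "all_moments Q (\<lambda>p. residual A b u c p $ k)"
  unfolding residual_coord inner_vec_def inner_real_def
  by (intro Q.all_moments_intros all_moments_y all_moments_x)

text \<open>Given the task \<open>w\<close>, label times input has mean \<open>w\<close> in every
  row, so pairing with \<open>w\<close> gives the second moment of \<open>w\<close> itself.\<close>

lemma task_s_moment: "(\<integral>p. fst p $ k * s p $ l \<partial>Q) = S $ k $ l"
proof -
  have int: "i \<in> idx \<Longrightarrow> integrable Q (\<lambda>p. fst p $ k * (fst (snd p) i $ l * y i p))" for i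
    by (intro all_moments_integrable all_moments_mult all_moments_w all_moments_x all_moments_y)
  have "(\<integral>p. fst p $ k * s p $ l \<partial>Q) = (\<integral>p. (1 / real n) * (\<Sum>i\<in>idx. fst p $ k * (fst (snd p) i $ l * y i p)) \<partial>Q)"
    by (simp add: s_coord sum_distrib_left mult_ac)
  also have "\<dots> = (1 / real n) * (\<Sum>i\<in>idx. \<integral>p. fst p $ k * (fst (snd p) i $ l * y i p) \<partial>Q)"
    using int by (simp only: Bochner_Integration.integral_mult_right_zero Bochner_Integration.integral_sum)
  also have "\<dots> = (1 / real n) * (\<Sum>i\<in>idx. S $ k $ l)"
    by (intro arg_cong2[where f="(*)"] sum.cong refl)
      (simp add: integral_y[OF coord_moments all_moments_input_coord] second_moment input_second_moment of_bool_def if_distrib cong: if_cong)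
  finally show ?thesis using n idx by simp
qed

text \<open>Two distinct rows contribute \<open>S\<close> by independence. A repeated row
  contributes in addition \<open>?D\<close>: the other two pairings of its four input factors,
  giving the trace and a second \<open>S\<close>, and the noise variance. With \<open>n^2\<close>
  ordered pairs, \<open>n\<close> of them repeated, division by \<open>n^2\<close> leaves
  \<open>S + ?D / n\<close>.\<close>

lemma s_second_moment: "(\<integral>p. s p $ k * s p $ l \<partial>Q) = moment_matrix S \<sigma> n $ k $ l"
proof -
  let ?D = "(mat 1 \<bullet> S + \<sigma>\<^sup>2) * of_bool (k = l) + S $ k $ l"
  have int: "i \<in> idx \<Longrightarrow> j \<in> idx \<Longrightarrow> integrable Q (\<lambda>p. (fst (snd p) i $ k * fst (snd p) j $ l) * (y i p * y j p))" for i j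
    by (intro all_moments_integrable all_moments_mult all_moments_x all_moments_y)
  have yterm: "(\<integral>p. (fst (snd p) i $ k * fst (snd p) j $ l) * (y i p * y j p) \<partial>Q) = S $ k $ l + of_bool (i = j) * ?D"
    if ij: "i \<in> idx" "j \<in> idx" for i j
  proof -
    have g: "all_moments inputs_law (\<lambda>x. x i $ k * x j $ l)"
      using ij by (intro all_moments_mult all_moments_input_coord)
    have "(\<integral>p. (fst (snd p) i $ k * fst (snd p) j $ l) * (y i p * y j p) \<partial>Q) =
      (\<Sum>q\<in>UNIV. \<Sum>r\<in>UNIV. S $ q $ r * (of_bool (k = q \<and> l = r) + of_bool (i = j) * (of_bool (k = l \<and> q = r) + of_bool (k = r \<and> l = q)))) +
      of_bool (i = j) * (\<integral>x. x i $ k * x j $ l \<partial>inputs_law) * \<sigma>\<^sup>2"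
      using integral_yy[OF all_moments_const[of 1] g ij] prob_space
      by (simp add: second_moment input_fourth_moment[OF ij])
    also have "(\<Sum>q\<in>UNIV. \<Sum>r\<in>UNIV. S $ q $ r * (of_bool (k = q \<and> l = r) + of_bool (i = j) * (of_bool (k = l \<and> q = r) + of_bool (k = r \<and> l = q)))) =
      S $ k $ l + of_bool (i = j) * (of_bool (k = l) * (mat 1 \<bullet> S) + S $ l $ k)"
    proof -
      have "S $ q $ r * (of_bool (k = q \<and> l = r) + of_bool (i = j) * (of_bool (k = l \<and> q = r) + of_bool (k = r \<and> l = q))) =
          (if r = l then (if q = k then S $ q $ r else 0) else 0) +
          ((if q = r then of_bool (i = j) * of_bool (k = l) * S $ q $ r else 0) +
          (if r = k then (if q = l then of_bool (i = j) * S $ q $ r else 0) else 0))" for q r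
        by auto
      then show ?thesis
        by (simp only: sum.distrib sum.delta sum.delta' finite UNIV_I if_True mat_1_inner sum_distrib_left[symmetric] distrib_left mult.assoc)
    qed
    also have "of_bool (i = j) * (\<integral>x. x i $ k * x j $ l \<partial>inputs_law) * \<sigma>\<^sup>2 = of_bool (i = j) * (of_bool (k = l) * \<sigma>\<^sup>2)"
      using ij by (cases "i = j") (auto simp: input_second_moment)
    finally show ?thesis by (simp add: S_sym[of l k] algebra_simps)
  qed
  have "(\<integral>p. s p $ k * s p $ l \<partial>Q) =
      (\<integral>p. (1 / real n)\<^sup>2 * (\<Sum>i\<in>idx. \<Sum>j\<in>idx. (fst (snd p) i $ k * fst (snd p) j $ l) * (y i p * y j p)) \<partial>Q)"
    by (simp add: s_coord sum_product power2_eq_square mult_ac)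
  also have "\<dots> = (1 / real n)\<^sup>2 * (\<Sum>i\<in>idx. \<Sum>j\<in>idx. \<integral>p. (fst (snd p) i $ k * fst (snd p) j $ l) * (y i p * y j p) \<partial>Q)"
  proof -
    have "(\<integral>p. (\<Sum>i\<in>idx. \<Sum>j\<in>idx. (fst (snd p) i $ k * fst (snd p) j $ l) * (y i p * y j p)) \<partial>Q) =
        (\<Sum>i\<in>idx. \<integral>p. (\<Sum>j\<in>idx. (fst (snd p) i $ k * fst (snd p) j $ l) * (y i p * y j p)) \<partial>Q)"
      by (intro Bochner_Integration.integral_sum Bochner_Integration.integrable_sum int)
    also have "\<dots> = (\<Sum>i\<in>idx. \<Sum>j\<in>idx. \<integral>p. (fst (snd p) i $ k * fst (snd p) j $ l) * (y i p * y j p) \<partial>Q)"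
      by (intro sum.cong refl Bochner_Integration.integral_sum int)
    finally show ?thesis by (simp only: Bochner_Integration.integral_mult_right_zero)
  qed
  also have "\<dots> = (1 / real n)\<^sup>2 * (\<Sum>i\<in>idx. \<Sum>j\<in>idx. S $ k $ l + of_bool (i = j) * ?D)"
    by (simp add: yterm)
  also have "(\<Sum>i\<in>idx. \<Sum>j\<in>idx. S $ k $ l + of_bool (i = j) * ?D) = (real n)\<^sup>2 * S $ k $ l + real n * ?D"
  proof -
    have "of_bool (i = j) * ?D = (if i = j then ?D else 0)" for i j :: nat by simp
    then show ?thesis
      using idx by (simp only: sum.distrib sum.delta' sum_constant if_True cong: sum.cong) (simp add: power2_eq_square algebra_simps)
  qed
  also have "(1 / real n)\<^sup>2 * ((real n)\<^sup>2 * S $ k $ l + real n * ?D) = moment_matrix S \<sigma> n $ k $ l"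
    using n by (simp add: moment_matrix_def mat_def power2_eq_square field_simps)
  finally show ?thesis .
qed

lemma regression_error_eq:
  "(\<Sum>k\<in>UNIV. \<integral>p. (fst p $ k - (B *v s p) $ k)\<^sup>2 \<partial>Q) = regression_error S \<sigma> n B"
proof -
  let ?C = "moment_matrix S \<sigma> n"
  have int: "integrable Q (\<lambda>p. fst p $ k * fst p $ k)" "integrable Q (\<lambda>p. fst p $ k * s p $ l)"
    "integrable Q (\<lambda>p. s p $ l * s p $ q)" for k l q
    by (auto intro!: all_moments_integrable all_moments_mult all_moments_w all_moments_s)
  have ww: "(\<integral>p. fst p $ k * fst p $ k \<partial>Q) = S $ k $ k" for k
  proof -
    interpret I: prob_space inputs_law by (rule prob_inputs)
    interpret N: prob_space noises_law by (rule prob_noises)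
    have "all_moments T (\<lambda>w. w $ k * w $ k)" by (intro all_moments_mult coord_moments)
    from integral_Q_mult[OF this I.all_moments_const[of 1] N.all_moments_const[of 1]]
    show ?thesis by (simp add: second_moment I.prob_space N.prob_space)
  qed
  have "(\<integral>p. (fst p $ k - (B *v s p) $ k)\<^sup>2 \<partial>Q) =
      S $ k $ k - 2 * (\<Sum>l\<in>UNIV. B $ k $ l * S $ k $ l) + (\<Sum>l\<in>UNIV. \<Sum>q\<in>UNIV. (B $ k $ l * B $ k $ q) * ?C $ l $ q)" for k
  proof -
    have i2: "integrable Q (\<lambda>p. \<Sum>l\<in>UNIV. (2 * B $ k $ l) * (fst p $ k * s p $ l))"
      using int by (intro Bochner_Integration.integrable_sum integrable_mult_right)
    have i3: "integrable Q (\<lambda>p. \<Sum>l\<in>UNIV. \<Sum>q\<in>UNIV. (B $ k $ l * B $ k $ q) * (s p $ l * s p $ q))"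
      using int by (intro Bochner_Integration.integrable_sum integrable_mult_right)
    have "(\<integral>p. (fst p $ k - (B *v s p) $ k)\<^sup>2 \<partial>Q) = (\<integral>p. fst p $ k * fst p $ k -
        (\<Sum>l\<in>UNIV. (2 * B $ k $ l) * (fst p $ k * s p $ l)) +
        (\<Sum>l\<in>UNIV. \<Sum>q\<in>UNIV. (B $ k $ l * B $ k $ q) * (s p $ l * s p $ q)) \<partial>Q)"
    proof (intro Bochner_Integration.integral_cong refl)
      fix p
      have "((B *v s p) $ k)\<^sup>2 = (\<Sum>l\<in>UNIV. \<Sum>q\<in>UNIV. (B $ k $ l * B $ k $ q) * (s p $ l * s p $ q))"
        by (simp add: matrix_vector_mult_def power2_eq_square sum_product mult_ac)
      moreover have "2 * (fst p $ k * (B *v s p) $ k) = (\<Sum>l\<in>UNIV. (2 * B $ k $ l) * (fst p $ k * s p $ l))"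
        by (simp add: matrix_vector_mult_def sum_distrib_left mult_ac)
      ultimately show "(fst p $ k - (B *v s p) $ k)\<^sup>2 = fst p $ k * fst p $ k -
        (\<Sum>l\<in>UNIV. (2 * B $ k $ l) * (fst p $ k * s p $ l)) +
        (\<Sum>l\<in>UNIV. \<Sum>q\<in>UNIV. (B $ k $ l * B $ k $ q) * (s p $ l * s p $ q))"
        by (simp add: power2_eq_square algebra_simps)
    qed
    also have "\<dots> = S $ k $ k - (\<Sum>l\<in>UNIV. (2 * B $ k $ l) * S $ k $ l) +
        (\<Sum>l\<in>UNIV. \<Sum>q\<in>UNIV. (B $ k $ l * B $ k $ q) * ?C $ l $ q)"
      using int i2 i3 by (simp only: Bochner_Integration.integral_add Bochner_Integration.integral_diff
          Bochner_Integration.integrable_diff Bochner_Integration.integral_sum Bochner_Integration.integrable_sum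
          integrable_mult_right Bochner_Integration.integral_mult_right_zero ww task_s_moment s_second_moment)
    finally show ?thesis by (simp add: sum_distrib_left mult_ac)
  qed
  moreover have "(B ** ?C) \<bullet> B = (\<Sum>k\<in>UNIV. \<Sum>l\<in>UNIV. \<Sum>q\<in>UNIV. (B $ k $ l * B $ k $ q) * ?C $ l $ q)"
  proof -
    have "(B ** ?C) \<bullet> B = (\<Sum>k\<in>UNIV. \<Sum>q\<in>UNIV. \<Sum>l\<in>UNIV. (B $ k $ l * B $ k $ q) * ?C $ l $ q)"
      unfolding inner_vec_def inner_real_def matrix_matrix_mult_def vec_lambda_beta sum_distrib_right
      by (intro sum.cong refl) simp
    also have "\<dots> = (\<Sum>k\<in>UNIV. \<Sum>l\<in>UNIV. \<Sum>q\<in>UNIV. (B $ k $ l * B $ k $ q) * ?C $ l $ q)"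
      by (intro sum.cong refl sum.swap)
    finally show ?thesis .
  qed
  ultimately show ?thesis
    by (simp add: regression_error_def mat_1_inner sum.distrib sum_subtractf inner_vec_def[of B] inner_vec_def[of "B $ _"] sum_distrib_left)
qed

text \<open>Negation of the noise goes through \<open>compose idx\<close>, which keeps the result
  \<open>undefined\<close> outside \<open>idx\<close>, as membership in the product space
  requires.\<close>

definition sign_flip :: "(real^'d) \<times> (nat \<Rightarrow> real^'d) \<times> (nat \<Rightarrow> real) \<Rightarrow> (real^'d) \<times> (nat \<Rightarrow> real^'d) \<times> (nat \<Rightarrow> real)" where
  "sign_flip p = (- fst p, fst (snd p), compose idx uminus (snd (snd p)))"

lemma distr_sign_flip: "distr Q Q sign_flip = Q" and sign_flip_measurable: "sign_flip \<in> measurable Q Q"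
proof -
  interpret N: prob_space "noise_law \<sigma>" by (intro prob_space_noise_law sigma)
  interpret I: prob_space inputs_law by (rule prob_inputs)
  interpret NN: prob_space noises_law by (rule prob_noises)
  interpret P: prob_space "inputs_law \<Otimes>\<^sub>M noises_law" by (rule prob_pair)
  have "distr (noise_law \<sigma>) (noise_law \<sigma>) uminus = distr (noise_law \<sigma>) borel uminus"
    by (intro distr_cong) auto
  then have "distr noises_law noises_law (compose idx uminus) = noises_law"
    using idx(1) by (subst distr_PiM_finite_prob_space') (auto simp: noise_law_symmetric N.prob_space_axioms)
  moreover have g: "compose idx uminus \<in> measurable noises_law noises_law"
    unfolding compose_def by (rule measurable_restrict) measurable
  moreover have "distr T T uminus = T"
    using symmetric by (subst distr_cong[OF refl sets_T refl]) auto
  moreover have f: "uminus \<in> measurable T T"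
    using sets_T by (simp cong: measurable_cong_sets)
  moreover have d1: "distr (inputs_law \<Otimes>\<^sub>M noises_law) (inputs_law \<Otimes>\<^sub>M noises_law) (\<lambda>(x, \<xi>). (x, compose idx uminus \<xi>)) =
      inputs_law \<Otimes>\<^sub>M noises_law"
    using pair_measure_distr[of "\<lambda>x. x" inputs_law inputs_law "compose idx uminus" noises_law noises_law]
      calculation(1) g NN.sigma_finite_measure_axioms by (simp add: distr_id2)
  moreover have m1: "(\<lambda>(x, \<xi>). (x, compose idx uminus \<xi>)) \<in> measurable (inputs_law \<Otimes>\<^sub>M noises_law) (inputs_law \<Otimes>\<^sub>M noises_law)"
    using g by measurable
  ultimately have "distr Q Q (\<lambda>(w, q). (- w, (\<lambda>(x, \<xi>). (x, compose idx uminus \<xi>)) q)) = Q"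
    using pair_measure_distr[of uminus T T "\<lambda>(x, \<xi>). (x, compose idx uminus \<xi>)" "inputs_law \<Otimes>\<^sub>M noises_law" "inputs_law \<Otimes>\<^sub>M noises_law"]
      P.sigma_finite_measure_axioms unfolding Q_eq by simp
  moreover have sf: "sign_flip = (\<lambda>(w, q). (- w, (\<lambda>(x, \<xi>). (x, compose idx uminus \<xi>)) q))"
    by (auto simp: sign_flip_def fun_eq_iff)
  ultimately show "distr Q Q sign_flip = Q" by simp
  show "sign_flip \<in> measurable Q Q"
    unfolding sf Q_eq using f m1 by measurable
qed

lemma y_sign_flip: "i \<in> idx \<Longrightarrow> y i (sign_flip p) = - y i p"
  by (simp add: y_def sign_flip_def label_def compose_def)

lemma s_sign_flip: "s (sign_flip p) = - s p"
  unfolding s_def by (simp add: y_sign_flip sum_negf) (simp add: sign_flip_def)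

lemma residual_sign_flip: "residual A b u c (sign_flip p) = residual A b u c p"
  unfolding residual_def by (simp add: y_sign_flip) (simp add: sign_flip_def)

text \<open>Invariance of \<open>Q\<close> under the flip makes the integral equal to its own
  negative.\<close>

lemma integral_odd:
  fixes G :: "_ \<Rightarrow> real"
  assumes "G \<in> borel_measurable Q" "\<And>p. G (sign_flip p) = - G p"
  shows "(\<integral>p. G p \<partial>Q) = 0"
proof -
  have "(\<integral>p. G p \<partial>Q) = (\<integral>p. G p \<partial>distr Q Q sign_flip)" by (simp add: distr_sign_flip)
  also have "\<dots> = (\<integral>p. G (sign_flip p) \<partial>Q)"
    by (intro integral_distr sign_flip_measurable assms)
  finally show ?thesis by (simp add: assms)
qed

text \<open>Coordinatewise the error is an odd term minus an even one. Their product is odd, so the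
  mixed term of the square integrates to zero.\<close>

lemma risk_decomposition:
  fixes W :: "'d weights"
  defines "A \<equiv> key_matrix W" and "b \<equiv> key_vector W" and "u \<equiv> value_vector W" and "c \<equiv> value_coeff W"
  shows "risk T \<sigma> n W = \<sigma>\<^sup>2 + regression_error S \<sigma> n (readout A b u c) +
    (\<Sum>k\<in>UNIV. \<integral>p. (residual A b u c p $ k)\<^sup>2 \<partial>Q)"
proof -
  let ?B = "readout A b u c"
  let ?o = "\<lambda>k p. fst p $ k - (?B *v s p) $ k" and ?e = "\<lambda>k p. residual A b u c p $ k"
  have o: "all_moments Q (?o k)" for k
    unfolding matrix_vector_mult_def by (auto intro!: Q.all_moments_intros all_moments_w all_moments_s)
  have e: "all_moments Q (?e k)" for k by (rule all_moments_residual)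
  have ints: "integrable Q (\<lambda>p. (?o k p)\<^sup>2)" "integrable Q (\<lambda>p. ?o k p * ?e k p)" "integrable Q (\<lambda>p. (?e k p)\<^sup>2)" for k
    by (intro all_moments_integrable Q.all_moments_intros o e all_moments_residual)+
  have odd: "(\<integral>p. ?o k p * ?e k p \<partial>Q) = 0" for k
  proof (rule integral_odd)
    show "(\<lambda>p. ?o k p * ?e k p) \<in> borel_measurable Q"
      by (intro borel_measurable_times all_moments_measurable o e)
    have minus: "?B *v (- z) = - (?B *v z)" for z
      by (simp add: matrix_vector_mult_def vec_eq_iff sum_negf)
    show "?o k (sign_flip p) * ?e k (sign_flip p) = - (?o k p * ?e k p)" for p
      by (simp only: s_sign_flip residual_sign_flip minus) (simp add: sign_flip_def algebra_simps)
  qed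
  have "risk T \<sigma> n W = (\<integral>p. \<sigma>\<^sup>2 + (norm (fst p - (?B *v s p + residual A b u c p)))\<^sup>2 \<partial>Q)"
    unfolding risk_eq[OF sigma prob_space_axioms sets_T] case_prod_unfold context_map_eq A_def b_def u_def c_def ..
  also have "\<dots> = (\<integral>p. \<sigma>\<^sup>2 + (\<Sum>k\<in>UNIV. (?o k p)\<^sup>2 - 2 * (?o k p * ?e k p) + (?e k p)\<^sup>2) \<partial>Q)"
    unfolding power2_norm_eq_inner inner_vec_def
    by (intro Bochner_Integration.integral_cong refl arg_cong2[where f="(+)"] sum.cong)
      (simp add: power2_eq_square algebra_simps)
  also have "\<dots> = \<sigma>\<^sup>2 + (\<Sum>k\<in>UNIV. \<integral>p. (?o k p)\<^sup>2 - 2 * (?o k p * ?e k p) + (?e k p)\<^sup>2 \<partial>Q)"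
  proof -
    have i: "integrable Q (\<lambda>p. (?o k p)\<^sup>2 - 2 * (?o k p * ?e k p) + (?e k p)\<^sup>2)" for k
      using ints by (intro Bochner_Integration.integrable_add Bochner_Integration.integrable_diff integrable_mult_right)
    then have "(\<integral>p. \<sigma>\<^sup>2 + (\<Sum>k\<in>UNIV. (?o k p)\<^sup>2 - 2 * (?o k p * ?e k p) + (?e k p)\<^sup>2) \<partial>Q) =
      (\<integral>p. \<sigma>\<^sup>2 \<partial>Q) + (\<integral>p. (\<Sum>k\<in>UNIV. (?o k p)\<^sup>2 - 2 * (?o k p * ?e k p) + (?e k p)\<^sup>2) \<partial>Q)"
      by (intro Bochner_Integration.integral_add Bochner_Integration.integrable_sum Q.integrable_const)
    then show ?thesis
      using Bochner_Integration.integral_sum[of UNIV Q "\<lambda>k p. (?o k p)\<^sup>2 - 2 * (?o k p * ?e k p) + (?e k p)\<^sup>2"] i Q.prob_space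
      by simp
  qed
  also have "(\<Sum>k\<in>UNIV. \<integral>p. (?o k p)\<^sup>2 - 2 * (?o k p * ?e k p) + (?e k p)\<^sup>2 \<partial>Q) =
      (\<Sum>k\<in>UNIV. (\<integral>p. (?o k p)\<^sup>2 \<partial>Q) + (\<integral>p. (?e k p)\<^sup>2 \<partial>Q))"
    using ints by (intro sum.cong refl)
      (simp only: Bochner_Integration.integral_add Bochner_Integration.integral_diff Bochner_Integration.integrable_diff
        integrable_mult_right Bochner_Integration.integral_mult_right_zero odd mult_zero_right diff_zero)
  finally show ?thesis
    by (simp only: sum.distrib regression_error_eq add.assoc)
qed

end


section \<open>Optimal weights\<close>

text \<open>Witness that every readout is attained with zero residual: identity value weights send
  \<open>snoc_vec 0 1\<close> to itself, so the value part is the bare label, and the label column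
  of the keys is zero.\<close>

definition weights_of :: "real^'d^'d \<Rightarrow> 'd::finite weights" where
  "weights_of B = ((\<chi> i j. case i of None \<Rightarrow> 0 | Some k \<Rightarrow> (case j of None \<Rightarrow> 0 | Some l \<Rightarrow> B $ k $ l)), mat 1, mat 1)"

lemma weights_of_simps:
  "key_matrix (weights_of B) = B" "key_vector (weights_of B) = 0"
  "value_vector (weights_of B) = 0" "value_coeff (weights_of B) = 1"
  by (simp_all add: weights_of_def key_matrix_def key_vector_def value_vector_def value_coeff_def snoc_vec_def vec_eq_iff)

text \<open>Right multiplication by \<open>C\<close> and by its transpose are adjoint for the
  entrywise inner product.\<close>

lemma matrix_mult_inner: "(X ** C) \<bullet> Y = X \<bullet> (Y ** transpose C)" for C :: "real^'n^'m"
proof -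
  have "(X ** C) \<bullet> Y = (\<Sum>k\<in>UNIV. \<Sum>q\<in>UNIV. \<Sum>l\<in>UNIV. X $ k $ l * C $ l $ q * Y $ k $ q)"
    by (simp add: inner_vec_def matrix_matrix_mult_def sum_distrib_right)
  also have "\<dots> = (\<Sum>k\<in>UNIV. \<Sum>l\<in>UNIV. \<Sum>q\<in>UNIV. X $ k $ l * C $ l $ q * Y $ k $ q)"
    by (intro sum.cong refl sum.swap)
  also have "\<dots> = X \<bullet> (Y ** transpose C)"
    by (simp add: inner_vec_def matrix_matrix_mult_def transpose_def sum_distrib_left mult_ac)
  finally show ?thesis .
qed

text \<open>Completing the square: the hypothesis on \<open>B0\<close> is the normal equation, which
  cancels the terms linear in \<open>B - B0\<close>.\<close>

lemma regression_error_minimal: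
  fixes S B0 B :: "real^'d^'d"
  assumes S: "transpose S = S" and B0: "B0 ** moment_matrix S \<sigma> n = S"
  shows "regression_error S \<sigma> n B =
    regression_error S \<sigma> n B0 + ((B - B0) ** moment_matrix S \<sigma> n) \<bullet> (B - B0)"
proof -
  let ?C = "moment_matrix S \<sigma> n"
  define D where "D = B - B0"
  have C: "transpose ?C = ?C"
    by (simp add: moment_matrix_def transpose_add transpose_scalar S)
  have "(D ** ?C) \<bullet> B0 = D \<bullet> S"
    by (simp only: matrix_mult_inner C B0)
  moreover have "(B0 ** ?C) \<bullet> D = D \<bullet> S"
    by (simp only: B0 inner_commute)
  moreover have "B = B0 + D" by (simp add: D_def)
  ultimately show ?thesis
    unfolding D_def[symmetric] regression_error_def
    by (simp add: matrix_add_rdistrib inner_add_left inner_add_right algebra_simps)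
qed

context context_model
begin

lemma residual_eq_0:
  assumes "c *\<^sub>R b = 0" "A = 0 \<or> u = 0"
  shows "residual A b u c p = 0"
proof -
  have zero: "(c * (y i p)\<^sup>2) *\<^sub>R b = 0" for i
    using assms(1) by auto
  have "0 *v z = (0 :: real^'d)" for z :: "real^'d"
    by (simp add: matrix_vector_mult_def vec_eq_iff)
  then show ?thesis
    using assms(2) unfolding residual_def zero by auto
qed

lemma risk_weights_of: "risk T \<sigma> n (weights_of B) = \<sigma>\<^sup>2 + regression_error S \<sigma> n B"
proof -
  have "residual B 0 0 1 p = 0" for p by (rule residual_eq_0) auto
  moreover have "readout B 0 0 1 = B"
    by (simp add: readout_def vec_eq_iff)
  ultimately show ?thesis
    by (simp add: risk_decomposition weights_of_simps)
qed

text \<open>Used with \<open>F = 1\<close> and \<open>F = w \<bullet> w\<close>. A vanishing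
  residual then yields two linear equations in \<open>u \<bullet> A $ k\<close> and
  \<open>c * b $ k\<close>.\<close>

lemma integral_residual_task:
  assumes F: "all_moments T F"
  shows "(\<integral>p. F (fst p) * residual A b u c p $ k \<partial>Q) =
    (\<integral>w. F w \<partial>T) * (u \<bullet> A $ k) + (c * b $ k) * ((\<integral>w. F w * (w \<bullet> w) \<partial>T) + (\<integral>w. F w \<partial>T) * \<sigma>\<^sup>2)"
proof -
  interpret I: prob_space inputs_law by (rule prob_inputs)
  interpret N: prob_space noises_law by (rule prob_noises)
  interpret G: prob_space "std_gauss :: (real^'d) measure" by (rule prob_space_std_gauss)
  let ?g = "\<lambda>i x. (u \<bullet> x i) * (A $ k \<bullet> x i)"
  have lin: "all_moments std_gauss (\<lambda>x. v \<bullet> x)" for v :: "real^'d"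
    unfolding inner_vec_def inner_real_def by (intro G.all_moments_intros all_moments_std_gauss)
  have g: "i \<in> idx \<Longrightarrow> all_moments inputs_law (?g i)" for i
    by (intro all_moments_mult all_moments_component[where f="\<lambda>x. _ \<bullet> x"] prob_space_std_gauss lin)
  have intg: "i \<in> idx \<Longrightarrow> integrable Q (\<lambda>p. F (fst p) * (?g i (fst (snd p)) * 1))" for i
    by (intro all_moments_integrable Q.all_moments_intros all_moments_task[OF F] all_moments_inputs[OF g])
  have inty: "i \<in> idx \<Longrightarrow> integrable Q (\<lambda>p. F (fst p) * (1 * (y i p * y i p)))" for i
    by (intro all_moments_integrable Q.all_moments_intros all_moments_task[OF F] all_moments_y)
  have G: "(\<integral>p. F (fst p) * (?g i (fst (snd p)) * 1) \<partial>Q) = (\<integral>w. F w \<partial>T) * (u \<bullet> A $ k)" if "i \<in> idx" for i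
  proof -
    have "(\<integral>x. ?g i x \<partial>inputs_law) = u \<bullet> A $ k"
      using integral_component[where f="\<lambda>x. (u \<bullet> x) * (A $ k \<bullet> x)", OF prob_space_std_gauss that all_moments_mult[OF lin lin]]
      by (simp add: std_gauss_bilinear_moment)
    then show ?thesis
      using integral_Q_mult[OF F g[OF that] N.all_moments_const[of 1]] by (simp add: N.prob_space)
  qed
  have Y: "(\<integral>p. F (fst p) * (1 * (y i p * y i p)) \<partial>Q) = (\<integral>w. F w * (w \<bullet> w) \<partial>T) + (\<integral>w. F w \<partial>T) * \<sigma>\<^sup>2" if "i \<in> idx" for i
  proof -
    have "integrable T (\<lambda>w. F w * w $ q * w $ q)" for q
      by (intro all_moments_integrable all_moments_mult F coord_moments)
    then have "(\<Sum>q\<in>UNIV. \<integral>w. F w * w $ q * w $ q \<partial>T) = (\<integral>w. F w * (w \<bullet> w) \<partial>T)"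
      by (subst Bochner_Integration.integral_sum[symmetric]) (simp_all add: inner_vec_def sum_distrib_left mult.assoc)
    moreover have "(\<Sum>q\<in>UNIV. \<Sum>r\<in>UNIV. (\<integral>w. F w * w $ q * w $ r \<partial>T) * (\<integral>x. 1 * x i $ q * x i $ r \<partial>inputs_law)) =
        (\<Sum>q\<in>UNIV. \<integral>w. F w * w $ q * w $ q \<partial>T)"
    proof (intro sum.cong refl)
      fix q
      have "(\<integral>w. F w * w $ q * w $ r \<partial>T) * (\<integral>x. 1 * x i $ q * x i $ r \<partial>inputs_law) =
          (if r = q then \<integral>w. F w * w $ q * w $ r \<partial>T else 0)" for r
        using that by (simp add: input_second_moment)
      then show "(\<Sum>r\<in>UNIV. (\<integral>w. F w * w $ q * w $ r \<partial>T) * (\<integral>x. 1 * x i $ q * x i $ r \<partial>inputs_law)) =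
          (\<integral>w. F w * w $ q * w $ q \<partial>T)"
        by (simp only: sum.delta finite UNIV_I if_True)
    qed
    ultimately show ?thesis
      using integral_yy[OF F I.all_moments_const[of 1] that that] by (simp add: I.prob_space)
  qed
  have "(\<integral>p. F (fst p) * residual A b u c p $ k \<partial>Q) = (\<integral>p. (1 / real n) *
      (\<Sum>i\<in>idx. F (fst p) * (?g i (fst (snd p)) * 1) + (c * b $ k) * (F (fst p) * (1 * (y i p * y i p)))) \<partial>Q)"
    unfolding residual_coord by (intro Bochner_Integration.integral_cong refl) (simp add: sum_distrib_left algebra_simps)
  also have "\<dots> = (1 / real n) *
      (\<Sum>i\<in>idx. \<integral>p. F (fst p) * (?g i (fst (snd p)) * 1) + (c * b $ k) * (F (fst p) * (1 * (y i p * y i p))) \<partial>Q)"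
    unfolding Bochner_Integration.integral_mult_right_zero using intg inty
    by (intro arg_cong2[where f="(*)"] refl Bochner_Integration.integral_sum Bochner_Integration.integrable_add integrable_mult_right)
  also have "(\<Sum>i\<in>idx. \<integral>p. F (fst p) * (?g i (fst (snd p)) * 1) + (c * b $ k) * (F (fst p) * (1 * (y i p * y i p))) \<partial>Q) =
      (\<Sum>i\<in>idx. (\<integral>w. F w \<partial>T) * (u \<bullet> A $ k) + (c * b $ k) * ((\<integral>w. F w * (w \<bullet> w) \<partial>T) + (\<integral>w. F w \<partial>T) * \<sigma>\<^sup>2))"
    using intg inty by (intro sum.cong refl)
      (simp only: Bochner_Integration.integral_add integrable_mult_right Bochner_Integration.integral_mult_right_zero G Y)
  finally show ?thesis using n idx by simp
qed

text \<open>A residual of zero mean square is orthogonal to every test function. The task functions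
  1 and \<open>w \<bullet> w\<close> eliminate the term in the squared labels; what remains is a
  quadratic form in the inputs, and testing it against products of coordinates reads off its
  symmetrised coefficients.\<close>

lemma residual_vanishes:
  assumes nondeg: "\<And>v. \<not> (AE w in T. w \<bullet> w = v)"
    and zero: "\<And>k. (\<integral>p. (residual A b u c p $ k)\<^sup>2 \<partial>Q) = 0"
  shows "c *\<^sub>R b = 0" "A = 0 \<or> u = 0"
proof -
  interpret G: prob_space "std_gauss :: (real^'d) measure" by (rule prob_space_std_gauss)
  have AE0: "AE p in Q. residual A b u c p $ k = 0" for k
  proof -
    have "integrable Q (\<lambda>p. (residual A b u c p $ k)\<^sup>2)"
      by (intro all_moments_integrable Q.all_moments_power all_moments_residual)
    then have "AE p in Q. (residual A b u c p $ k)\<^sup>2 = 0"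
      using zero[of k] by (subst (asm) integral_nonneg_eq_0_iff_AE) auto
    then show ?thesis by simp
  qed
  have E0: "(\<integral>p. f p * residual A b u c p $ k \<partial>Q) = 0" for f k
    using AE0[of k] by (intro integral_eq_zero_AE) auto
  let ?V = "\<lambda>w :: real^'d. w \<bullet> w"
  have V: "all_moments T ?V"
    unfolding inner_vec_def inner_real_def by (intro all_moments_intros coord_moments)
  define m1 where "m1 = (\<integral>w. ?V w \<partial>T)"
  define m2 where "m2 = (\<integral>w. ?V w * ?V w \<partial>T)"
  have intV: "integrable T ?V" "integrable T (\<lambda>w. ?V w * ?V w)"
    by (intro all_moments_integrable all_moments_mult V)+
  have eq1: "u \<bullet> A $ k + (c * b $ k) * (m1 + \<sigma>\<^sup>2) = 0" for k
    using integral_residual_task[OF all_moments_const[of 1], of A b u c k] E0[of "\<lambda>_. 1" k]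
    by (simp add: m1_def prob_space)
  have eq2: "m1 * (u \<bullet> A $ k) + (c * b $ k) * (m2 + m1 * \<sigma>\<^sup>2) = 0" for k
    using integral_residual_task[OF V, of A b u c k] E0[of "\<lambda>p. ?V (fst p)" k]
    by (simp add: m1_def m2_def)
  have cb: "c * b $ k = 0" for k
  proof (rule ccontr)
    assume nz: "c * b $ k \<noteq> 0"
    \<comment> \<open>This is the second equation minus \<open>m1\<close> times the first:
      \<open>u \<bullet> A $ k\<close> and the noise variance cancel, and the variance of
      \<open>w \<bullet> w\<close> remains as factor.\<close>
    have "(c * b $ k) * (m2 - m1 * m1) =
      (m1 * (u \<bullet> A $ k) + (c * b $ k) * (m2 + m1 * \<sigma>\<^sup>2)) - m1 * (u \<bullet> A $ k + (c * b $ k) * (m1 + \<sigma>\<^sup>2))"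
      by (simp add: algebra_simps)
    with eq1[of k] eq2[of k] nz have var: "m2 - m1 * m1 = 0" by simp
    have "(\<integral>w. (?V w - m1)\<^sup>2 \<partial>T) = (\<integral>w. ?V w * ?V w - 2 * m1 * ?V w + m1 * m1 \<partial>T)"
      by (intro Bochner_Integration.integral_cong refl) (simp add: power2_eq_square algebra_simps)
    also have "\<dots> = m2 - 2 * m1 * m1 + m1 * m1"
      using intV prob_space by (simp add: m1_def m2_def)
    finally have "(\<integral>w. (?V w - m1)\<^sup>2 \<partial>T) = 0" using var by simp
    moreover have "integrable T (\<lambda>w. (?V w - m1)\<^sup>2)"
      by (intro all_moments_integrable all_moments_intros V)
    ultimately have "AE w in T. (?V w - m1)\<^sup>2 = 0"
      by (subst (asm) integral_nonneg_eq_0_iff_AE) auto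
    then have "AE w in T. ?V w = m1" by simp
    with nondeg show False by blast
  qed
  then show "c *\<^sub>R b = 0" by (simp add: vec_eq_iff)
  have uA: "u \<bullet> A $ k = 0" for k using eq1[of k] cb[of k] by simp
  \<comment> \<open>The test function is a product of two coordinates of one row \<open>j\<close>.
    By \<open>uA\<close>, the other rows drop out, and so does the pairing of \<open>u\<close> with
    \<open>A $ k\<close> in row \<open>j\<close>.\<close>
  have pair: "u $ p * A $ k $ q + u $ q * A $ k $ p = 0" for k p q
  proof -
    obtain j where j: "j \<in> idx" using idx by auto
    let ?g = "\<lambda>i x. (u \<bullet> x i) * (A $ k \<bullet> x i) * (x j $ p * x j $ q)"
    have lin: "all_moments std_gauss (\<lambda>x. v \<bullet> x)" for v :: "real^'d"
      unfolding inner_vec_def inner_real_def by (intro G.all_moments_intros all_moments_std_gauss)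
    have g: "i \<in> idx \<Longrightarrow> all_moments inputs_law (?g i)" for i
      using j by (intro all_moments_mult all_moments_component[where f="\<lambda>x. _ \<bullet> x"] prob_space_std_gauss lin all_moments_input_coord)
    interpret I: prob_space inputs_law by (rule prob_inputs)
    interpret N: prob_space noises_law by (rule prob_noises)
    have ex: "(\<integral>z. ?g i (fst (snd z)) \<partial>Q) = of_bool (i = j) * (u $ p * A $ k $ q + u $ q * A $ k $ p)" if i: "i \<in> idx" for i
    proof -
      have "(\<integral>z. ?g i (fst (snd z)) \<partial>Q) = (\<integral>x. ?g i x \<partial>inputs_law)"
        using integral_Q_mult[OF all_moments_const[of 1] g[OF i] N.all_moments_const[of 1]] prob_space N.prob_space by simp
      also have "\<dots> = of_bool (i = j) * (u $ p * A $ k $ q + u $ q * A $ k $ p)"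
      proof (cases "i = j")
        case True
        have "(\<integral>x. ?g j x \<partial>inputs_law) = (\<integral>x. (u \<bullet> x) * (A $ k \<bullet> x) * (x $ p * x $ q) \<partial>std_gauss)"
          using j by (intro integral_component[where f="\<lambda>x. (u \<bullet> x) * (A $ k \<bullet> x) * (x $ p * x $ q)"]
              prob_space_std_gauss all_moments_mult lin all_moments_std_gauss)
        with True show ?thesis by (simp add: std_gauss_bilinear_moment uA)
      next
        case False
        have "(\<integral>x. ?g i x \<partial>inputs_law) = (\<integral>x. (u \<bullet> x) * (A $ k \<bullet> x) \<partial>std_gauss) * (\<integral>x. x $ p * x $ q \<partial>std_gauss)"
          using i j idx(1) False
          by (intro integral_two_components[where f="\<lambda>x. (u \<bullet> x) * (A $ k \<bullet> x)" and g="\<lambda>x. x $ p * x $ q"]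
              prob_space_std_gauss all_moments_mult lin all_moments_std_gauss)
        with False show ?thesis by (simp add: std_gauss_bilinear_moment uA)
      qed
      finally show ?thesis .
    qed
    have "0 = (\<integral>z. (fst (snd z) j $ p * fst (snd z) j $ q) * residual A b u c z $ k \<partial>Q)"
      by (simp only: E0)
    also have "\<dots> = (\<integral>z. (1 / real n) * (\<Sum>i\<in>idx. ?g i (fst (snd z))) \<partial>Q)"
      unfolding residual_coord cb by (intro Bochner_Integration.integral_cong refl) (simp add: sum_distrib_left mult_ac)
    also have "\<dots> = (1 / real n) * (\<Sum>i\<in>idx. \<integral>z. ?g i (fst (snd z)) \<partial>Q)"
      unfolding Bochner_Integration.integral_mult_right_zero
      by (intro arg_cong2[where f="(*)"] refl Bochner_Integration.integral_sum all_moments_integrable all_moments_inputs[OF g])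
    also have "\<dots> = (1 / real n) * (\<Sum>i\<in>idx. if i = j then u $ p * A $ k $ q + u $ q * A $ k $ p else 0)"
      by (intro arg_cong2[where f="(*)"] sum.cong refl) (simp add: ex)
    also have "\<dots> = (1 / real n) * (u $ p * A $ k $ q + u $ q * A $ k $ p)"
      using idx(1) j by (simp only: sum.delta if_True)
    finally show ?thesis using n by simp
  qed
  show "A = 0 \<or> u = 0"
  proof (rule disjCI)
    assume "u \<noteq> 0"
    then obtain p where p: "u $ p \<noteq> 0" by (auto simp: vec_eq_iff)
    \<comment> \<open>Taking \<open>q = p\<close> gives \<open>2 * u $ p * A $ k $ p = 0\<close>;
      with this entry gone, the pair \<open>p\<close>, \<open>q\<close> determines all
      others.\<close>
    have "A $ k $ p = 0" for k using pair[of p k p] p by simp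
    then have "A $ k $ q = 0" for k q using pair[of p k q] p by simp
    then show "A = 0" by (simp add: vec_eq_iff)
  qed
qed

text \<open>Comparison with \<open>weights_of B0\<close>: the risk of \<open>W\<close> exceeds the
  risk of that competitor by a positive definite form in the difference of the readouts plus the
  size of the residual. Optimality forces both to vanish.\<close>

lemma optimal_weights:
  fixes W :: "'d weights"
  assumes opt: "is_arg_min (risk T \<sigma> n) (\<lambda>_. True) W"
    and nondeg: "\<And>v. \<not> (AE w in T. w \<bullet> w = v)"
    and B0: "B0 ** moment_matrix S \<sigma> n = S"
    and pos: "\<And>D :: real^'d^'d. D \<noteq> 0 \<Longrightarrow> 0 < (D ** moment_matrix S \<sigma> n) \<bullet> D"
  shows "readout (key_matrix W) (key_vector W) (value_vector W) (value_coeff W) = B0"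
    and "value_coeff W *\<^sub>R key_vector W = 0" and "key_matrix W = 0 \<or> value_vector W = 0"
proof -
  let ?B = "readout (key_matrix W) (key_vector W) (value_vector W) (value_coeff W)"
  let ?e = "\<lambda>k. \<integral>p. (residual (key_matrix W) (key_vector W) (value_vector W) (value_coeff W) p $ k)\<^sup>2 \<partial>Q"
  let ?D = "?B - B0"
  have "\<not> risk T \<sigma> n (weights_of B0) < risk T \<sigma> n W"
    using opt unfolding is_arg_min_def by blast
  moreover have "transpose S = S"
    by (simp add: transpose_def vec_eq_iff S_sym)
  ultimately have le: "(?D ** moment_matrix S \<sigma> n) \<bullet> ?D + (\<Sum>k\<in>UNIV. ?e k) \<le> 0"
    unfolding risk_weights_of risk_decomposition[of W] using regression_error_minimal[of S B0 \<sigma> n ?B] B0 by simp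
  have e: "0 \<le> ?e k" for k by simp
  then have sum: "0 \<le> (\<Sum>k\<in>UNIV. ?e k)" by (simp add: sum_nonneg)
  have D: "?D = 0"
    using pos[of ?D] le sum by fastforce
  then show "?B = B0" by simp
  have "(\<Sum>k\<in>UNIV. ?e k) = 0" using le sum unfolding D by simp
  then have "?e k = 0" for k
    using e by (simp add: sum_nonneg_eq_0_iff)
  from residual_vanishes[OF nondeg this]
  show "value_coeff W *\<^sub>R key_vector W = 0" "key_matrix W = 0 \<or> value_vector W = 0" by auto
qed

lemma risk_without_residual:
  fixes W :: "'d weights"
  assumes "value_coeff W *\<^sub>R key_vector W = 0" "key_matrix W = 0 \<or> value_vector W = 0"
  shows "risk T \<sigma> n W = \<sigma>\<^sup>2 +
    regression_error S \<sigma> n (readout (key_matrix W) (key_vector W) (value_vector W) (value_coeff W))"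
  using residual_eq_0[OF assms] by (simp add: risk_decomposition)

end


section \<open>The limit\<close>

lemma trace_mult_transpose: "mat 1 \<bullet> (U ** transpose U) = mat 1 \<bullet> (transpose U ** U)" for U :: "real^'r^'d"
proof -
  have "mat 1 \<bullet> (U ** transpose U) = (\<Sum>k\<in>UNIV. \<Sum>j\<in>UNIV. U $ k $ j * U $ k $ j)"
    by (simp add: mat_1_inner matrix_matrix_mult_def transpose_def)
  also have "\<dots> = (\<Sum>j\<in>UNIV. \<Sum>k\<in>UNIV. U $ k $ j * U $ k $ j)" by (rule sum.swap)
  also have "\<dots> = mat 1 \<bullet> (transpose U ** U)"
    by (simp add: mat_1_inner matrix_matrix_mult_def transpose_def)
  finally show ?thesis .
qed

lemma mat_1_inner_mat_1: "(mat 1 :: real^'d^'d) \<bullet> mat 1 = real CARD('d)"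
  by (subst mat_1_inner) (simp add: mat_def)

lemma tendsto_matrix_mult:
  fixes A :: "'a \<Rightarrow> real^'n^'m" and B :: "'a \<Rightarrow> real^'k^'n"
  assumes "(A \<longlongrightarrow> X) F" "(B \<longlongrightarrow> Y) F"
  shows "((\<lambda>t. A t ** B t) \<longlongrightarrow> X ** Y) F"
proof (intro vec_tendstoI)
  fix i j
  have "((\<lambda>t. \<Sum>k\<in>UNIV. A t $ i $ k * B t $ k $ j) \<longlongrightarrow> (\<Sum>k\<in>UNIV. X $ i $ k * Y $ k $ j)) F"
    by (intro tendsto_intros assms)
  then show "((\<lambda>t. (A t ** B t) $ i $ j) \<longlongrightarrow> (X ** Y) $ i $ j) F"
    by (simp add: matrix_matrix_mult_def)
qed

lemma tendsto_regression_error: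
  assumes "(S \<longlongrightarrow> S0) F" "(B \<longlongrightarrow> B0) F"
  shows "((\<lambda>t. regression_error (S t) \<sigma> n (B t)) \<longlongrightarrow> regression_error S0 \<sigma> n B0) F"
  unfolding regression_error_def moment_matrix_def divide_inverse
  by (intro tendsto_intros tendsto_matrix_mult assms)

lemma matrix_inner_eq_trace: "X \<bullet> Y = mat 1 \<bullet> (Y ** transpose X)" for X Y :: "real^'d^'d"
  using matrix_mult_inner[of "mat 1" X Y] by simp

text \<open>A level set of \<open>w \<bullet> w\<close> lies in a sphere and is negligible, whereas
  the whole space is not. For negative \<open>v\<close> the level set and the sphere of radius
  \<open>sqrt v\<close> are both empty.\<close>

lemma AE_lborel_inner_not_constant: "\<not> (AE w in (lborel :: (real^'d) measure). w \<bullet> w = v)"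
proof
  assume AE: "AE w in (lborel :: (real^'d) measure). w \<bullet> w = v"
  have "{w :: real^'d. w \<bullet> w = v} \<subseteq> sphere 0 (sqrt v)"
    by (auto simp: norm_eq_sqrt_inner)
  then have "negligible {w :: real^'d. w \<bullet> w = v}"
    using negligible_sphere negligible_subset by blast
  then have "AE w in lebesgue. w \<notin> {w :: real^'d. w \<bullet> w = v}"
    by (intro AE_not_in) (simp add: negligible_iff_null_sets)
  moreover have "AE w in lebesgue. (w :: real^'d) \<bullet> w = v"
    using AE by (rule AE_completion)
  ultimately have "AE w in (lebesgue :: (real^'d) measure). False"
    by eventually_elim simp
  then have "(UNIV :: (real^'d) set) \<in> null_sets lebesgue"
    by (subst (asm) AE_iff_measurable[of UNIV]) auto
  then show False by (simp flip: negligible_iff_null_sets)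
qed

locale orthogonal_factors =
  fixes U1 U2 :: "real^'r^'d"
  assumes orth1: "transpose U1 ** U1 = mat 1"
    and orth2: "transpose U2 ** U2 = mat 1"
    and orth12: "transpose U1 ** U2 = 0"
begin

lemma orth21: "transpose U2 ** U1 = 0"
proof -
  have "transpose (transpose U1 ** U2) = transpose U2 ** U1" by (simp add: matrix_transpose_mul)
  moreover have "transpose (0 :: real^'r^'r) = 0" by (simp add: transpose_def vec_eq_iff)
  ultimately show ?thesis by (simp add: orth12)
qed

definition P :: "real^'d^'d" where
  "P = U1 ** transpose U1 + U2 ** transpose U2"

definition Ut :: "real \<Rightarrow> real^'r^'d" where
  "Ut \<theta> = cos \<theta> *\<^sub>R U1 + sin \<theta> *\<^sub>R U2"

lemma P_transpose: "transpose P = P"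
  by (simp add: P_def transpose_add matrix_transpose_mul)

lemma P_U: "P ** U1 = U1" "P ** U2 = U2"
  by (simp_all add: P_def matrix_add_rdistrib matrix_mul_assoc[symmetric] orth1 orth2 orth12 orth21)

lemma P_idem: "P ** P = P"
proof -
  have "P ** P = P ** U1 ** transpose U1 + P ** U2 ** transpose U2"
    by (subst (2) P_def) (simp add: matrix_add_ldistrib matrix_mul_assoc)
  then show ?thesis by (simp add: P_U) (simp add: P_def)
qed

lemma trace_P: "mat 1 \<bullet> P = 2 * real CARD('r)"
  by (simp add: P_def inner_add_right trace_mult_transpose orth1 orth2 mat_1_inner_mat_1)

lemma Ut_orth: "transpose (Ut \<theta>) ** Ut \<theta> = mat 1"
proof -
  have "transpose (Ut \<theta>) ** Ut \<theta> = (cos \<theta> * cos \<theta>) *\<^sub>R mat 1 + (sin \<theta> * sin \<theta>) *\<^sub>R mat 1"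
    by (simp add: Ut_def transpose_add transpose_scalar matrix_bilinear orth1 orth2 orth12 orth21)
  also have "\<dots> = (cos \<theta> * cos \<theta> + sin \<theta> * sin \<theta>) *\<^sub>R mat 1"
    by (simp only: scaleR_add_left)
  finally show ?thesis
    using sin_cos_squared_add2[of \<theta>] by (simp add: power2_eq_square)
qed

text \<open>For every angle the columns of \<open>Ut \<theta>\<close> lie in the span of the two
  training subspaces, on which \<open>P\<close> is the identity; this is why the final limit does
  not depend on \<theta>.\<close>

lemma P_Ut: "P ** (Ut \<theta> ** transpose (Ut \<theta>)) = Ut \<theta> ** transpose (Ut \<theta>)"
proof -
  have "P ** Ut \<theta> = Ut \<theta>"
    by (simp add: Ut_def matrix_add_ldistrib matrix_scaleR_right P_U)
  then show ?thesis by (simp add: matrix_mul_assoc)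
qed

lemma train_cov: "(1/2) *\<^sub>R spiked_cov U1 \<epsilon> + (1/2) *\<^sub>R spiked_cov U2 \<epsilon> = (1/2) *\<^sub>R P + \<epsilon> *\<^sub>R mat 1"
  by (simp add: vec_eq_iff spiked_cov_def P_def field_simps)

text \<open>The coefficient of the identity in the training moment matrix. Half the trace of
  \<open>P\<close> is \<open>r\<close>, so the covariance \<open>P/2 + \<epsilon> I\<close> has
  trace \<open>r + d * \<epsilon>\<close>.\<close>

definition ridge :: "real \<Rightarrow> nat \<Rightarrow> real \<Rightarrow> real" where
  "ridge \<sigma> n \<epsilon> = (1 + 1 / real n) * \<epsilon> + (real CARD('r) + real CARD('d) * \<epsilon> + \<sigma>\<^sup>2) / real n"

text \<open>Solution of the normal equation of the form \<open>p P + q I\<close>. With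
  \<open>a = (1 + 1/n)/2\<close> and \<rho> the ridge, comparison of coefficients gives
  \<open>q * \<rho> = \<epsilon>\<close> and \<open>p * (a + \<rho>) + q * a = 1/2\<close>.\<close>

definition optimal_readout :: "real \<Rightarrow> nat \<Rightarrow> real \<Rightarrow> real^'d^'d" where
  "optimal_readout \<sigma> n \<epsilon> =
     ((1/2 - \<epsilon> / ridge \<sigma> n \<epsilon> * ((1 + 1 / real n) / 2)) / ((1 + 1 / real n) / 2 + ridge \<sigma> n \<epsilon>)) *\<^sub>R P +
     (\<epsilon> / ridge \<sigma> n \<epsilon>) *\<^sub>R mat 1"

lemma train_moment_matrix:
  "moment_matrix ((1/2) *\<^sub>R P + \<epsilon> *\<^sub>R mat 1) \<sigma> n = ((1 + 1 / real n) / 2) *\<^sub>R P + ridge \<sigma> n \<epsilon> *\<^sub>R mat 1"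
  by (simp add: moment_matrix_def ridge_def inner_add_right trace_P mat_1_inner_mat_1 scaleR_add_right scaleR_add_left mult.commute)

lemma ridge_pos: "n \<ge> 1 \<Longrightarrow> \<epsilon> \<ge> 0 \<Longrightarrow> 0 < ridge \<sigma> n \<epsilon>"
  unfolding ridge_def by (intro add_nonneg_pos divide_pos_pos add_pos_nonneg mult_nonneg_nonneg) auto

lemma optimal_readout_eq:
  assumes "n \<ge> 1" "\<epsilon> > 0"
  shows "optimal_readout \<sigma> n \<epsilon> ** moment_matrix ((1/2) *\<^sub>R P + \<epsilon> *\<^sub>R mat 1) \<sigma> n = (1/2) *\<^sub>R P + \<epsilon> *\<^sub>R mat 1"
proof -
  define a where "a = (1 + 1 / real n) / 2"
  define r where "r = ridge \<sigma> n \<epsilon>"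
  define q where "q = \<epsilon> / r"
  define p where "p = (1/2 - q * a) / (a + r)"
  have r: "r > 0" using ridge_pos assms by (simp add: r_def)
  have a: "a > 0" by (simp add: a_def add_pos_nonneg)
  have "p * (a + r) = 1/2 - q * a" using a r by (simp add: p_def)
  then have "p * a + p * r + q * a = 1/2" by (simp add: algebra_simps)
  moreover have "q * r = \<epsilon>" using r by (simp add: q_def)
  ultimately show ?thesis
    unfolding train_moment_matrix optimal_readout_def a_def[symmetric] r_def[symmetric] q_def[symmetric] p_def[symmetric]
      projection_pencil_mult[OF P_idem] by simp
qed

text \<open>\<open>P\<close> is symmetric and idempotent, so its part of the form is the squared
  norm of \<open>D ** P\<close>; strictness comes from the positive ridge.\<close>

lemma train_coercive:
  assumes "n \<ge> 1" "\<epsilon> > 0" "D \<noteq> 0"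
  shows "0 < (D ** moment_matrix ((1/2) *\<^sub>R P + \<epsilon> *\<^sub>R mat 1) \<sigma> n) \<bullet> D"
proof -
  have "(D ** P) \<bullet> D = (D ** P) \<bullet> (D ** P)"
  proof -
    have "(D ** P) \<bullet> D = ((D ** P) ** P) \<bullet> D"
      by (simp add: P_idem flip: matrix_mul_assoc)
    also have "\<dots> = (D ** P) \<bullet> (D ** P)"
      by (simp only: matrix_mult_inner[of "D ** P"] P_transpose)
    finally show ?thesis .
  qed
  then have "(D ** moment_matrix ((1/2) *\<^sub>R P + \<epsilon> *\<^sub>R mat 1) \<sigma> n) \<bullet> D =
      ((1 + 1 / real n) / 2) * ((D ** P) \<bullet> (D ** P)) + ridge \<sigma> n \<epsilon> * (D \<bullet> D)"
    unfolding train_moment_matrix by (simp add: matrix_add_ldistrib matrix_scaleR_right inner_add_left)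
  moreover have "0 < ridge \<sigma> n \<epsilon> * (D \<bullet> D)"
    using ridge_pos assms by simp
  ultimately show ?thesis by (simp add: add_nonneg_pos)
qed

text \<open>The conclusions of \<open>optimal_weights\<close> are algebraic conditions on
  \<open>W\<close>, free of length and law, so they can be read in the test model although they were
  derived in the training model.\<close>

lemma optimal_test_risk:
  fixes W :: "'d weights"
  assumes \<sigma>: "\<sigma> \<ge> 0" and n: "n \<ge> 1" and m: "m \<ge> 1" and \<epsilon>: "\<epsilon> > 0"
    and opt: "is_arg_min (risk (gauss_mixture (spiked_cov U1 \<epsilon>) (spiked_cov U2 \<epsilon>)) \<sigma> n) (\<lambda>_. True) W"
  shows "risk (gauss_law (spiked_cov (Ut \<theta>) \<epsilon>)) \<sigma> m W =
    \<sigma>\<^sup>2 + regression_error (spiked_cov (Ut \<theta>) \<epsilon>) \<sigma> m (optimal_readout \<sigma> n \<epsilon>)"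
proof -
  let ?T = "gauss_mixture (spiked_cov U1 \<epsilon>) (spiked_cov U2 \<epsilon>)" and ?S = "(1/2) *\<^sub>R P + \<epsilon> *\<^sub>R mat 1"
  note dens = gauss_density_spiked_pos[OF orth1 \<epsilon>] gauss_density_spiked_pos[OF orth2 \<epsilon>]
  have "centred_law ?T ?S"
    unfolding train_cov[symmetric]
    by (intro centred_law_mixture centred_law_spiked orth1 orth2 \<epsilon> less_imp_le[OF dens(1)] less_imp_le[OF dens(2)])
  then interpret train: context_model ?T ?S \<sigma> n
    using \<sigma> n by (intro context_model.intro context_model_axioms.intro)
  have "centred_law (gauss_law (spiked_cov (Ut \<theta>) \<epsilon>)) (spiked_cov (Ut \<theta>) \<epsilon>)"
    by (intro centred_law_spiked Ut_orth \<epsilon>)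
  then interpret test: context_model "gauss_law (spiked_cov (Ut \<theta>) \<epsilon>)" "spiked_cov (Ut \<theta>) \<epsilon>" \<sigma> m
    using \<sigma> m by (intro context_model.intro context_model_axioms.intro)
  have nondeg: "\<not> (AE w in ?T. w \<bullet> w = v)" for v
    using AE_gauss_mixture_imp_lborel[OF _ dens] AE_lborel_inner_not_constant by blast
  note W = train.optimal_weights[OF opt nondeg optimal_readout_eq[OF n \<epsilon>] train_coercive[OF n \<epsilon>]]
  show ?thesis
    using test.risk_without_residual[OF W(2,3)] by (simp add: W(1))
qed

text \<open>On the range of \<open>P\<close> and at \<open>\<epsilon> = 0\<close>, the eigenvalue
  1/2 of the training covariance divided by that of its moment matrix.\<close>

definition limit_coeff :: "real \<Rightarrow> nat \<Rightarrow> real" where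
  "limit_coeff \<sigma> n = (1/2) / ((1 + 1 / real n) / 2 + (real CARD('r) + \<sigma>\<^sup>2) / real n)"

text \<open>The ridge has a positive limit for fixed \<open>n\<close>, so the identity part
  \<open>\<epsilon> / ridge \<sigma> n \<epsilon>\<close> dies out.\<close>

lemma tendsto_optimal_readout:
  assumes n: "n \<ge> 1"
  shows "(optimal_readout \<sigma> n \<longlongrightarrow> limit_coeff \<sigma> n *\<^sub>R P) (at_right 0)"
proof -
  have "((\<lambda>\<epsilon>. (1 + 1 / real n) * \<epsilon> + (real CARD('r) + real CARD('d) * \<epsilon> + \<sigma>\<^sup>2) / real n) \<longlongrightarrow>
      (1 + 1 / real n) * 0 + (real CARD('r) + real CARD('d) * 0 + \<sigma>\<^sup>2) / real n) (at_right 0)"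
    unfolding divide_inverse by (intro tendsto_intros)
  then have ridge: "(ridge \<sigma> n \<longlongrightarrow> ridge \<sigma> n 0) (at_right 0)"
    by (simp add: ridge_def[abs_def])
  have pos: "0 < ridge \<sigma> n 0" using n by (rule ridge_pos) simp
  have "0 < (1 + 1 / real n) / 2" by (simp add: add_pos_nonneg)
  from add_pos_pos[OF this pos] have "(optimal_readout \<sigma> n \<longlongrightarrow>
      ((1/2 - 0 / ridge \<sigma> n 0 * ((1 + 1 / real n) / 2)) / ((1 + 1 / real n) / 2 + ridge \<sigma> n 0)) *\<^sub>R P +
      (0 / ridge \<sigma> n 0) *\<^sub>R mat 1) (at_right 0)"
    unfolding optimal_readout_def[abs_def] using pos
    by (intro tendsto_intros ridge) auto
  then show ?thesis by (simp add: limit_coeff_def ridge_def)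
qed

lemma tendsto_limit_coeff: "(limit_coeff \<sigma>) \<longlonglongrightarrow> 1"
proof -
  have "(\<lambda>n. (1/2) / ((1 + 1 / real n) / 2 + (real CARD('r) + \<sigma>\<^sup>2) / real n)) \<longlonglongrightarrow> (1/2) / ((1 + 0) / 2 + 0)"
    by (intro tendsto_intros lim_const_over_n) auto
  then show ?thesis by (simp add: limit_coeff_def[abs_def])
qed

text \<open>Three traces decide the value: those of the test covariance and of its product with
  \<open>P\<close> are \<open>r\<close>, while \<open>P\<close> itself has trace
  \<open>2 * r\<close>, which enters with the multiple of the identity in the moment matrix.\<close>

lemma regression_error_limit:
  "regression_error (Ut \<theta> ** transpose (Ut \<theta>)) \<sigma> m (\<beta> *\<^sub>R P) =
    real CARD('r) - 2 * \<beta> * real CARD('r) +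
    \<beta>\<^sup>2 * ((1 + 1 / real m) * real CARD('r) + ((real CARD('r) + \<sigma>\<^sup>2) / real m) * (2 * real CARD('r)))"
proof -
  let ?R = "Ut \<theta> ** transpose (Ut \<theta>)"
  have tr: "mat 1 \<bullet> ?R = real CARD('r)"
    by (simp add: trace_mult_transpose Ut_orth mat_1_inner_mat_1)
  have RP: "?R ** P = ?R"
  proof -
    have "transpose (P ** ?R) = ?R ** P" by (simp add: matrix_transpose_mul P_transpose)
    then show ?thesis by (simp add: P_Ut matrix_transpose_mul)
  qed
  have PR: "P \<bullet> ?R = real CARD('r)"
    by (simp add: matrix_inner_eq_trace[of P] P_transpose RP tr)
  have PP: "P \<bullet> P = 2 * real CARD('r)"
    by (simp add: matrix_inner_eq_trace[of P] P_transpose P_idem trace_P)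
  show ?thesis
    unfolding regression_error_def moment_matrix_def tr
    by (simp add: matrix_add_ldistrib matrix_scaleR_left matrix_scaleR_right P_Ut inner_add_left PR PP
        inner_commute[of ?R P] power2_eq_square algebra_simps)
qed

end

text \<open>The optimal models enter as an arbitrary choice of minimisers. The nested limits are
  expressed through their intermediate values \<open>L\<close> and \<open>L'\<close>, so the
  existence of each limit is part of the claim.\<close>

theorem theorem1:
  fixes U1 U2 :: "real^'r^'d"
    and \<sigma> :: real
    and Wopt :: "nat \<Rightarrow> real \<Rightarrow> 'd weights"
  assumes dim: "CARD('d) > 2 * CARD('r)"
    and sigma: "\<sigma> \<ge> 0"
    and orth1: "transpose U1 ** U1 = mat 1"
    and orth2: "transpose U2 ** U2 = mat 1"
    and orth12: "transpose U1 ** U2 = 0"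
    and optimal: "\<And>n \<epsilon>. n \<ge> 1 \<Longrightarrow> \<epsilon> > 0 \<Longrightarrow>
      is_arg_min (risk (gauss_mixture (spiked_cov U1 \<epsilon>) (spiked_cov U2 \<epsilon>)) \<sigma> n)
        (\<lambda>_. True) (Wopt n \<epsilon>)"
  shows "\<forall>\<theta>\<in>{0..pi/2}. \<exists>(L :: nat \<Rightarrow> nat \<Rightarrow> real) (L' :: nat \<Rightarrow> real).
      (\<forall>m\<ge>1. \<forall>n\<ge>1.
        ((\<lambda>\<epsilon>. risk (gauss_law (spiked_cov (cos \<theta> *\<^sub>R U1 + sin \<theta> *\<^sub>R U2) \<epsilon>)) \<sigma> m (Wopt n \<epsilon>))
          \<longlongrightarrow> L m n) (at_right 0)) \<and>
      (\<forall>m\<ge>1. (\<lambda>n. L m n) \<longlonglongrightarrow> L' m) \<and>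
      L' \<longlonglongrightarrow> \<sigma>\<^sup>2"
proof
  fix \<theta> :: real
  interpret orthogonal_factors U1 U2
    by unfold_locales (rule orth1 orth2 orth12)+
  let ?r = "real CARD('r)"
  define R where "R = Ut \<theta> ** transpose (Ut \<theta>)"
  \<comment> \<open>The test risk at \<open>\<epsilon> = 0\<close> for the readout
    \<open>\<beta> *\<^sub>R P\<close>. The training length acts on it through \<beta> alone, and it
    is continuous in \<beta>.\<close>
  define G where "G m \<beta> = \<sigma>\<^sup>2 + (?r - 2 * \<beta> * ?r +
      \<beta>\<^sup>2 * ((1 + 1 / real m) * ?r + ((?r + \<sigma>\<^sup>2) / real m) * (2 * ?r)))" for m \<beta>
  have G: "G m \<beta> = \<sigma>\<^sup>2 + regression_error R \<sigma> m (\<beta> *\<^sub>R P)" for m \<beta>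
    by (simp add: G_def R_def regression_error_limit)
  have "((\<lambda>\<epsilon>. risk (gauss_law (spiked_cov (Ut \<theta>) \<epsilon>)) \<sigma> m (Wopt n \<epsilon>)) \<longlongrightarrow> G m (limit_coeff \<sigma> n)) (at_right 0)"
    if m: "m \<ge> 1" and n: "n \<ge> 1" for m n
  proof -
    have "((\<lambda>\<epsilon>. R + \<epsilon> *\<^sub>R mat 1) \<longlongrightarrow> R + 0 *\<^sub>R mat 1) (at_right 0)"
      by (intro tendsto_intros)
    then have "(spiked_cov (Ut \<theta>) \<longlongrightarrow> R) (at_right 0)"
      by (simp add: spiked_cov_def[abs_def] R_def)
    then have "((\<lambda>\<epsilon>. \<sigma>\<^sup>2 + regression_error (spiked_cov (Ut \<theta>) \<epsilon>) \<sigma> m (optimal_readout \<sigma> n \<epsilon>)) \<longlongrightarrow>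
        G m (limit_coeff \<sigma> n)) (at_right 0)"
      unfolding G by (intro tendsto_add tendsto_const tendsto_regression_error tendsto_optimal_readout n)
    moreover have "\<forall>\<^sub>F \<epsilon> in at_right 0. \<sigma>\<^sup>2 + regression_error (spiked_cov (Ut \<theta>) \<epsilon>) \<sigma> m (optimal_readout \<sigma> n \<epsilon>) =
        risk (gauss_law (spiked_cov (Ut \<theta>) \<epsilon>)) \<sigma> m (Wopt n \<epsilon>)"
      using eventually_at_right_less[of 0]
      by eventually_elim (rule optimal_test_risk[OF sigma n m _ optimal[OF n], symmetric])
    ultimately show ?thesis by (rule Lim_transform_eventually)
  qed
  moreover have "(\<lambda>n. G m (limit_coeff \<sigma> n)) \<longlonglongrightarrow> G m 1" for m
    unfolding G_def by (intro tendsto_intros tendsto_limit_coeff)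
  moreover have "(\<lambda>m. G m 1) \<longlonglongrightarrow> \<sigma>\<^sup>2"
  proof -
    \<comment> \<open>At \<open>\<beta> = 1\<close> the terms \<open>r - 2 r + r\<close> cancel, and
      everything else besides \<open>\<sigma>^2\<close> carries a factor \<open>1/m\<close>.\<close>
    have "(\<lambda>m. G m 1) \<longlonglongrightarrow> \<sigma>\<^sup>2 + (?r - 2 * 1 * ?r + 1\<^sup>2 * ((1 + 0) * ?r + 0 * (2 * ?r)))"
      unfolding G_def by (intro tendsto_intros lim_const_over_n)
    then show ?thesis by simp
  qed
  ultimately show "\<exists>(L :: nat \<Rightarrow> nat \<Rightarrow> real) (L' :: nat \<Rightarrow> real).
      (\<forall>m\<ge>1. \<forall>n\<ge>1.
        ((\<lambda>\<epsilon>. risk (gauss_law (spiked_cov (cos \<theta> *\<^sub>R U1 + sin \<theta> *\<^sub>R U2) \<epsilon>)) \<sigma> m (Wopt n \<epsilon>))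
          \<longlongrightarrow> L m n) (at_right 0)) \<and>
      (\<forall>m\<ge>1. (\<lambda>n. L m n) \<longlonglongrightarrow> L' m) \<and>
      L' \<longlonglongrightarrow> \<sigma>\<^sup>2"
    unfolding Ut_def by (intro exI[of _ "\<lambda>m n. G m (limit_coeff \<sigma> n)"] exI[of _ "\<lambda>m. G m 1"]) auto
qed

end
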